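(* For $n\geq 1$ let $t_n$ (respectively $\tau_n$) denote the number of all labeled (respectively unlabeled) trees on $n$ vertices, and let $b_n'$ (respectively $b_n''$) denote the number of all balanced labeled (respectively balanced unlabeled) trees on $n$ vertices. Then $$\lim_{n\rightarrow\infty}\frac{b_n'}{t_n}=1\qquad\text{and}\qquad \lim_{n\rightarrow\infty}\frac{b_n''}{\tau_n}=1.$$
   Context: A labeled tree on $n$ vertices is a tree with vertex set $\{1,\ldots,n\}$; an unlabeled tree on $n$ vertices is an isomorphism class of trees with $n$ vertices. A finite simple graph $G=(V,E)$ is called balanced if there exists a map (coloring) $c:V\rightarrow\{1,2\}$ such that $|v_1(c)-v_2(c)|\leq 1$ and $|e_1(c)-e_2(c)|\leq 1$, where $v_i(c)=|c^{-1}(\{i\})|$ is the number of vertices of color $i$ and $e_i(c)$ is the number of edges $uv\in E$ with $c(u)=c(v)=i$. An unlabeled tree is balanced if any (equivalently every) representative of the isomorphism class is balanced. *)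

theory Defs
  imports Complex_Main "Graph_Theory.Digraph_Component" "Graph_Theory.Digraph_Isomorphism"
begin

text \<open>
  A finite simple graph is a \<^locale>\<open>pair_graph\<close>: a finite vertex set with a finite, symmetric and
  irreflexive set of arcs. An undirected edge \<open>uv\<close> is thus represented by the two arcs
  \<open>(u,v)\<close> and \<open>(v,u)\<close>.

  The library predicate \<open>Digraph_Component.tree\<close> is not usable here: it forbids directed cycles,
  and in a symmetric digraph every edge yields the directed cycle \<open>u, v, u\<close>. A cycle of the
  underlying simple graph is a directed cycle of length at least 3.
\<close>

definition simple_tree :: "'a pair_pre_digraph \<Rightarrow> bool" where
  "simple_tree G \<longleftrightarrow> pair_graph G \<and> Digraph_Component.connected (with_proj G) \<and>
     \<not> (\<exists>p. pre_digraph.cycle (with_proj G) p \<and> 3 \<le> length p)"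

definition num_verts_of_color :: "'a pair_pre_digraph \<Rightarrow> ('a \<Rightarrow> nat) \<Rightarrow> nat \<Rightarrow> nat" where
  "num_verts_of_color G c i = card {v \<in> pverts G. c v = i}"

text \<open>Edges are counted as unordered pairs, so that the two arcs of an edge count once.\<close>

definition num_edges_of_color :: "'a pair_pre_digraph \<Rightarrow> ('a \<Rightarrow> nat) \<Rightarrow> nat \<Rightarrow> nat" where
  "num_edges_of_color G c i = card {{u, v} | u v. (u, v) \<in> parcs G \<and> c u = i \<and> c v = i}"

definition balanced :: "'a pair_pre_digraph \<Rightarrow> bool" where
  "balanced G \<longleftrightarrow> (\<exists>c :: 'a \<Rightarrow> nat. c ` pverts G \<subseteq> {1, 2} \<and>
     \<bar>int (num_verts_of_color G c 1) - int (num_verts_of_color G c 2)\<bar> \<le> 1 \<and>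
     \<bar>int (num_edges_of_color G c 1) - int (num_edges_of_color G c 2)\<bar> \<le> 1)"

definition labeled_trees :: "nat \<Rightarrow> nat pair_pre_digraph set" where
  "labeled_trees n = {G. simple_tree G \<and> pverts G = {1..n}}"

definition tree_iso :: "nat \<Rightarrow> (nat pair_pre_digraph \<times> nat pair_pre_digraph) set" where
  "tree_iso n = {(G, H). G \<in> labeled_trees n \<and> H \<in> labeled_trees n \<and>
     digraph_iso (with_proj G) (with_proj H)}"

text \<open>
  Every tree with \<open>n\<close> vertices is isomorphic to one with vertex set \<open>{1..n}\<close>, so the isomorphism
  classes of trees with \<open>n\<close> vertices correspond to the classes of labeled trees.
\<close>

definition unlabeled_trees :: "nat \<Rightarrow> nat pair_pre_digraph set set" where
  "unlabeled_trees n = labeled_trees n // tree_iso n"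

definition balanced_labeled_trees :: "nat \<Rightarrow> nat pair_pre_digraph set" where
  "balanced_labeled_trees n = {G \<in> labeled_trees n. balanced G}"

text \<open>
  By \<open>balanced_unlabeled_trees_altdef\<close> below, \<open>some representative\<close> may be replaced by
  \<open>every representative\<close>.
\<close>

definition balanced_unlabeled_trees :: "nat \<Rightarrow> nat pair_pre_digraph set set" where
  "balanced_unlabeled_trees n = {C \<in> unlabeled_trees n. \<exists>G \<in> C. balanced G}"


lemma finite_labeled_trees: "finite (labeled_trees n)"
proof -
  have "labeled_trees n \<subseteq>
      (\<lambda>A. \<lparr>pverts = {1..n}, parcs = A\<rparr>) ` Pow ({1..n} \<times> {1..n})"
  proof
    fix G assume G: "G \<in> labeled_trees n"
    then have "pair_graph G" and V: "pverts G = {1..n}"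
      by (auto simp: labeled_trees_def simple_tree_def)
    then interpret pair_graph G by simp
    have "parcs G \<subseteq> {1..n} \<times> {1..n}"
      using arc_fst_in_verts arc_snd_in_verts V by (metis mem_Times_iff subsetI)
    moreover have "G = \<lparr>pverts = {1..n}, parcs = parcs G\<rparr>"
      using V by (cases G) simp
    ultimately show "G \<in> (\<lambda>A. \<lparr>pverts = {1..n}, parcs = A\<rparr>) ` Pow ({1..n} \<times> {1..n})"
      by blast
  qed
  then show ?thesis by (rule finite_subset) simp
qed

lemma pair_graph_digraph_iso_iff:
  assumes "pair_graph G"
  shows "digraph_iso (with_proj G) (with_proj H) \<longleftrightarrow>
    (\<exists>f. inj_on f (pverts G) \<and> pverts H = f ` pverts G \<and> parcs H = map_prod f f ` parcs G)"
    (is "?L \<longleftrightarrow> ?R")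
proof
  interpret pair_graph G by fact
  assume ?L
  then obtain h where h: "digraph_isomorphism h" and H: "with_proj H = app_iso h (with_proj G)"
    by (auto simp: digraph_iso_def)
  have V: "pverts H = iso_verts h ` pverts G" and A: "parcs H = iso_arcs h ` parcs G"
    and "iso_tail h = fst" "iso_head h = snd"
    using H by (auto simp: app_iso_def with_proj_def)
  then have "iso_arcs h a = map_prod (iso_verts h) (iso_verts h) a" if "a \<in> parcs G" for a
    using h that by (cases a) (auto simp: digraph_isomorphism_def prod_eq_iff)
  then have "parcs H = map_prod (iso_verts h) (iso_verts h) ` parcs G"
    using A by auto
  then show ?R using h V by (auto simp: digraph_isomorphism_def)
next
  interpret pair_graph G by fact
  assume ?R
  then obtain f where f: "inj_on f (pverts G)" "pverts H = f ` pverts G"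
    "parcs H = map_prod f f ` parcs G" by blast
  define h where "h = \<lparr>iso_verts = f, iso_arcs = map_prod f f, iso_head = snd, iso_tail = fst\<rparr>"
  have "inj_on (map_prod f f) (parcs G)"
    using map_prod_inj_on[OF f(1) f(1)]
    by (rule inj_on_subset) (auto dest: in_arcsD1 in_arcsD2)
  then have "digraph_isomorphism h"
    using f(1) wf_digraph by (simp add: digraph_isomorphism_def h_def)
  moreover have "with_proj H = app_iso h (with_proj G)"
    using f by (simp add: app_iso_def with_proj_def h_def)
  ultimately show ?L by (auto simp: digraph_iso_def)
qed

lemma equiv_tree_iso: "equiv (labeled_trees n) (tree_iso n)"
proof -
  have pg: "pair_graph G" if "G \<in> labeled_trees n" for G
    using that by (simp add: labeled_trees_def simple_tree_def)
  have "refl_on (labeled_trees n) (tree_iso n)"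
  proof (rule refl_onI)
    fix G assume "G \<in> labeled_trees n"
    moreover from pg[OF this] have "digraph_iso (with_proj G) (with_proj G)"
      by (subst pair_graph_digraph_iso_iff) (auto intro!: exI[of _ id] simp: map_prod.id)
    ultimately show "(G, G) \<in> tree_iso n" by (simp add: tree_iso_def)
  qed
  moreover have "sym (tree_iso n)"
  proof (rule symI)
    fix G H assume GH: "(G, H) \<in> tree_iso n"
    then interpret pair_graph G by (auto simp: tree_iso_def pg)
    from GH show "(H, G) \<in> tree_iso n"
      by (auto simp: tree_iso_def intro: digraph_iso_swap[OF wf_digraph])
  qed
  moreover have "trans (tree_iso n)"
    by (rule transI) (auto simp: tree_iso_def intro: digraph_iso_trans)
  ultimately show ?thesis by (auto simp: equiv_def tree_iso_def)
qed

lemma balanced_iso: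
  assumes "pair_graph G" "digraph_iso (with_proj G) (with_proj H)" "balanced G"
  shows "balanced H"
proof -
  interpret pair_graph G by fact
  obtain f where f: "inj_on f (pverts G)" "pverts H = f ` pverts G"
    "parcs H = map_prod f f ` parcs G"
    using assms(2) unfolding pair_graph_digraph_iso_iff[OF assms(1)] by blast
  obtain c where c: "c ` pverts G \<subseteq> {1, 2::nat}"
     "\<bar>int (num_verts_of_color G c 1) - int (num_verts_of_color G c 2)\<bar> \<le> 1"
     "\<bar>int (num_edges_of_color G c 1) - int (num_edges_of_color G c 2)\<bar> \<le> 1"
    using assms(3) by (auto simp: balanced_def)
  define d where "d = c \<circ> the_inv_into (pverts G) f"
  have d: "d (f v) = c v" if "v \<in> pverts G" for v
    using that f(1) by (simp add: d_def the_inv_into_f_f)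
  have verts: "num_verts_of_color H d i = num_verts_of_color G c i" for i
  proof -
    have "{v \<in> pverts H. d v = i} = f ` {v \<in> pverts G. c v = i}"
      using f(2) d by auto
    moreover have "inj_on f {v \<in> pverts G. c v = i}"
      using f(1) by (rule inj_on_subset) auto
    ultimately show ?thesis by (simp add: num_verts_of_color_def card_image)
  qed
  have edges: "num_edges_of_color H d i = num_edges_of_color G c i" for i
  proof -
    let ?E = "{{u, v} | u v. (u, v) \<in> parcs G \<and> c u = i \<and> c v = i}"
    let ?F = "{{u, v} | u v. (u, v) \<in> parcs H \<and> d u = i \<and> d v = i}"
    have "?F = (`) f ` ?E"
    proof (intro equalityI subsetI)
      fix e assume "e \<in> ?F"
      then obtain u v where uv: "(u, v) \<in> parcs G" "e = {f u, f v}" "d (f u) = i" "d (f v) = i"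
        by (auto simp: f(3))
      moreover from uv(1) have "u \<in> pverts G" "v \<in> pverts G" by (auto dest: in_arcsD1 in_arcsD2)
      ultimately have "{u, v} \<in> ?E" "e = f ` {u, v}" using d by auto
      then show "e \<in> (`) f ` ?E" by blast
    next
      fix e assume "e \<in> (`) f ` ?E"
      then obtain u v where uv: "(u, v) \<in> parcs G" "e = {f u, f v}" "c u = i" "c v = i"
        by auto
      moreover from uv(1) have "u \<in> pverts G" "v \<in> pverts G" by (auto dest: in_arcsD1 in_arcsD2)
      moreover have "(f u, f v) \<in> parcs H" using uv(1) f(3) by force
      ultimately have "(f u, f v) \<in> parcs H \<and> d (f u) = i \<and> d (f v) = i"
        using d by simp
      then show "e \<in> ?F" unfolding uv(2) by blast
    qed
    moreover have "inj_on ((`) f) ?E"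
      using inj_on_image_Pow[OF f(1)]
      by (rule inj_on_subset) (auto dest: in_arcsD1 in_arcsD2)
    ultimately show ?thesis by (simp add: num_edges_of_color_def card_image)
  qed
  have "d ` pverts H \<subseteq> {1, 2}" using c(1) d f(2) by auto
  with c verts edges show ?thesis unfolding balanced_def by metis
qed

lemma balanced_unlabeled_trees_altdef:
  "balanced_unlabeled_trees n = {C \<in> unlabeled_trees n. \<forall>G \<in> C. balanced G}"
proof -
  have "(\<exists>G \<in> C. balanced G) \<longleftrightarrow> (\<forall>G \<in> C. balanced G)" if C: "C \<in> unlabeled_trees n" for C
  proof -
    have ne: "C \<noteq> {}"
      using C equiv_tree_iso in_quotient_imp_non_empty unfolding unlabeled_trees_def by blast
    have "balanced H" if "G \<in> C" "balanced G" "H \<in> C" for G H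
    proof -
      have "(G, H) \<in> tree_iso n"
        using C equiv_tree_iso quotient_eq_iff that unfolding unlabeled_trees_def by metis
      then show ?thesis
        using balanced_iso that(2) by (auto simp: tree_iso_def labeled_trees_def simple_tree_def)
    qed
    with ne show ?thesis by blast
  qed
  then show ?thesis unfolding balanced_unlabeled_trees_def by blast
qed

end

theory Submission
  imports Defs "HOL-Analysis.Infinite_Sum" "HOL-Analysis.Convex" "HOL-Library.Multiset" "HOL-Library.FuncSet" "HOL-Real_Asymp.Real_Asymp"
begin

text \<open>
  Root a tree. A colouring by signs is balanced as soon as the signs and the signs weighted by the
  numbers of children both have sums in \<open>{-1, 0, 1}\<close>. Greedy pairing of vertices yields such signs
  whenever there are at least as many vertices with exactly one child as any vertex has children.
  So it remains to show that the trees with fewer unary vertices than the maximal number of children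
  are rare.

  Labelled trees: there are at least \<open>n^(n-2)\<close> of them, while the bad ones inject into the functions
  from \<open>n - 1\<close> to \<open>n\<close> points with the same property of the fibres, and an exponential moment of the
  fibre sizes bounds the number of those by \<open>n! (e - 1/2)^(n-1) e^2\<close>.

  Unlabelled trees: rooting changes the count by a factor of at most \<open>n\<close>. If every unary vertex of a
  rooted tree is given the weight \<open>u < 1\<close>, the radius of convergence of the generating function grows
  strictly beyond that of all rooted trees, even when the tree is also weighted by \<open>u^(-d)\<close>, \<open>d\<close> the
  maximal number of children. So the bad trees are exponentially rare.
\<close>

section \<open>Rooted trees as parent functions\<close>

text \<open>Doubled, the difference of the two monochromatic edge counts is a sum of signs weighted
  by degrees; rooting turns degrees into numbers of children up to a bounded error, and leaves get
  weight 0. A rooted tree has at least as many leaves as any vertex has children, so only unary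
  vertices can be in short supply.

  The unlabelled case is the harder one, since no asymptotic formula for the number of trees is
  used. The Euler product over subtrees is written as the exponential of the sum of the weights plus
  the sum of an \<open>excess\<close> that comes from repeated subtrees. The excess is quadratic in
  the weights and so remains summable somewhat beyond \<open>rho\<close>; what is left is a
  one-variable fixed point problem. For \<open>u = 1\<close> the slope at the fixed point is the
  fixed point itself, which may reach 1; a weight \<open>u < 1\<close> pushes it below 1, which
  leaves room to move beyond \<open>rho\<close>. Divergence beyond \<open>rho\<close> alone bounds
  the number of rooted trees from below only for infinitely many sizes; joining two trees under a
  new root extends this to all large sizes.

  Both gains are exponential, so the polynomial losses from rooting and from a crude Stirling bound
  do no harm.\<close>

text \<open>The rank \<open>h\<close> stands for acyclicity: it falls strictly along
  \<open>p\<close>, so iterating \<open>p\<close> from any vertex of \<open>V\<close> must end in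
  \<open>r\<close>. Nothing is fixed about \<open>p\<close> at \<open>r\<close> or outside
  \<open>V\<close>, so many \<open>p\<close> describe one tree; the counting arguments therefore use
  extensional functions.\<close>

definition rooted :: "'a set \<Rightarrow> 'a \<Rightarrow> ('a \<Rightarrow> 'a) \<Rightarrow> bool" where
  "rooted V r p \<longleftrightarrow> finite V \<and> r \<in> V \<and> (\<forall>v\<in>V-{r}. p v \<in> V) \<and>
     (\<exists>h::'a \<Rightarrow> nat. \<forall>v\<in>V-{r}. h (p v) < h v)"

definition tree_of :: "'a set \<Rightarrow> 'a \<Rightarrow> ('a \<Rightarrow> 'a) \<Rightarrow> 'a pair_pre_digraph" where
  "tree_of V r p = \<lparr>pverts = V, parcs = (\<Union>v\<in>V-{r}. {(v, p v), (p v, v)})\<rparr>"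

definition children :: "'a set \<Rightarrow> 'a \<Rightarrow> ('a \<Rightarrow> 'a) \<Rightarrow> 'a \<Rightarrow> 'a set" where
  "children V r p v = {w \<in> V-{r}. p w = v}"

lemma tree_of_simps [simp]:
  "pverts (tree_of V r p) = V"
  "parcs (tree_of V r p) = (\<Union>v\<in>V-{r}. {(v, p v), (p v, v)})"
  by (simp_all add: tree_of_def)

lemma rooted_induct [consumes 2, case_names root step]:
  assumes "rooted V r p" "v \<in> V" "P r" "\<And>v. v \<in> V - {r} \<Longrightarrow> P (p v) \<Longrightarrow> P v"
  shows "P v"
proof -
  obtain h :: "'a \<Rightarrow> nat" where h: "\<And>v. v \<in> V-{r} \<Longrightarrow> h (p v) < h v"
    using assms(1) by (auto simp: rooted_def)
  have pV: "p v \<in> V" if "v \<in> V-{r}" for v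
    using that assms(1) by (auto simp: rooted_def)
  show ?thesis using assms(2)
  proof (induction v rule: measure_induct_rule[of h])
    case (less v)
    show ?case
    proof (cases "v = r")
      case False
      then have v: "v \<in> V-{r}" using less.prems by simp
      show ?thesis using less.IH[OF h[OF v] pV[OF v]] assms(4)[OF v] by simp
    qed (use assms(3) in simp)
  qed
qed

lemma rooted_parent_neq:
  assumes "rooted V r p" "v \<in> V - {r}"
  shows "p v \<noteq> v"
  using assms unfolding rooted_def by (metis less_irrefl)

lemma rtrancl_on_eq_rtrancl:
  assumes "A \<subseteq> V \<times> V" "u \<in> V"
  shows "(u, v) \<in> rtrancl_on V A \<longleftrightarrow> (u, v) \<in> A\<^sup>*"
proof
  assume "(u, v) \<in> A\<^sup>*"
  then show "(u, v) \<in> rtrancl_on V A"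
    using assms by (induction rule: rtrancl_induct) (auto intro: rtrancl_on_into_rtrancl_on)
qed (auto dest: rtrancl_on_rtranclI)

lemma connected_symcl_iff:
  assumes "pair_graph G"
  shows "Digraph_Component.connected (with_proj G) \<longleftrightarrow>
    pverts G \<noteq> {} \<and> (\<forall>u\<in>pverts G. \<forall>v\<in>pverts G. (u, v) \<in> (parcs G)\<^sup>*)"
proof -
  interpret pair_graph G by fact
  have "(parcs G)\<^sup>s = parcs G"
    by (auto simp: symcl_def arcs_symmetric)
  moreover have "parcs G \<subseteq> pverts G \<times> pverts G"
    by (auto dest: in_arcsD1 in_arcsD2)
  ultimately show ?thesis
    by (simp add: connected_conv rtrancl_on_eq_rtrancl)
qed

lemma pcas_nth:
  assumes "pcas u q v" "i < length q"
  shows "q ! i = (pawalk_verts u q ! i, pawalk_verts u q ! Suc i)"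
  using assms
proof (induction q arbitrary: u i)
  case (Cons a q)
  then show ?case by (cases i; cases q) (auto simp: prod_eq_iff)
qed simp

lemma pawalk_verts_ends:
  assumes "pcas u q v"
  shows "pawalk_verts u q ! 0 = u" "pawalk_verts u q ! length q = v" "length (pawalk_verts u q) = Suc (length q)"
  using assms by (induction q arbitrary: u) auto

lemma pair_graph_tree_of:
  assumes "rooted V r p"
  shows "pair_graph (tree_of V r p)"
proof unfold_locales
  show "symmetric (with_proj (tree_of V r p))"
    by (auto simp: symmetric_def intro!: symI)
qed (use assms rooted_parent_neq[OF assms] in \<open>force simp: rooted_def\<close>)+

text \<open>On a cycle take a vertex of maximal rank. Neither of its neighbours on the cycle ranks
  higher, so each is its parent; but on a cycle of length at least 3 the two neighbours
  differ.\<close>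

lemma tree_of_no_cycle:
  assumes R: "rooted V r p" and cyc: "pre_digraph.cycle (with_proj (tree_of V r p)) q" and len: "3 \<le> length q"
  shows False
proof -
  let ?G = "tree_of V r p"
  interpret pair_graph ?G by (rule pair_graph_tree_of[OF R])
  obtain h :: "'a \<Rightarrow> nat" where h: "\<And>v. v \<in> V-{r} \<Longrightarrow> h (p v) < h v"
    using R by (auto simp: rooted_def)
  have up: "y = p x" if "(x, y) \<in> parcs ?G" "h y \<le> h x" for x y
    using that h by fastforce
  obtain u where u: "awalk u q u" and dist: "distinct (tl (pawalk_verts u q))"
    using cyc by (auto simp: cycle_def)
  have cas: "pcas u q u" and sub: "set q \<subseteq> parcs ?G"
    using u by (auto simp: awalk_def)
  define vs where "vs = pawalk_verts u q"
  define k where "k = length q"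
  have k3: "3 \<le> k" using len by (simp add: k_def)
  note ends = pawalk_verts_ends[OF cas, folded vs_def k_def]
  have arc: "(vs ! i, vs ! Suc i) \<in> parcs ?G" if "i < k" for i
    using pcas_nth[OF cas that[unfolded k_def]] sub nth_mem[of i q] that
    by (auto simp: vs_def k_def)
  have inj_tl: "i = j" if "vs ! Suc i = vs ! Suc j" "i < k" "j < k" for i j
  proof -
    have "tl vs ! i = vs ! Suc i" "tl vs ! j = vs ! Suc j"
      using that ends(3) by (auto simp: nth_tl)
    with that dist ends(3) show ?thesis
      using nth_eq_iff_index_eq[of "tl vs" i j] by (simp add: vs_def[symmetric])
  qed
  \<comment> \<open>\<open>c\<close> runs through the tail of the vertex list, whose entries are
    distinct; the head repeats the last entry.\<close>
  define c where "c i = vs ! Suc i" for i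
  obtain i where i: "i < k" and imax: "\<And>j. j < k \<Longrightarrow> h (c j) \<le> h (c i)"
  proof -
    let ?H = "(\<lambda>j. h (c j)) ` {..<k}"
    have "h (c 0) \<in> ?H" using k3 by auto
    then have "Max ?H \<in> ?H" by (intro Max_in) auto
    then obtain i where "i < k" "h (c i) = Max ?H" by auto
    then show ?thesis using that[of i] by (auto intro!: Max_ge)
  qed
  \<comment> \<open>Cyclic successor and predecessor of position \<open>i\<close>;
    \<open>3 \<le> k\<close> keeps them apart.\<close>
  define s where "s = (if Suc i = k then 0 else Suc i)"
  define t where "t = (if i = 0 then k - 1 else i - 1)"
  have st: "s < k" "t < k" "s \<noteq> t" using i k3 by (auto simp: s_def t_def)
  have A1: "(c i, c s) \<in> parcs ?G"
    using arc[of "Suc i"] arc[of 0] i k3 ends by (auto simp: c_def s_def)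
  have A2: "(c t, c i) \<in> parcs ?G"
    using arc[of i] i k3 ends by (auto simp: c_def t_def)
  then have "(c i, c t) \<in> parcs ?G" by (rule arcs_symmetric)
  then have "c t = p (c i)" using up imax st by blast
  moreover have "c s = p (c i)" using A1 up imax st by blast
  ultimately show False using inj_tl[of s t] st by (auto simp: c_def)
qed

lemma simple_tree_tree_of:
  assumes R: "rooted V r p"
  shows "simple_tree (tree_of V r p)"
proof -
  let ?G = "tree_of V r p"
  have pg: "pair_graph ?G" by (rule pair_graph_tree_of[OF R])
  have up: "(v, r) \<in> (parcs ?G)\<^sup>*" if "v \<in> V" for v
    using R that
  proof (induction rule: rooted_induct)
    case (step v)
    have "(v, p v) \<in> parcs ?G" using step by auto
    then show ?case using step by (meson converse_rtrancl_into_rtrancl)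
  qed simp
  have "sym (parcs ?G)" by (auto intro!: symI)
  then have "sym ((parcs ?G)\<^sup>*)" by (rule sym_rtrancl)
  then have "(r, v) \<in> (parcs ?G)\<^sup>*" if "v \<in> V" for v
    using up[OF that] by (auto dest: symD)
  then have "(u, v) \<in> (parcs ?G)\<^sup>*" if "u \<in> V" "v \<in> V" for u v
    using up that by (meson rtrancl_trans)
  moreover have "V \<noteq> {}" using R by (auto simp: rooted_def)
  ultimately show ?thesis
    using pg tree_of_no_cycle[OF R] connected_symcl_iff[OF pg] by (auto simp: simple_tree_def)
qed

text \<open>The parent is a neighbour nearer to \<open>r\<close>, with \<open>h\<close> the length
  of a shortest walk from \<open>r\<close>. An arc of \<open>G\<close> missing from the resulting
  tree would, together with the path that joins its ends in that tree, form a cycle of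
  \<open>G\<close> of length at least 3.\<close>

lemma simple_tree_ex_parent:
  assumes T: "simple_tree G" and r: "r \<in> pverts G"
  obtains p where "rooted (pverts G) r p" "G = tree_of (pverts G) r p"
proof -
  interpret pair_graph G using T by (simp add: simple_tree_def)
  let ?E = "parcs G" and ?V = "pverts G"
  have pg: "pair_graph G" ..
  have conn: "(r, v) \<in> ?E\<^sup>*" if "v \<in> ?V" for v
    using T r that connected_symcl_iff[OF pg] by (auto simp: simple_tree_def)
  define h where "h v = (LEAST k. (r, v) \<in> ?E ^^ k)" for v
  have hp: "(r, v) \<in> ?E ^^ h v" if "v \<in> ?V" for v
    unfolding h_def using rtrancl_imp_relpow[OF conn[OF that]] by (rule LeastI_ex[OF exI, OF someI_ex])
  have ex: "\<exists>w. (w, v) \<in> ?E \<and> h w < h v" if "v \<in> ?V - {r}" for v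
  proof -
    have "h v \<noteq> 0" using hp[of v] that by (cases "h v") auto
    then obtain k where k: "h v = Suc k" by (cases "h v") auto
    have "(r, v) \<in> ?E ^^ Suc k" using hp[of v] that k by auto
    then obtain w where "(r, w) \<in> ?E ^^ k" "(w, v) \<in> ?E" by auto
    moreover then have "h w \<le> k" unfolding h_def by (intro Least_le)
    ultimately show ?thesis using k by auto
  qed
  define p where "p v = (SOME w. (w, v) \<in> ?E \<and> h w < h v)" for v
  have p: "(p v, v) \<in> ?E" "h (p v) < h v" if "v \<in> ?V - {r}" for v
    using someI_ex[OF ex[OF that]] unfolding p_def by auto
  have R: "rooted ?V r p"
    unfolding rooted_def using r p pair_finite_verts in_arcsD1 by blast
  let ?H = "tree_of ?V r p"
  interpret H: pair_graph ?H by (rule pair_graph_tree_of[OF R])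
  have sub: "parcs ?H \<subseteq> ?E" using p by (auto intro: arcs_symmetric)
  have "?E \<subseteq> parcs ?H"
  proof (rule ccontr)
    assume "\<not> ?E \<subseteq> parcs ?H"
    then obtain a b where ab: "(a, b) \<in> ?E" "(a, b) \<notin> parcs ?H" by (meson subrelI)
    have abV: "a \<in> ?V" "b \<in> ?V" using ab in_arcsD1 in_arcsD2 by auto
    have "Digraph_Component.connected (with_proj ?H)"
      using simple_tree_tree_of[OF R] by (simp add: simple_tree_def)
    then have "(a, b) \<in> (parcs ?H)\<^sup>*"
      using abV connected_symcl_iff[OF H.pair_graph] by auto
    moreover have "parcs ?H \<subseteq> ?V \<times> ?V" using sub in_arcsD1 in_arcsD2 by (meson SigmaI subrelI subsetD)
    ultimately have "Digraph.reachable (with_proj ?H) a b"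
      using abV rtrancl_on_eq_rtrancl[of "parcs ?H" ?V a b] by (simp add: reachable_def)
    then obtain q where q: "H.apath a q b" using H.reachable_apath by blast
    have ne: "a \<noteq> b" using ab pair_no_loops by force
    have cas: "pcas a q b" and sq: "set q \<subseteq> parcs ?H" and dq: "distinct (pawalk_verts a q)"
      using q by (auto simp: H.apath_def H.awalk_def)
    have l2: "2 \<le> length q"
    proof (rule ccontr)
      assume "\<not> ?thesis"
      then consider "q = []" | e where "q = [e]" by (cases q) (auto simp: not_le less_Suc_eq)
      then show False
      proof cases
        case 2
        then have "e = (a, b)" using cas by (cases e) auto
        then show False using 2 sq ab by auto
      qed (use cas ne in auto)
    qed
    have "awalk a (q @ [(b, a)]) a"
    proof -
      have "awalk a q b" using sq sub cas abV by (auto simp: awalk_def)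
      moreover have "awalk b [(b, a)] a" using ab abV arcs_symmetric by (auto simp: awalk_def)
      ultimately show ?thesis by (rule awalk_appendI)
    qed
    moreover have "distinct (tl (pawalk_verts a (q @ [(b, a)])))"
    proof -
      have "pawalk_verts x (w @ [(b, a)]) = pawalk_verts x w @ [a]" if "pcas x w b" for x w
        using that by (induction w arbitrary: x) auto
      from this[OF cas] have "pawalk_verts a (q @ [(b, a)]) = pawalk_verts a q @ [a]" .
      moreover obtain w where "pawalk_verts a q = a # w"
        using cas by (cases q) auto
      ultimately show ?thesis using dq by simp
    qed
    ultimately have "cycle (q @ [(b, a)])" by (auto simp: cycle_def)
    moreover have "3 \<le> length (q @ [(b, a)])" using l2 by simp
    ultimately show False using T unfolding simple_tree_def by blast
  qed
  with sub have "parcs G = parcs ?H" by auto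
  then have "G = ?H" by (cases G) (simp add: tree_of_def)
  with R that show ?thesis by blast
qed

text \<open>If the parents of \<open>v\<close> differ, then the edge from \<open>v\<close> to
  \<open>p' v\<close> must come from \<open>p (p' v) = v\<close>. By induction on the rank of the
  second function \<open>p' (p' v) = v\<close> follows, so that rank would fall along a
  2-cycle.\<close>

lemma tree_of_parent_unique:
  assumes R: "rooted V r p" and R': "rooted V r p'" and eq: "tree_of V r p = tree_of V r p'"
    and v: "v \<in> V - {r}"
  shows "p v = p' v"
proof -
  obtain h :: "'a \<Rightarrow> nat" where h: "\<And>v. v \<in> V-{r} \<Longrightarrow> h (p v) < h v"
    using R by (auto simp: rooted_def)
  obtain h' :: "'a \<Rightarrow> nat" where h': "\<And>v. v \<in> V-{r} \<Longrightarrow> h' (p' v) < h' v"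
    using R' by (auto simp: rooted_def)
  have arcs: "parcs (tree_of V r p) = parcs (tree_of V r p')" using eq by simp
  show ?thesis using v
  proof (induction v rule: measure_induct_rule[of h'])
    case (less v)
    show ?case
    proof (rule ccontr)
      assume ne: "p v \<noteq> p' v"
      have "(v, p' v) \<in> parcs (tree_of V r p)" unfolding arcs using less.prems by auto
      with ne have w: "p' v \<in> V - {r}" "p (p' v) = v" by auto
      have "p (p' v) = p' (p' v)" using less.IH[OF h'[OF less.prems] w(1)] .
      with w have "p' (p' v) = v" by simp
      then show False using h'[OF less.prems] h'[OF w(1)] by simp
    qed
  qed
qed


section \<open>Balancing by pairing\<close>

lemma rooted_children_sum:
  fixes g :: "'a \<Rightarrow> 'b::semiring_1"
  assumes R: "rooted V r p"
  shows "(\<Sum>w\<in>V-{r}. g (p w)) = (\<Sum>v\<in>V. of_nat (card (children V r p v)) * g v)"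
proof -
  have fin: "finite V" and pV: "p ` (V-{r}) \<subseteq> V" using R by (auto simp: rooted_def)
  have "(\<Sum>w\<in>V-{r}. g (p w)) = (\<Sum>v\<in>V. \<Sum>w | w \<in> V-{r} \<and> p w = v. g (p w))"
    using fin pV by (subst sum.group[of "V-{r}" V p "\<lambda>w. g (p w)"]) auto
  also have "\<dots> = (\<Sum>v\<in>V. of_nat (card (children V r p v)) * g v)"
    by (intro sum.cong) (auto simp: children_def)
  finally show ?thesis .
qed

text \<open>An edge is identified by its child endpoint. Two different children naming the same edge
  would be each other's parents, against the ranks.\<close>

lemma num_edges_of_color_tree_of:
  assumes R: "rooted V r p"
  shows "num_edges_of_color (tree_of V r p) c i = card {w \<in> V-{r}. c w = i \<and> c (p w) = i}"
proof -
  obtain h :: "'a \<Rightarrow> nat" where h: "\<And>v. v \<in> V-{r} \<Longrightarrow> h (p v) < h v"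
    using R by (auto simp: rooted_def)
  let ?A = "{w \<in> V-{r}. c w = i \<and> c (p w) = i}"
  have "{{u, v} | u v. (u, v) \<in> parcs (tree_of V r p) \<and> c u = i \<and> c v = i} = (\<lambda>w. {w, p w}) ` ?A" (is "?L = _")
  proof (intro equalityI subsetI)
    fix e assume "e \<in> ?L"
    then obtain u v where uv: "e = {u, v}" "(u, v) \<in> parcs (tree_of V r p)" "c u = i" "c v = i" by blast
    from uv(2) consider "u \<in> V-{r}" "v = p u" | "v \<in> V-{r}" "u = p v" by auto
    then show "e \<in> (\<lambda>w. {w, p w}) ` ?A"
    proof cases
      case 1
      then show ?thesis using uv by (intro image_eqI[of _ _ u]) simp_all
    next
      case 2
      then show ?thesis using uv by (intro image_eqI[of _ _ v]) (simp_all add: insert_commute)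
    qed
  next
    fix e assume "e \<in> (\<lambda>w. {w, p w}) ` ?A"
    then obtain w where "w \<in> ?A" "e = {w, p w}" by blast
    moreover from this(1) have "(w, p w) \<in> parcs (tree_of V r p)" by (simp, blast)
    ultimately show "e \<in> ?L" by (intro CollectI exI[of _ w] exI[of _ "p w"]) simp
  qed
  moreover have "inj_on (\<lambda>w. {w, p w}) ?A"
  proof (rule inj_onI)
    fix x y assume xy: "x \<in> ?A" "y \<in> ?A" "{x, p x} = {y, p y}"
    show "x = y"
    proof (rule ccontr)
      assume "x \<noteq> y"
      then have eq: "p y = x" "p x = y" using xy(3) unfolding doubleton_eq_iff by blast+
      have "h (p x) < h x" "h (p y) < h y" using h xy(1,2) by simp_all
      then show False unfolding eq by simp
    qed
  qed
  ultimately show ?thesis by (simp add: num_edges_of_color_def card_image)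
qed

lemma sum_sign_eq_card_diff:
  fixes f :: "'a \<Rightarrow> int"
  assumes "finite A" "\<And>x. x \<in> A \<Longrightarrow> f x = of_bool (P x) - of_bool (Q x)"
  shows "(\<Sum>x\<in>A. f x) = int (card {x\<in>A. P x}) - int (card {x\<in>A. Q x})"
proof -
  have "(\<Sum>x\<in>A. f x) = (\<Sum>x\<in>A. of_bool (P x)) - (\<Sum>x\<in>A. of_bool (Q x))"
    using assms(2) by (simp add: sum_subtractf)
  then show ?thesis using assms(1) by (simp add: sum.If_cases Int_def of_bool_def)
qed

text \<open>An edge contributes half the sum of the signs of its ends to the difference of the edge
  counts. In the doubled sum every non-root vertex appears once as a child, and every vertex appears
  once as a parent for each of its children.\<close>

lemma balanced_tree_ofI:
  fixes \<sigma> :: "'a \<Rightarrow> int"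
  assumes R: "rooted V r p" and \<sigma>: "\<And>v. \<sigma> v = 1 \<or> \<sigma> v = -1"
    and 1: "\<bar>\<Sum>v\<in>V. \<sigma> v\<bar> \<le> 1"
    and 2: "\<bar>\<Sum>v\<in>V. \<sigma> v * int (card (children V r p v))\<bar> \<le> 1"
  shows "balanced (tree_of V r p)"
proof -
  let ?G = "tree_of V r p"
  have fin: "finite V" and r: "r \<in> V" using R by (auto simp: rooted_def)
  define c :: "'a \<Rightarrow> nat" where "c v = (if \<sigma> v = 1 then 1 else 2)" for v
  have c1: "c v = 1 \<longleftrightarrow> \<sigma> v = 1" and c2: "c v = 2 \<longleftrightarrow> \<sigma> v = -1" for v
    using \<sigma>[of v] by (auto simp: c_def)
  have v: "int (num_verts_of_color ?G c 1) - int (num_verts_of_color ?G c 2) = (\<Sum>v\<in>V. \<sigma> v)"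
    unfolding num_verts_of_color_def tree_of_simps
    by (rule sum_sign_eq_card_diff[symmetric]) (use fin \<sigma> c1 c2 in auto)
  have "2 * (int (num_edges_of_color ?G c 1) - int (num_edges_of_color ?G c 2))
      = 2 * (\<Sum>w\<in>V-{r}. (\<sigma> w + \<sigma> (p w)) div 2)"
    unfolding num_edges_of_color_tree_of[OF R]
  proof (subst sum_sign_eq_card_diff)
    fix x
    show "(\<sigma> x + \<sigma> (p x)) div 2 = of_bool (c x = 1 \<and> c (p x) = 1) - of_bool (c x = 2 \<and> c (p x) = 2)"
      unfolding c1 c2 using \<sigma>[of x] \<sigma>[of "p x"] by auto
  qed (use fin in auto)
  also have "\<dots> = (\<Sum>w\<in>V-{r}. \<sigma> w + \<sigma> (p w))"
    unfolding sum_distrib_left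
  proof (intro sum.cong refl)
    fix w show "2 * ((\<sigma> w + \<sigma> (p w)) div 2) = \<sigma> w + \<sigma> (p w)"
      using \<sigma>[of w] \<sigma>[of "p w"] by auto
  qed
  also have "\<dots> = (\<Sum>v\<in>V. \<sigma> v) - \<sigma> r + (\<Sum>v\<in>V. \<sigma> v * int (card (children V r p v)))"
    using rooted_children_sum[OF R, of \<sigma>] fin r
    by (simp add: sum.distrib sum_diff1 mult.commute)
  finally have "2 * (int (num_edges_of_color ?G c 1) - int (num_edges_of_color ?G c 2)) =
    (\<Sum>v\<in>V. \<sigma> v) - \<sigma> r + (\<Sum>v\<in>V. \<sigma> v * int (card (children V r p v)))" .
  \<comment> \<open>Three terms of size at most 1 give \<open>\<bar>2 * x\<bar> \<le> 3\<close>, and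
    \<open>x\<close> is an integer.\<close>
  moreover have arith: "\<bar>x\<bar> \<le> 1" if "2 * x = a - b + c" "\<bar>b\<bar> = 1" "\<bar>a\<bar> \<le> 1" "\<bar>c\<bar> \<le> 1"
    for x a b c :: int using that by linarith
  moreover have "\<bar>\<sigma> r\<bar> = 1" using \<sigma>[of r] by auto
  ultimately have "\<bar>int (num_edges_of_color ?G c 1) - int (num_edges_of_color ?G c 2)\<bar> \<le> 1"
    using 1 2 arith by blast
  moreover have "c ` V \<subseteq> {1, 2}" by (auto simp: c_def)
  ultimately show ?thesis
    unfolding balanced_def using v 1 by (intro exI[of _ c]) simp
qed

text \<open>Two elements at a time receive opposite signs, oriented so that the difference of their
  values opposes the running total \<open>s\<close>. Both quantities have size at most
  \<open>m\<close>, hence so does their sum. The free start value \<open>s\<close> allows stages to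
  be chained.\<close>

lemma pairing_signs:
  fixes a :: "'a \<Rightarrow> int"
  assumes "finite Y" "\<And>y. y \<in> Y \<Longrightarrow> 0 \<le> a y \<and> a y \<le> m" "\<bar>s\<bar> \<le> m"
  shows "\<exists>\<sigma>::'a \<Rightarrow> int. (\<forall>y. \<sigma> y = 1 \<or> \<sigma> y = -1) \<and> \<bar>sum \<sigma> Y\<bar> \<le> 1 \<and>
      (even (card Y) \<longrightarrow> sum \<sigma> Y = 0) \<and> \<bar>s + (\<Sum>y\<in>Y. \<sigma> y * a y)\<bar> \<le> m"
    using assms
  proof (induction "card Y" arbitrary: Y s rule: less_induct)
    case less
    consider "Y = {}" | x where "Y = {x}" | x y where "x \<in> Y" "y \<in> Y" "x \<noteq> y" by auto
    then show ?case
    proof cases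
      case 1
      then show ?thesis using less.prems by (intro exI[of _ "\<lambda>_. 1"]) auto
    next
      case (2 x)
      have "0 \<le> a x" "a x \<le> m" using less.prems(2)[of x] 2 by auto
      then show ?thesis
        using 2 less.prems(3) by (intro exI[of _ "\<lambda>_. if s \<le> 0 then 1 else -1"]) auto
    next
      case (3 x y)
      define e :: int where "e = (if s * (a x - a y) \<le> 0 then 1 else -1)"
      have e: "e = 1 \<or> e = -1" by (simp add: e_def)
      define Y' where "Y' = Y - {x, y}"
      have Y: "Y = insert x (insert y Y')" "x \<notin> Y'" "y \<notin> Y'" "finite Y'"
        using 3 less.prems(1) by (auto simp: Y'_def)
      have card: "card Y = card Y' + 2" using Y 3 by simp
      have b: "0 \<le> a x" "a x \<le> m" "0 \<le> a y" "a y \<le> m" using less.prems(2) 3 by auto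
      have "\<bar>s + e * (a x - a y)\<bar> \<le> m"
        using b less.prems(3) by (auto simp: e_def mult_le_0_iff abs_le_iff not_le zero_less_mult_iff)
      then obtain \<tau> :: "'a \<Rightarrow> int" where \<tau>: "\<And>y. \<tau> y = 1 \<or> \<tau> y = -1" "\<bar>sum \<tau> Y'\<bar> \<le> 1"
        "even (card Y') \<Longrightarrow> sum \<tau> Y' = 0" "\<bar>s + e * (a x - a y) + (\<Sum>y\<in>Y'. \<tau> y * a y)\<bar> \<le> m"
        using less.hyps[of Y' "s + e * (a x - a y)"] less.prems Y card by auto
      let ?\<sigma> = "\<tau>(x := e, y := -e)"
      have s1: "sum ?\<sigma> Y' = sum \<tau> Y'" and s2: "(\<Sum>y\<in>Y'. ?\<sigma> y * a y) = (\<Sum>y\<in>Y'. \<tau> y * a y)"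
        using Y by (auto intro!: sum.cong)
      have "sum ?\<sigma> Y = sum \<tau> Y'" unfolding Y(1) using Y 3 s1 by simp
      moreover have "(\<Sum>y\<in>Y. ?\<sigma> y * a y) = e * (a x - a y) + (\<Sum>y\<in>Y'. \<tau> y * a y)"
        unfolding Y(1) using Y 3 s2 by (simp add: algebra_simps)
      ultimately show ?thesis using \<tau> e card
        by (intro exI[of _ ?\<sigma>]) (auto simp: algebra_simps)
    qed
  qed

text \<open>An element of value 1 and one of value 0 with opposite signs leave the sum of signs
  unchanged and move the weighted total by 1 in either direction. Each pair is spent on moving
  \<open>s\<close> towards 0; from 0 it can only move to 1, whence the maximum with 1.\<close>

lemma unit_pairing_signs:
  fixes a :: "'a \<Rightarrow> int"
  assumes "finite A" "finite B" "A \<inter> B = {}" "card A = card B"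
    "\<And>y. y \<in> A \<Longrightarrow> a y = 1" "\<And>y. y \<in> B \<Longrightarrow> a y = 0"
  shows "\<exists>\<sigma>::'a \<Rightarrow> int. (\<forall>y. \<sigma> y = 1 \<or> \<sigma> y = -1) \<and> sum \<sigma> (A \<union> B) = 0 \<and>
      \<bar>s + (\<Sum>y\<in>A \<union> B. \<sigma> y * a y)\<bar> \<le> max (\<bar>s\<bar> - int (card A)) 1"
    using assms
  proof (induction A arbitrary: B s rule: finite_induct)
    case empty
    then show ?case by (intro exI[of _ "\<lambda>_. 1"]) auto
  next
    case (insert x A)
    then obtain y where y: "y \<in> B" by (metis card_0_eq card_insert_disjoint ex_in_conv nat.simps(3))
    define B' where "B' = B - {y}"
    have B: "B = insert y B'" "y \<notin> B'" "finite B'" "card A = card B'"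
      using y insert by (auto simp: B'_def)
    define e :: int where "e = (if s \<le> 0 then 1 else -1)"
    obtain \<tau> :: "'a \<Rightarrow> int" where \<tau>: "\<And>y. \<tau> y = 1 \<or> \<tau> y = -1" "sum \<tau> (A \<union> B') = 0"
      "\<bar>s + e + (\<Sum>y\<in>A \<union> B'. \<tau> y * a y)\<bar> \<le> max (\<bar>s + e\<bar> - int (card A)) 1"
      using insert.IH[of B' "s + e"] insert.prems B by auto
    let ?\<sigma> = "\<tau>(x := e, y := -e)"
    have ni: "x \<notin> A \<union> B'" "y \<notin> A \<union> B'" "x \<noteq> y" "finite (A \<union> B')"
      using insert.hyps insert.prems B by auto
    have U: "insert x A \<union> B = insert x (insert y (A \<union> B'))" using B by auto
    have s1: "sum ?\<sigma> (A \<union> B') = sum \<tau> (A \<union> B')"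
      and s2: "(\<Sum>y\<in>A \<union> B'. ?\<sigma> y * a y) = (\<Sum>y\<in>A \<union> B'. \<tau> y * a y)"
      using ni by (auto intro!: sum.cong)
    have "a x = 1" "a y = 0" using insert.prems y by auto
    then have "sum ?\<sigma> (insert x A \<union> B) = 0"
      "(\<Sum>y\<in>insert x A \<union> B. ?\<sigma> y * a y) = e + (\<Sum>y\<in>A \<union> B'. \<tau> y * a y)"
      unfolding U using ni s1 s2 \<tau>(2) by simp_all
    moreover have "max (\<bar>s + e\<bar> - int (card A)) 1 \<le> max (\<bar>s\<bar> - int (card (insert x A))) 1"
      using insert.hyps by (auto simp: e_def)
    moreover have "e = 1 \<or> e = -1" by (simp add: e_def)
    ultimately show ?case using \<tau>
      by (intro exI[of _ ?\<sigma>]) (auto simp: algebra_simps)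
  qed

lemma ex_subset_card: "n \<le> card S \<Longrightarrow> \<exists>T\<subseteq>S. card T = n"
  by (meson obtain_subset_with_card_n)

text \<open>Three stages. Pairing the large values leaves a total of size at most \<open>m\<close>;
  unit pairs bring it down to at most 1; the remaining values are 0 or 1, and pairing them preserves
  the bound 1. The first two stages have sign sum exactly 0, so only the last can contribute to
  it.\<close>

lemma balancing_signs:
  fixes a :: "'a \<Rightarrow> int" and m :: nat
  assumes fin: "finite V" and a: "\<And>v. v \<in> V \<Longrightarrow> 0 \<le> a v \<and> a v \<le> int m"
    and zeros: "m \<le> card {v\<in>V. a v = 0}" and ones: "m \<le> card {v\<in>V. a v = 1}"
  obtains \<sigma> :: "'a \<Rightarrow> int" where "\<And>y. \<sigma> y = 1 \<or> \<sigma> y = -1" "\<bar>sum \<sigma> V\<bar> \<le> 1"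
    "\<bar>\<Sum>v\<in>V. \<sigma> v * a v\<bar> \<le> 1"
proof -
  let ?Z = "{v\<in>V. a v = 0}" and ?O = "{v\<in>V. a v = 1}" and ?X = "{v\<in>V. 2 \<le> a v}"
  \<comment> \<open>An odd number of large values is completed by one zero. This uses up one of the
    \<open>m\<close> zeros and leaves the \<open>m - 1\<close> that are needed for the unit
    pairs.\<close>
  obtain X Z where X: "?X \<subseteq> X" "X \<inter> ?O = {}" "X \<subseteq> V" "even (card X)"
    and Z: "Z \<subseteq> ?Z" "X \<inter> Z = {}" "card Z = m - 1"
  proof (cases "even (card ?X)")
    case True
    have "m - 1 \<le> card ?Z" using zeros by simp
    from ex_subset_card[OF this] obtain Z where "Z \<subseteq> ?Z" "card Z = m - 1"
      by blast
    with True show ?thesis by (intro that[of ?X Z]) auto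
  next
    case False
    have "?X \<noteq> {}"
    proof
      assume "?X = {}"
      with False show False by simp
    qed
    then obtain x where "x \<in> V" "2 \<le> a x" by blast
    then have "m \<ge> 2" using a[of x] by linarith
    then have "card ?Z > 0" using zeros by linarith
    then obtain z where z: "z \<in> ?Z" unfolding card_gt_0_iff by blast
    have "m - 1 \<le> card (?Z - {z})" using zeros z fin by simp
    from ex_subset_card[OF this] obtain Z where "Z \<subseteq> ?Z - {z}" "card Z = m - 1"
      by blast
    moreover have "even (card (insert z ?X))" using False z fin by simp
    ultimately show ?thesis using z by (intro that[of "insert z ?X" Z]) auto
  qed
  have "m - 1 \<le> card ?O" using ones by simp
  from ex_subset_card[OF this] obtain B where B: "B \<subseteq> ?O" "card B = m - 1"
    by blast
  have finX: "finite X" "finite Z" "finite B"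
    using finite_subset[OF X(3) fin] finite_subset[OF Z(1)] finite_subset[OF B(1)] fin by simp_all
  have aX: "0 \<le> a y \<and> a y \<le> int m" if "y \<in> X" for y using a X(3) that by blast
  obtain \<sigma>1 :: "'a \<Rightarrow> int" where \<sigma>1: "\<forall>y. \<sigma>1 y = 1 \<or> \<sigma>1 y = -1" "sum \<sigma>1 X = 0"
    "\<bar>0 + (\<Sum>y\<in>X. \<sigma>1 y * a y)\<bar> \<le> int m"
    using pairing_signs[of X a "int m" 0, OF finX(1) aX] X(4) by auto
  define t1 where "t1 = (\<Sum>y\<in>X. \<sigma>1 y * a y)"
  have aB: "a y = 1" if "y \<in> B" for y using B(1) that by blast
  have aZ: "a y = 0" if "y \<in> Z" for y using Z(1) that by blast
  have cards: "card B = card Z" using B Z by simp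
  have BZ: "B \<inter> Z = {}" using aB aZ by fastforce
  obtain \<sigma>2 :: "'a \<Rightarrow> int" where \<sigma>2: "\<forall>y. \<sigma>2 y = 1 \<or> \<sigma>2 y = -1" "sum \<sigma>2 (B \<union> Z) = 0"
    "\<bar>t1 + (\<Sum>y\<in>B \<union> Z. \<sigma>2 y * a y)\<bar> \<le> max (\<bar>t1\<bar> - int (card B)) 1"
    using unit_pairing_signs[of B Z a t1, OF finX(3,2) BZ cards aB aZ] by blast
  define t2 where "t2 = t1 + (\<Sum>y\<in>B \<union> Z. \<sigma>2 y * a y)"
  have t2: "\<bar>t2\<bar> \<le> 1" using \<sigma>1(3) \<sigma>2(3) B(2) unfolding t2_def[symmetric] t1_def[symmetric] by auto
  define W where "W = V - X - (B \<union> Z)"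
  have W: "0 \<le> a y \<and> a y \<le> 1" if "y \<in> W" for y using that a[of y] X(1) unfolding W_def by force
  have finW: "finite W" using fin by (simp add: W_def)
  obtain \<sigma>3 :: "'a \<Rightarrow> int" where \<sigma>3: "\<forall>y. \<sigma>3 y = 1 \<or> \<sigma>3 y = -1" "\<bar>sum \<sigma>3 W\<bar> \<le> 1"
    "\<bar>t2 + (\<Sum>y\<in>W. \<sigma>3 y * a y)\<bar> \<le> 1"
    using pairing_signs[of W a 1 t2, OF finW W t2] by blast
  define \<sigma> where "\<sigma> y = (if y \<in> X then \<sigma>1 y else if y \<in> B \<union> Z then \<sigma>2 y else \<sigma>3 y)" for y
  have V: "V = X \<union> ((B \<union> Z) \<union> W)" using X B Z by (auto simp: W_def)
  have disj: "X \<inter> ((B \<union> Z) \<union> W) = {}" "(B \<union> Z) \<inter> W = {}" using X B Z by (auto simp: W_def)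
  have split: "(\<Sum>v\<in>V. \<sigma> v * b v) = (\<Sum>v\<in>X. \<sigma>1 v * b v) + ((\<Sum>v\<in>B \<union> Z. \<sigma>2 v * b v) + (\<Sum>v\<in>W. \<sigma>3 v * b v))" for b
  proof -
    have "(\<Sum>v\<in>V. \<sigma> v * b v) = (\<Sum>v\<in>X. \<sigma> v * b v) + ((\<Sum>v\<in>B \<union> Z. \<sigma> v * b v) + (\<Sum>v\<in>W. \<sigma> v * b v))"
      unfolding V using finX finW disj by (simp add: sum.union_disjoint)
    moreover have "(\<Sum>v\<in>X. \<sigma> v * b v) = (\<Sum>v\<in>X. \<sigma>1 v * b v)" "(\<Sum>v\<in>B \<union> Z. \<sigma> v * b v) = (\<Sum>v\<in>B \<union> Z. \<sigma>2 v * b v)"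
      "(\<Sum>v\<in>W. \<sigma> v * b v) = (\<Sum>v\<in>W. \<sigma>3 v * b v)"
      using disj by (auto intro!: sum.cong simp: \<sigma>_def)
    ultimately show ?thesis by simp
  qed
  show ?thesis
  proof (rule that[of \<sigma>])
    show "\<sigma> y = 1 \<or> \<sigma> y = -1" for y using \<sigma>1(1) \<sigma>2(1) \<sigma>3(1) by (auto simp: \<sigma>_def)
    show "\<bar>sum \<sigma> V\<bar> \<le> 1" using split[of "\<lambda>_. 1"] \<sigma>1(2) \<sigma>2(2) \<sigma>3(2) by simp
    show "\<bar>\<Sum>v\<in>V. \<sigma> v * a v\<bar> \<le> 1" using split[of a] \<sigma>3(3) by (simp add: t2_def t1_def)
  qed
qed

text \<open>The numbers of children minus 1 sum to -1. Leaves contribute -1 each and all other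
  vertices at least 0, so the number of leaves is 1 plus the surplus of the other vertices, among
  them that of \<open>v\<close>.\<close>

lemma card_children_le_card_leaves:
  assumes R: "rooted V r p" and v: "v \<in> V"
  shows "card (children V r p v) \<le> card {w\<in>V. card (children V r p w) = 0}"
proof -
  let ?a = "\<lambda>v. int (card (children V r p v))" and ?L = "{w\<in>V. card (children V r p w) = 0}"
  have fin: "finite V" and r: "r \<in> V" using R by (auto simp: rooted_def)
  have "(\<Sum>w\<in>V. ?a w) = int (card (V-{r}))"
    using rooted_children_sum[OF R, of "\<lambda>_. 1::int"] by simp
  also have "\<dots> = int (card V) - 1"
    using fin r card_Suc_Diff1[OF fin r] by linarith
  finally have 1: "(\<Sum>w\<in>V. ?a w - 1) = -1" by (simp add: sum_subtractf)
  have "(\<Sum>w\<in>V. ?a w - 1) = (\<Sum>w\<in>V-?L. ?a w - 1) + (\<Sum>w\<in>?L. ?a w - 1)"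
    using fin by (intro sum.subset_diff) auto
  also have "(\<Sum>w\<in>?L. ?a w - 1) = (\<Sum>w\<in>?L. - 1)" by (intro sum.cong) auto
  finally have L: "int (card ?L) = 1 + (\<Sum>w\<in>V-?L. ?a w - 1)" using 1 by simp
  have nn: "0 \<le> ?a w - 1" if "w \<in> V - ?L" for w using that by (auto simp: Suc_leI)
  show ?thesis
  proof (cases "v \<in> ?L")
    case False
    then have "?a v - 1 \<le> (\<Sum>w\<in>V-?L. ?a w - 1)"
      using fin v nn by (intro member_le_sum) auto
    with L show ?thesis by linarith
  qed auto
qed

definition unary :: "'a set \<Rightarrow> 'a \<Rightarrow> ('a \<Rightarrow> 'a) \<Rightarrow> 'a set" where
  "unary V r p = {v\<in>V. card (children V r p v) = 1}"

text \<open>Contrapositive, through \<open>balancing_signs\<close> with \<open>m\<close> the maximal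
  number of children: the zeros are the leaves, which always suffice, and the ones are the unary
  vertices.\<close>

lemma not_balanced_few_unary:
  assumes R: "rooted V r p" and "\<not> balanced (tree_of V r p)"
  shows "\<exists>w\<in>V. card (unary V r p) < card (children V r p w)"
proof (rule ccontr)
  assume "\<not> ?thesis"
  then have k: "\<And>w. w \<in> V \<Longrightarrow> card (children V r p w) \<le> card (unary V r p)" by (auto simp: not_less)
  let ?a = "\<lambda>v. card (children V r p v)"
  have fin: "finite V" and r: "r \<in> V" using R by (auto simp: rooted_def)
  define m where "m = Max (?a ` V)"
  have "m \<in> ?a ` V" unfolding m_def using fin r by (intro Max_in) auto
  then obtain v where v: "v \<in> V" "m = ?a v" by auto
  have le: "?a w \<le> m" if "w \<in> V" for w unfolding m_def using fin that by auto
  obtain \<sigma> :: "'a \<Rightarrow> int" where "\<And>y. \<sigma> y = 1 \<or> \<sigma> y = -1" "\<bar>sum \<sigma> V\<bar> \<le> 1"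
    "\<bar>\<Sum>v\<in>V. \<sigma> v * int (?a v)\<bar> \<le> 1"
  proof (rule balancing_signs[of V "\<lambda>v. int (?a v)" m])
    show "m \<le> card {v \<in> V. int (?a v) = 0}"
      using card_children_le_card_leaves[OF R v(1)] v(2) by (simp only: of_nat_eq_0_iff)
    show "m \<le> card {v \<in> V. int (?a v) = 1}"
      using k[OF v(1)] v(2) by (simp only: unary_def of_nat_eq_1_iff)
  qed (use fin le in auto)
  then show False using balanced_tree_ofI[OF R, of \<sigma>] assms(2) by blast
qed


section \<open>Labelled trees\<close>

lemma sum_Pow_card:
  fixes F :: "nat \<Rightarrow> 'b::comm_semiring_1"
  assumes "finite U"
  shows "(\<Sum>J\<in>Pow U. F (card J)) = (\<Sum>j\<le>card U. of_nat (card U choose j) * F j)"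
proof -
  have "(\<Sum>J\<in>Pow U. F (card J)) = (\<Sum>j\<le>card U. \<Sum>J | J \<in> Pow U \<and> card J = j. F (card J))"
    using assms by (subst sum.group) (auto intro: card_mono)
  also have "\<dots> = (\<Sum>j\<le>card U. of_nat (card U choose j) * F j)"
  proof (intro sum.cong refl)
    fix j
    have "(\<Sum>J | J \<in> Pow U \<and> card J = j. F (card J)) = (\<Sum>J | J \<in> Pow U \<and> card J = j. F j)"
      by (intro sum.cong) auto
    also have "\<dots> = of_nat (card U choose j) * F j"
      using n_subsets[OF assms, of j] by (simp add: Pow_def)
    finally show "(\<Sum>J | J \<in> Pow U \<and> card J = j. F (card J)) = of_nat (card U choose j) * F j" .
  qed
  finally show ?thesis .
qed

section \<open>Counting rooted forests\<close>

text \<open>For disjoint \<open>U\<close> and \<open>K\<close> these are the rooted forests on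
  \<open>U \<union> K\<close> with root set \<open>K\<close>, given by their parent
  functions.\<close>

definition acyclic_funs :: "'a set \<Rightarrow> 'a set \<Rightarrow> ('a \<Rightarrow> 'a) set" where
  "acyclic_funs U K = {f \<in> U \<rightarrow>\<^sub>E U \<union> K. \<exists>h::'a \<Rightarrow> nat. \<forall>v\<in>U. h (f v) < h v}"

lemma finite_acyclic_funs: "finite U \<Longrightarrow> finite K \<Longrightarrow> finite (acyclic_funs U K)"
  unfolding acyclic_funs_def by (simp add: finite_PiE)

lemma acyclic_funs_glue:
  assumes "J \<subseteq> U" "U \<inter> K = {}" "g \<in> J \<rightarrow>\<^sub>E K" "f \<in> acyclic_funs (U - J) J"
  shows "(\<lambda>v. if v \<in> J then g v else f v) \<in> acyclic_funs U K"
proof -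
  obtain h :: "'a \<Rightarrow> nat" where h: "\<And>v. v \<in> U - J \<Longrightarrow> h (f v) < h v"
    using assms(4) by (auto simp: acyclic_funs_def)
  have f: "f v \<in> U" if "v \<in> U - J" for v
    using assms(1,4) that by (auto simp: acyclic_funs_def PiE_iff)
  have f': "f v = undefined" if "v \<notin> U" for v
    using assms(4) that by (auto simp: acyclic_funs_def PiE_iff extensional_def)
  have g: "g v \<in> K" if "v \<in> J" for v using assms(3) that by auto
  define h' where "h' v = (if v \<in> K then 0 else Suc (h v))" for v
  have "\<forall>v\<in>U. h' (if v \<in> J then g v else f v) < h' v"
    using assms(2) h g f unfolding h'_def by auto
  moreover have "(\<lambda>v. if v \<in> J then g v else f v) \<in> U \<rightarrow>\<^sub>E U \<union> K"
    using f f' g assms(1) by (auto simp: PiE_iff extensional_def)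
  ultimately show ?thesis unfolding acyclic_funs_def by blast
qed

text \<open>The lower bound in Cayley's forest formula \<open>k * n ^ (n - k - 1)\<close> for
  \<open>n = card U + card K\<close>, multiplied by \<open>n\<close> to avoid a negative exponent.
  With \<open>J\<close> the set of vertices whose parent lies in \<open>K\<close>, a forest splits
  into a map from \<open>J\<close> to \<open>K\<close> and a forest on \<open>U - J\<close> rooted
  at \<open>J\<close>; induction and the binomial theorem give the bound.\<close>

lemma card_acyclic_funs_ge:
  assumes "finite U" "finite K" "U \<inter> K = {}"
  shows "card K * (card U + card K) ^ card U \<le> (card U + card K) * card (acyclic_funs U K)"
  using assms
proof (induction "card U" arbitrary: U K rule: less_induct)
  case less
  show ?case
  proof (cases "U = {}")
    case True
    then show ?thesis by (simp add: acyclic_funs_def)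
  next
    case False
    define m k where "m = card U" and "k = card K"
    obtain m' where m': "m = Suc m'"
      using False less.prems(1) by (metis card_0_eq m_def not0_implies_Suc)
    define S where "S = (SIGMA J:Pow U. (J \<rightarrow>\<^sub>E K) \<times> acyclic_funs (U - J) J)"
    define glue :: "'a set \<times> ('a \<Rightarrow> 'a) \<times> ('a \<Rightarrow> 'a) \<Rightarrow> 'a \<Rightarrow> 'a"
      where "glue = (\<lambda>(J, g, f) v. if v \<in> J then g v else f v)"
    have "glue ` S \<subseteq> acyclic_funs U K"
      using acyclic_funs_glue[OF _ less.prems(3)] by (auto simp: S_def glue_def)
    moreover have "inj_on glue S"
    proof (rule inj_onI)
      fix x y assume xy: "x \<in> S" "y \<in> S" "glue x = glue y"
      \<comment> \<open>The glued function reveals \<open>J\<close> as the set of vertices sent into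
        \<open>K\<close>.\<close>
      have rec: "fst z = {v \<in> U. glue z v \<in> K}" if z: "z \<in> S" for z
      proof -
        obtain J g f where zz: "z = (J, g, f)" by (cases z)
        have J: "J \<subseteq> U" "g \<in> J \<rightarrow>\<^sub>E K" "f \<in> acyclic_funs (U - J) J"
          using z by (auto simp: zz S_def)
        have "f v \<in> U" if "v \<in> U - J" for v
          using J(1,3) that by (auto simp: acyclic_funs_def PiE_iff)
        then have "f v \<notin> K" if "v \<in> U - J" for v using less.prems(3) that by blast
        moreover have "g v \<in> K" if "v \<in> J" for v using J(2) that by auto
        ultimately show ?thesis using J(1) by (auto simp: zz glue_def)
      qed
      obtain J g f where x: "x = (J, g, f)" by (cases x)
      obtain J' g' f' where y: "y = (J', g', f')" by (cases y)
      have J: "J' = J" using rec[OF xy(1)] rec[OF xy(2)] xy(3) by (simp add: x y)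
      have g: "g \<in> J \<rightarrow>\<^sub>E K" "g' \<in> J \<rightarrow>\<^sub>E K" and f: "f \<in> U - J \<rightarrow>\<^sub>E U - J \<union> J" "f' \<in> U - J \<rightarrow>\<^sub>E U - J \<union> J"
        using xy(1,2) by (auto simp: x y J S_def acyclic_funs_def)
      have eq: "(if v \<in> J then g v else f v) = (if v \<in> J then g' v else f' v)" for v
        using fun_cong[OF xy(3), of v] by (simp add: x y J glue_def)
      have "g = g'" using eq by (intro PiE_ext[OF g]) (metis)
      moreover have "f = f'" using eq by (intro PiE_ext[OF f]) (metis DiffD2)
      ultimately show "x = y" by (simp add: x y J)
    qed
    ultimately have card_S: "card S \<le> card (acyclic_funs U K)"
      using finite_acyclic_funs[OF less.prems(1,2)] by (metis card_image card_mono)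
    have finS: "finite ((J \<rightarrow>\<^sub>E K) \<times> acyclic_funs (U - J) J)" if "J \<subseteq> U" for J
      using less.prems that by (intro finite_cartesian_product finite_PiE finite_acyclic_funs) (auto intro: finite_subset)
    have "card S = (\<Sum>J\<in>Pow U. card ((J \<rightarrow>\<^sub>E K) \<times> acyclic_funs (U - J) J))"
      unfolding S_def using less.prems(1) finS by (intro card_SigmaI) auto
    also have "\<dots> = (\<Sum>J\<in>Pow U. k ^ card J * card (acyclic_funs (U - J) J))"
      using less.prems(1) by (intro sum.cong) (auto simp: card_cartesian_product card_PiE k_def finite_subset)
    \<comment> \<open>The factor \<open>m\<close> is the total number of vertices,
      \<open>card (U - J) + card J\<close>, of each smaller forest, as the induction hypothesis
      wants it.\<close>
    finally have "m * card S = (\<Sum>J\<in>Pow U. k ^ card J * (m * card (acyclic_funs (U - J) J)))"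
      by (simp add: sum_distrib_left mult_ac)
    also have "\<dots> \<ge> (\<Sum>J\<in>Pow U. k ^ card J * (card J * m ^ (m - card J)))"
    proof (intro sum_mono mult_left_mono)
      fix J assume J: "J \<in> Pow U"
      then have finJ: "finite J" using less.prems(1) finite_subset by auto
      show "card J * m ^ (m - card J) \<le> m * card (acyclic_funs (U - J) J)"
      \<comment> \<open>For empty \<open>J\<close> the set \<open>U - J\<close> is no smaller than
        \<open>U\<close> and induction does not apply; there the factor \<open>card J\<close> makes
        the bound trivial.\<close>
      proof (cases "J = {}")
        case False
        have c: "card (U - J) = m - card J" "card J \<le> m" "card J > 0"
          using J finJ False less.prems(1) by (auto simp: m_def card_Diff_subset card_mono card_gt_0_iff)
        then have "card (U - J) < card U" by (simp add: m_def[symmetric])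
        from less.hyps[OF this, of J] show ?thesis using c finJ less.prems(1) by auto
      qed simp
    qed simp
    also have "(\<Sum>J\<in>Pow U. k ^ card J * (card J * m ^ (m - card J)))
        = (\<Sum>j\<le>Suc m'. (Suc m' choose j) * (k ^ j * (j * m ^ (m - j))))"
      using sum_Pow_card[OF less.prems(1), of "\<lambda>j. k ^ j * (j * m ^ (m - j))"] by (simp add: m_def[symmetric] m')
    also have "\<dots> = (\<Sum>i\<le>m'. (Suc m' choose Suc i) * (k ^ Suc i * (Suc i * m ^ (m' - i))))"
      by (subst sum.atMost_Suc_shift) (simp add: m')
    also have "\<dots> = (\<Sum>i\<le>m'. m * k * ((m' choose i) * k ^ i * m ^ (m' - i)))"
    proof (intro sum.cong refl)
      fix i
      have "Suc i * (Suc m' choose Suc i) = m * (m' choose i)"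
        using Suc_times_binomial[of i m'] by (simp add: m')
      then show "(Suc m' choose Suc i) * (k ^ Suc i * (Suc i * m ^ (m' - i))) = m * k * ((m' choose i) * k ^ i * m ^ (m' - i))"
        by (metis (no_types, lifting) mult.assoc mult.commute mult.left_commute power_Suc)
    qed
    also have "\<dots> = m * (k * (m + k) ^ m')"
      by (simp add: sum_distrib_left[symmetric] binomial[of k m m'] add.commute)
    finally have "m * (k * (m + k) ^ m') \<le> m * card S" .
    then have "k * (m + k) ^ m' \<le> card S" using m' by (simp only: mult_le_cancel1)
    then have "k * (m + k) ^ m' \<le> card (acyclic_funs U K)" using card_S by simp
    then have "(m + k) * (k * (m + k) ^ m') \<le> (m + k) * card (acyclic_funs U K)" by (rule mult_left_mono) simp
    then show ?thesis unfolding m_def[symmetric] k_def[symmetric] by (simp add: m' algebra_simps)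
  qed
qed

lemma rooted_acyclic_fun:
  assumes "f \<in> acyclic_funs (V - {r}) {r}" "r \<in> V" "finite V"
  shows "rooted V r f"
proof -
  have "V - {r} \<union> {r} = V" using assms(2) by auto
  then show ?thesis using assms unfolding rooted_def acyclic_funs_def by (auto simp: PiE_iff)
qed

text \<open>The forests whose only root is 1. The factor \<open>n\<close> replaces the exponent
  \<open>n - 2\<close> of Cayley's formula, which would be wrong in truncated subtraction at
  \<open>n = 1\<close> only by accident of convention.\<close>

lemma card_labeled_trees_ge:
  assumes "n \<ge> 1"
  shows "n ^ (n - 1) \<le> n * card (labeled_trees n)"
proof -
  let ?V = "{1..n}" and ?F = "acyclic_funs ({1..n} - {1}) {1::nat}"
  have R: "rooted ?V 1 f" if "f \<in> ?F" for f using rooted_acyclic_fun[OF that] assms by simp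
  have "inj_on (tree_of ?V 1) ?F"
  proof (rule inj_onI)
    fix f g assume fg: "f \<in> ?F" "g \<in> ?F" "tree_of ?V 1 f = tree_of ?V 1 g"
    have "f \<in> ?V - {1} \<rightarrow>\<^sub>E ?V - {1} \<union> {1}" "g \<in> ?V - {1} \<rightarrow>\<^sub>E ?V - {1} \<union> {1}"
      using fg(1,2) unfolding acyclic_funs_def by blast+
    then show "f = g"
      by (rule PiE_ext) (rule tree_of_parent_unique[OF R[OF fg(1)] R[OF fg(2)] fg(3)])
  qed
  moreover have "tree_of ?V 1 ` ?F \<subseteq> labeled_trees n"
    using simple_tree_tree_of[OF R] by (auto simp: labeled_trees_def)
  ultimately have "card ?F \<le> card (labeled_trees n)"
    using finite_labeled_trees by (metis card_image card_mono)
  moreover have "n ^ (n - 1) \<le> n * card ?F"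
    using card_acyclic_funs_ge[of "?V - {1}" "{1}"] assms by simp
  ultimately show ?thesis by (meson le_trans mult_le_mono2)
qed

section \<open>Exponential moments of fibre sizes\<close>

text \<open>The left side is \<open>fact (card A)\<close> times the coefficient of degree
  \<open>card A\<close> in the product of the exponential generating functions with coefficients
  \<open>\<phi> v j / fact j\<close>. The coefficients being nonnegative, it is at most the value of
  the product at 1. The induction splits off the fibre \<open>B\<close> of one point.\<close>

lemma sum_prod_fibres_le:
  fixes \<phi> :: "'v \<Rightarrow> nat \<Rightarrow> real"
  assumes "finite V" "finite A" "\<And>v j. \<phi> v j \<ge> 0" "\<And>v N. v \<in> V \<Longrightarrow> (\<Sum>j\<le>N. \<phi> v j / fact j) \<le> b v"
  shows "(\<Sum>f\<in>A \<rightarrow>\<^sub>E V. \<Prod>v\<in>V. \<phi> v (card {a\<in>A. f a = v})) \<le> fact (card A) * (\<Prod>v\<in>V. b v)"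
  using assms
proof (induction V arbitrary: A rule: finite_induct)
  case empty
  have "A \<rightarrow>\<^sub>E ({} :: 'v set) = {}" if "A \<noteq> {}" using that by (auto simp: PiE_eq_empty_iff)
  then show ?case by (cases "A = {}") simp_all
next
  case (insert v V)
  have b0: "b u \<ge> 0" if "u \<in> insert v V" for u
  proof -
    have "0 \<le> (\<Sum>j\<le>0::nat. \<phi> u j / fact j)" using insert.prems(2) by simp
    also have "\<dots> \<le> b u" using insert.prems(3) that by blast
    finally show ?thesis .
  qed
  define P where "P = (\<Prod>v\<in>V. b v)"
  have P0: "P \<ge> 0" unfolding P_def using b0 by (intro prod_nonneg) auto
  define m where "m = card A"
  let ?S = "SIGMA B:Pow A. (A - B) \<rightarrow>\<^sub>E V"
  let ?glue = "\<lambda>(B, g) a. if a \<in> B then v else g a"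
  let ?w = "\<lambda>f. \<Prod>u\<in>insert v V. \<phi> u (card {a\<in>A. f a = u})"
  have w: "?w (?glue (B, g)) = \<phi> v (card B) * (\<Prod>u\<in>V. \<phi> u (card {a\<in>A - B. g a = u}))"
    if "B \<in> Pow A" "g \<in> (A - B) \<rightarrow>\<^sub>E V" for B g
  proof -
    have gV: "g a \<in> V" if "a \<in> A - B" for a using \<open>g \<in> _\<close> that by auto
    then have gv: "g a \<noteq> v" if "a \<in> A - B" for a using insert.hyps(2) that by metis
    have "{a\<in>A. ?glue (B, g) a = v} = B" using that(1) gv by auto
    moreover have "{a\<in>A. ?glue (B, g) a = u} = {a\<in>A - B. g a = u}" if "u \<in> V" for u
      using insert.hyps(2) that by auto
    ultimately show ?thesis using insert.hyps by (simp cong: prod.cong)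
  qed
  have "(\<Sum>f\<in>A \<rightarrow>\<^sub>E insert v V. ?w f) = (\<Sum>x\<in>?S. ?w (?glue x))"
  proof (rule sum.reindex_bij_witness[where i = "?glue" and j = "\<lambda>f. ({a\<in>A. f a = v}, restrict f (A - {a\<in>A. f a = v}))"])
    fix f assume f: "f \<in> A \<rightarrow>\<^sub>E insert v V"
    show eq: "?glue ({a\<in>A. f a = v}, restrict f (A - {a\<in>A. f a = v})) = f"
      using f by (auto simp: fun_eq_iff PiE_iff extensional_def)
    show "({a\<in>A. f a = v}, restrict f (A - {a\<in>A. f a = v})) \<in> ?S"
      using f by (auto simp: PiE_iff)
    show "?w (?glue ({a\<in>A. f a = v}, restrict f (A - {a\<in>A. f a = v}))) = ?w f" unfolding eq ..
  next
    fix x assume "x \<in> ?S"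
    then obtain B g where x: "x = (B, g)" "B \<subseteq> A" "g \<in> (A - B) \<rightarrow>\<^sub>E V" by auto
    have gV: "g a \<in> V" if "a \<in> A - B" for a using x(3) that by auto
    have gu: "g a = undefined" if "a \<notin> A - B" for a using x(3) that by (auto simp: PiE_iff extensional_def)
    have gv: "g a \<noteq> v" if "a \<in> A - B" for a using gV[OF that] insert.hyps(2) by metis
    have B: "{a\<in>A. ?glue x a = v} = B" using x(1,2) gv by auto
    have "restrict (?glue x) (A - B) = g"
      using gu by (auto simp: fun_eq_iff x(1) restrict_def)
    then show "({a\<in>A. ?glue x a = v}, restrict (?glue x) (A - {a\<in>A. ?glue x a = v})) = x"
      unfolding B by (simp add: x(1))
    show "?glue x \<in> A \<rightarrow>\<^sub>E insert v V"
      using x gV gu by (auto simp: PiE_iff extensional_def)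
  qed
  also have "\<dots> = (\<Sum>B\<in>Pow A. \<Sum>g\<in>(A - B) \<rightarrow>\<^sub>E V. ?w (?glue (B, g)))"
  proof -
    have "finite (Pow A)" "\<forall>B\<in>Pow A. finite ((A - B) \<rightarrow>\<^sub>E V)"
      using insert.prems(1) insert.hyps(1) by (auto intro!: finite_PiE)
    from sum.Sigma[OF this, of "\<lambda>B g. ?w (?glue (B, g))"] show ?thesis
      by (simp only: split_def fst_conv snd_conv)
  qed
  also have "\<dots> = (\<Sum>B\<in>Pow A. \<phi> v (card B) * (\<Sum>g\<in>(A - B) \<rightarrow>\<^sub>E V. \<Prod>u\<in>V. \<phi> u (card {a\<in>A - B. g a = u})))"
    unfolding sum_distrib_left by (intro sum.cong refl w)
  also have "\<dots> \<le> (\<Sum>B\<in>Pow A. \<phi> v (card B) * (fact (m - card B) * P))"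
  proof (intro sum_mono mult_left_mono)
    fix B assume B: "B \<in> Pow A"
    then have "card (A - B) = m - card B"
      using insert.prems(1) by (auto simp: m_def card_Diff_subset finite_subset)
    then show "(\<Sum>g\<in>(A - B) \<rightarrow>\<^sub>E V. \<Prod>u\<in>V. \<phi> u (card {a\<in>A - B. g a = u})) \<le> fact (m - card B) * P"
      using insert.IH[of "A - B"] insert.prems unfolding P_def by simp
  qed (use insert.prems in auto)
  also have "\<dots> = (\<Sum>j\<le>m. real (m choose j) * (\<phi> v j * (fact (m - j) * P)))"
    using sum_Pow_card[OF insert.prems(1), of "\<lambda>j. \<phi> v j * (fact (m - j) * P)"] by (simp add: m_def)
  also have "\<dots> = (\<Sum>j\<le>m. fact m * P * (\<phi> v j / fact j))"
    by (intro sum.cong) (simp_all add: binomial_fact)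
  also have "\<dots> = fact m * P * (\<Sum>j\<le>m. \<phi> v j / fact j)" by (simp add: sum_distrib_left)
  also have "\<dots> \<le> fact m * P * b v"
    using insert.prems(3) P0 by (intro mult_left_mono) auto
  finally show ?case using insert.hyps by (simp add: m_def P_def mult_ac)
qed

lemma sum_exp_series_le:
  fixes x :: real
  assumes "x \<ge> 0"
  shows "(\<Sum>j\<le>N. x ^ j / fact j) \<le> exp x"
proof -
  have s: "(\<lambda>j. x ^ j / fact j) sums exp x"
    using exp_converges[of x] by (simp add: divide_inverse mult.commute)
  then have "(\<Sum>j\<in>{..N}. x ^ j / fact j) \<le> suminf (\<lambda>j. x ^ j / fact j)"
    using assms by (intro sum_le_suminf) (auto simp: sums_iff)
  then show ?thesis using s by (simp add: sums_iff)
qed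

text \<open>Halving the term \<open>j = 1\<close> takes exactly 1/2 off the series of e. For
  \<open>N = 0\<close> that term is absent, and e being at least 2 settles the case.\<close>

lemma sum_exp_series_le':
  "(\<Sum>j\<le>N. (if j = 1 then 1/2 else 1) / fact j) \<le> exp 1 - (1/2::real)"
proof (cases "N = 0")
  case True
  have "(2::real) \<le> exp 1" using exp_ge_add_one_self[of 1] by simp
  with True show ?thesis by simp
next
  case False
  have "(\<Sum>j\<le>N. (if j = 1 then 1/2 else 1) / fact j) = (\<Sum>j\<le>N. 1 ^ j / fact j - (if j = 1 then 1/2 else (0::real)))"
    by (intro sum.cong) auto
  also have "\<dots> = (\<Sum>j\<le>N. 1 ^ j / fact j) - 1/2"
    using False by (simp add: sum_subtractf)
  also have "\<dots> \<le> exp 1 - 1/2" using sum_exp_series_le[of 1 N] by simp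
  finally show ?thesis .
qed

text \<open>If \<open>w\<close> has more preimages than there are singleton fibres, then 2 to the
  size of its fibre times 1/2 to the number of singleton fibres is at least 1. This weight is a
  product over the points, with factor at most \<open>exp 2\<close> for \<open>w\<close> and
  \<open>exp 1 - 1/2\<close> for every other point; a union bound over \<open>w\<close> gives the
  factor \<open>card V\<close>.\<close>

lemma card_few_unary_funs_le:
  fixes V :: "'v set"
  assumes "finite A" "finite V"
  defines "ch \<equiv> \<lambda>f v. card {a\<in>A. f a = v}"
  shows "real (card {f \<in> A \<rightarrow>\<^sub>E V. \<exists>w\<in>V. card {v\<in>V. ch f v = 1} < ch f w})
     \<le> card V * (fact (card A) * (exp 2 * (exp 1 - 1/2) ^ (card V - 1)))"
proof -
  define \<phi> :: "'v \<Rightarrow> 'v \<Rightarrow> nat \<Rightarrow> real" where "\<phi> w v j = (if v = w then 2 ^ j else 1) * (if j = 1 then 1/2 else 1)" for w v j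
  let ?B = "{f \<in> A \<rightarrow>\<^sub>E V. \<exists>w\<in>V. card {v\<in>V. ch f v = 1} < ch f w}"
  have fin: "finite (A \<rightarrow>\<^sub>E V)" using assms by (intro finite_PiE) auto
  have prod: "(\<Prod>v\<in>V. \<phi> w v (ch f v)) = 2 ^ ch f w * (1/2) ^ card {v\<in>V. ch f v = 1}" if "w \<in> V" for f w
  proof -
    have "(\<Prod>v\<in>V. \<phi> w v (ch f v)) = (\<Prod>v\<in>V. if v = w then 2 ^ ch f v else 1) * (\<Prod>v\<in>V. if ch f v = 1 then 1/2 else 1)"
      by (simp add: \<phi>_def prod.distrib)
    also have "(\<Prod>v\<in>V. if v = w then 2 ^ ch f v else 1) = (2 ^ ch f w :: real)"
      using that assms(2) by (simp add: prod.delta)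
    also have "(\<Prod>v\<in>V. if ch f v = 1 then 1/2 else 1) = ((1/2) ^ card {v\<in>V. ch f v = 1} :: real)"
      using assms(2) by (simp add: prod.If_cases Int_def)
    finally show ?thesis .
  qed
  have "real (card ?B) = (\<Sum>f\<in>?B. 1)" by simp
  also have "\<dots> \<le> (\<Sum>f\<in>?B. \<Sum>w\<in>V. \<Prod>v\<in>V. \<phi> w v (ch f v))"
  proof (intro sum_mono)
    fix f assume "f \<in> ?B"
    then obtain w where w: "w \<in> V" "card {v\<in>V. ch f v = 1} \<le> ch f w" by auto
    have "(1::real) = 2 ^ card {v\<in>V. ch f v = 1} * (1/2) ^ card {v\<in>V. ch f v = 1}"
      by (simp add: power_mult_distrib[symmetric])
    also have "\<dots> \<le> 2 ^ ch f w * (1/2) ^ card {v\<in>V. ch f v = 1}"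
      using w by (intro mult_right_mono power_increasing) auto
    also have "\<dots> = (\<Prod>v\<in>V. \<phi> w v (ch f v))" using prod[OF w(1)] by simp
    also have "\<dots> \<le> (\<Sum>w\<in>V. \<Prod>v\<in>V. \<phi> w v (ch f v))"
      using w assms(2) by (intro member_le_sum prod_nonneg) (auto simp: \<phi>_def)
    finally show "1 \<le> (\<Sum>w\<in>V. \<Prod>v\<in>V. \<phi> w v (ch f v))" .
  qed
  also have "\<dots> \<le> (\<Sum>f\<in>A \<rightarrow>\<^sub>E V. \<Sum>w\<in>V. \<Prod>v\<in>V. \<phi> w v (ch f v))"
    using fin by (intro sum_mono2 sum_nonneg prod_nonneg) (auto simp: \<phi>_def)
  also have "\<dots> = (\<Sum>w\<in>V. \<Sum>f\<in>A \<rightarrow>\<^sub>E V. \<Prod>v\<in>V. \<phi> w v (ch f v))" by (rule sum.swap)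
  also have "\<dots> \<le> (\<Sum>w\<in>V. fact (card A) * (exp 2 * (exp 1 - 1/2) ^ (card V - 1)))"
  proof (intro sum_mono)
    fix w assume w: "w \<in> V"
    have "(\<Sum>f\<in>A \<rightarrow>\<^sub>E V. \<Prod>v\<in>V. \<phi> w v (ch f v)) \<le> fact (card A) * (\<Prod>v\<in>V. if v = w then exp 2 else exp 1 - 1/2)"
      unfolding ch_def
    proof (rule sum_prod_fibres_le)
      fix v N
      show "(\<Sum>j\<le>N. \<phi> w v j / fact j) \<le> (if v = w then exp 2 else exp 1 - 1/2)"
      proof (cases "v = w")
        case True
        have "(\<Sum>j\<le>N. \<phi> w v j / fact j) \<le> (\<Sum>j\<le>N. 2 ^ j / fact j)"
          using True by (intro sum_mono) (auto simp: \<phi>_def)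
        also have "\<dots> \<le> exp 2" by (rule sum_exp_series_le) simp
        finally show ?thesis using True by simp
      next
        case False
        then show ?thesis using sum_exp_series_le'[of N] by (simp add: \<phi>_def)
      qed
    qed (use assms in \<open>auto simp: \<phi>_def\<close>)
    also have "(\<Prod>v\<in>V. if v = w then exp 2 else exp 1 - 1/2) = exp 2 * (exp 1 - 1/2 :: real) ^ (card V - 1)"
      using w assms(2) by (subst prod.remove[OF assms(2) w]) (simp cong: prod.cong_simp)
    finally show "(\<Sum>f\<in>A \<rightarrow>\<^sub>E V. \<Prod>v\<in>V. \<phi> w v (ch f v)) \<le> fact (card A) * (exp 2 * (exp 1 - 1/2) ^ (card V - 1))" .
  qed
  finally show ?thesis by simp
qed

lemma card_unbalanced_labeled_trees_le:
  assumes n: "n \<ge> 1"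
  shows "real (card (labeled_trees n - balanced_labeled_trees n)) \<le> n * (fact (n - 1) * (exp 2 * (exp 1 - 1/2) ^ (n - 1)))"
proof -
  let ?V = "{1..n}" and ?A = "{1..n} - {1::nat}"
  let ?B = "{f \<in> ?A \<rightarrow>\<^sub>E ?V. \<exists>w\<in>?V. card {v\<in>?V. card {a\<in>?A. f a = v} = 1} < card {a\<in>?A. f a = w}}"
  have "finite (?A \<rightarrow>\<^sub>E ?V)" by (intro finite_PiE) auto
  then have fin: "finite ?B" by (rule finite_subset[rotated]) blast
  have "labeled_trees n - balanced_labeled_trees n \<subseteq> tree_of ?V 1 ` ?B"
  proof
    fix G assume G: "G \<in> labeled_trees n - balanced_labeled_trees n"
    then have T: "simple_tree G" "pverts G = ?V" "\<not> balanced G"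
      by (auto simp: labeled_trees_def balanced_labeled_trees_def)
    obtain p where p: "rooted ?V 1 p" "G = tree_of ?V 1 p"
      using simple_tree_ex_parent[OF T(1), of 1] T(2) n by auto
    define f where "f = restrict p ?A"
    have ch: "children ?V 1 p v = {a\<in>?A. f a = v}" for v by (auto simp: children_def f_def)
    have "f \<in> ?A \<rightarrow>\<^sub>E ?V" using p(1) by (auto simp: f_def rooted_def)
    moreover have "\<exists>w\<in>?V. card {v\<in>?V. card {a\<in>?A. f a = v} = 1} < card {a\<in>?A. f a = w}"
      using not_balanced_few_unary[OF p(1)] T(3) p(2) unfolding unary_def ch by simp
    moreover have "G = tree_of ?V 1 f" unfolding p(2) tree_of_def by (auto simp: f_def)
    ultimately show "G \<in> tree_of ?V 1 ` ?B" by blast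
  qed
  then have "card (labeled_trees n - balanced_labeled_trees n) \<le> card ?B"
    using fin by (meson card_image_le card_mono finite_imageI order_trans)
  also have "real (card ?B) \<le> card ?V * (fact (card ?A) * (exp 2 * (exp 1 - 1/2) ^ (card ?V - 1)))"
    by (rule card_few_unary_funs_le) auto
  finally show ?thesis using n by simp
qed

text \<open>A Stirling bound up to a polynomial factor; the induction step is the inequality
  \<open>exp 1 \<le> (1 + 1 / n) ^ (n + 1)\<close>.\<close>

lemma fact_exp_le:
  assumes "n \<ge> 1"
  shows "fact n * exp (real n) \<le> exp 1 * real n ^ (n + 1)"
  using assms
proof (induction n rule: dec_induct)
  case (step n)
  have "1 / (1 + real n) \<le> ln (1 + 1 / real n)"
  proof -
    have "1 - 1 / (1 + 1 / real n) \<le> ln (1 + 1 / real n)"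
    proof -
      have "ln (1 / (1 + 1 / real n)) \<le> 1 / (1 + 1 / real n) - 1"
        by (intro ln_le_minus_one) (auto intro!: divide_pos_pos add_pos_nonneg)
      moreover have "ln (1 / (1 + 1 / real n)) = - ln (1 + 1 / real n)"
        by (subst ln_div) (auto intro!: add_pos_nonneg)
      ultimately show ?thesis by linarith
    qed
    moreover have "1 - 1 / (1 + 1 / real n) = 1 / (1 + real n)" using step by (simp add: field_simps)
    ultimately show ?thesis by simp
  qed
  then have "1 \<le> real (Suc n) * ln (1 + 1 / real n)" by (simp add: field_simps)
  then have "exp 1 \<le> exp (real (Suc n) * ln (1 + 1 / real n))" by simp
  also have "\<dots> = (1 + 1 / real n) ^ Suc n"
  proof -
    have "0 < 1 + 1 / real n" by (intro add_pos_nonneg) auto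
    then show ?thesis by (simp only: exp_of_nat_mult exp_ln)
  qed
  finally have e: "exp 1 \<le> (1 + 1 / real n) ^ Suc n" .
  have "fact (Suc n) * exp (real (Suc n)) = real (Suc n) * exp 1 * (fact n * exp (real n))"
    by (simp add: exp_add algebra_simps)
  also have "\<dots> \<le> real (Suc n) * (1 + 1 / real n) ^ Suc n * (exp 1 * real n ^ (n + 1))"
    using step.IH by (intro mult_mono[OF mult_left_mono[OF e]]) auto
  also have "\<dots> = exp 1 * real (Suc n) * ((1 + 1 / real n) * real n) ^ Suc n"
    by (simp add: power_mult_distrib)
  also have "(1 + 1 / real n) * real n = real (Suc n)" using step by (simp add: field_simps)
  finally show ?case by (simp add: mult_ac)
qed simp

lemma labeled_trees_limit:
  "(\<lambda>n. real (card (balanced_labeled_trees n)) / real (card (labeled_trees n))) \<longlonglongrightarrow> 1"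
proof -
  \<comment> \<open>Chosen so that \<open>exp 1 - 1/2 = q * exp 1\<close>: the powers of e cancel
    against the factorial, and \<open>q ^ (n - 1)\<close> is the gain.\<close>
  define q :: real where "q = 1 - exp (-1) / 2"
  have q: "0 < q" "q < 1"
  proof -
    have "exp (-1) < (1::real)" by simp
    moreover have "0 < exp (-1::real)" by simp
    ultimately show "0 < q" "q < 1" unfolding q_def by linarith+
  qed
  define u where "u n = real (card (labeled_trees n - balanced_labeled_trees n)) / real (card (labeled_trees n))" for n
  have bound: "u n \<le> exp 2 * (real n ^ 3 * q ^ (n - 1))" if n: "n \<ge> 1" for n
  proof -
    let ?t = "real (card (labeled_trees n))"
    have t: "real n ^ (n - 1) \<le> real n * ?t"
      using card_labeled_trees_ge[OF n] by (metis of_nat_le_iff of_nat_mult of_nat_power)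
    have t0: "?t > 0"
    proof -
      have "0 < real n ^ (n - 1)" using n by simp
      with t have "0 < real n * ?t" by linarith
      then show ?thesis using n by (simp add: zero_less_mult_iff)
    qed
    have qe: "exp 1 - 1/2 = q * exp 1" by (simp add: q_def algebra_simps exp_minus field_simps)
    have "real (card (labeled_trees n - balanced_labeled_trees n)) \<le> n * (fact (n - 1) * (exp 2 * (q * exp 1) ^ (n - 1)))"
      using card_unbalanced_labeled_trees_le[OF n] unfolding qe .
    also have "\<dots> = fact n * exp (real n) * (exp 1 * q ^ (n - 1))"
    proof -
      have "exp (real n) = exp 1 ^ (n - 1) * exp 1"
        using n by (metis exp_of_nat_mult mult.right_neutral power_Suc2 Suc_diff_1 less_eq_Suc_le One_nat_def)
      moreover have "exp 2 = exp 1 * exp (1::real)" by (simp add: exp_add[symmetric])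
      moreover have "fact n = real n * fact (n - 1)" using n by (simp add: fact_reduce)
      ultimately show ?thesis by (simp add: power_mult_distrib)
    qed
    also have "\<dots> \<le> exp 1 * real n ^ (n + 1) * (exp 1 * q ^ (n - 1))"
      using q by (intro mult_right_mono fact_exp_le n) auto
    also have "\<dots> = exp 2 * real n ^ 2 * q ^ (n - 1) * real n ^ (n - 1)"
    proof -
      have "real n ^ (n + 1) = real n ^ 2 * real n ^ (n - 1)"
        using n by (simp add: power_add[symmetric])
      moreover have "exp 2 = exp 1 * exp (1::real)" by (simp add: exp_add[symmetric])
      ultimately show ?thesis by simp
    qed
    also have "\<dots> \<le> exp 2 * real n ^ 2 * q ^ (n - 1) * (real n * ?t)"
      using q t by (intro mult_left_mono) auto
    finally show ?thesis unfolding u_def using t0 by (simp add: field_simps power3_eq_cube power2_eq_square)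
  qed
  have lim: "(\<lambda>n. exp 2 * (real n ^ 3 * q ^ (n - 1))) \<longlonglongrightarrow> 0"
    using q by real_asymp
  have "u \<longlonglongrightarrow> 0"
    by (rule tendsto_sandwich[OF _ _ tendsto_const lim])
       (use bound in \<open>auto simp: u_def intro!: eventually_sequentiallyI[of 1]\<close>)
  then have "(\<lambda>n. 1 - u n) \<longlonglongrightarrow> 1 - 0" by (intro tendsto_intros)
  moreover have "\<forall>\<^sub>F n in sequentially. 1 - u n = real (card (balanced_labeled_trees n)) / real (card (labeled_trees n))"
  proof (rule eventually_sequentiallyI[of 1])
    fix n :: nat assume n: "1 \<le> n"
    have sub: "balanced_labeled_trees n \<subseteq> labeled_trees n" by (auto simp: balanced_labeled_trees_def)
    then have "card (labeled_trees n - balanced_labeled_trees n) = card (labeled_trees n) - card (balanced_labeled_trees n)"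
      "card (balanced_labeled_trees n) \<le> card (labeled_trees n)"
      using finite_labeled_trees[of n] by (simp_all add: card_Diff_subset finite_subset card_mono)
    moreover have "card (labeled_trees n) > 0"
      using card_labeled_trees_ge[OF n] n by (cases "card (labeled_trees n)") auto
    ultimately show "1 - u n = real (card (balanced_labeled_trees n)) / real (card (labeled_trees n))"
      by (simp add: u_def field_simps)
  qed
  ultimately show ?thesis using tendsto_cong by force
qed


section \<open>Unlabelled rooted trees and their generating function\<close>

definition mset_prod :: "('a \<Rightarrow> real) \<Rightarrow> 'a multiset \<Rightarrow> real" where
  "mset_prod f M = prod_mset (image_mset f M)"

lemma mset_prod_simps [simp]:
  "mset_prod f {#} = 1" "mset_prod f (add_mset a M) = f a * mset_prod f M"
  by (simp_all add: mset_prod_def)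

lemma mset_prod_nonneg: "(\<And>x. 0 \<le> f x) \<Longrightarrow> 0 \<le> mset_prod f M"
  by (induction M) auto

lemma size_eq_Suc_0: "size M = Suc 0 \<longleftrightarrow> (\<exists>a. M = {#a#})"
  by (metis One_nat_def size_1_singleton_mset size_single)

lemma mset_prod_scale: "mset_prod (\<lambda>x. z * f x) M = z ^ size M * mset_prod f M"
  by (induction M) auto

definition bounded_msets :: "'a set \<Rightarrow> nat \<Rightarrow> 'a multiset set" where
  "bounded_msets A J = {M. set_mset M \<subseteq> A \<and> (\<forall>a. count M a \<le> J)}"

lemma bij_betw_bounded_msets:
  assumes "finite A"
  shows "bij_betw (\<lambda>g. \<Sum>a\<in>A. replicate_mset (g a) a) (A \<rightarrow>\<^sub>E {..J}) (bounded_msets A J)"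
proof -
  have c: "count (\<Sum>a\<in>A. replicate_mset (g a) a) b = (if b \<in> A then g b else 0)" for g b
  proof -
    have "count (\<Sum>a\<in>A. replicate_mset (g a) a) b = (\<Sum>a\<in>A. if b = a then g b else 0)"
      unfolding count_sum by (intro sum.cong) auto
    then show ?thesis using assms by simp
  qed
  show ?thesis
  proof (rule bij_betwI[where g = "\<lambda>M. restrict (count M) A"])
    show "(\<lambda>g. \<Sum>a\<in>A. replicate_mset (g a) a) \<in> (A \<rightarrow>\<^sub>E {..J}) \<rightarrow> bounded_msets A J"
    proof
      fix g assume g: "g \<in> A \<rightarrow>\<^sub>E {..J}"
      have "b \<in> A" if "b \<in># (\<Sum>a\<in>A. replicate_mset (g a) a)" for b
      proof (rule ccontr)
        assume "b \<notin> A"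
        then have "count (\<Sum>a\<in>A. replicate_mset (g a) a) b = 0" unfolding c by simp
        with that show False by (simp add: not_in_iff[symmetric])
      qed
      moreover have "count (\<Sum>a\<in>A. replicate_mset (g a) a) b \<le> J" for b
        unfolding c using g by (auto simp: PiE_iff)
      ultimately show "(\<Sum>a\<in>A. replicate_mset (g a) a) \<in> bounded_msets A J"
        unfolding bounded_msets_def by blast
    qed
    show "(\<lambda>M. restrict (count M) A) \<in> bounded_msets A J \<rightarrow> A \<rightarrow>\<^sub>E {..J}"
      by (auto simp: bounded_msets_def)
    show "restrict (count (\<Sum>a\<in>A. replicate_mset (g a) a)) A = g" if "g \<in> A \<rightarrow>\<^sub>E {..J}" for g
      using that by (auto simp: fun_eq_iff c PiE_iff extensional_def)
    show "(\<Sum>a\<in>A. replicate_mset (restrict (count M) A a) a) = M" if "M \<in> bounded_msets A J" for M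
      using that by (intro multiset_eqI) (auto simp: c bounded_msets_def not_in_iff)
  qed
qed

lemma finite_bounded_msets: "finite A \<Longrightarrow> finite (bounded_msets A J)"
  using bij_betw_finite[OF bij_betw_bounded_msets[of A J]] by (simp add: finite_PiE)

lemma sum_bounded_msets:
  assumes "finite A"
  shows "(\<Sum>M\<in>bounded_msets A J. mset_prod f M) = (\<Prod>a\<in>A. \<Sum>j\<le>J. f a ^ j)"
proof -
  have prod_rep: "mset_prod f (\<Sum>a\<in>A. replicate_mset (g a) a) = (\<Prod>a\<in>A. f a ^ g a)" for g
    using assms
  proof (induction A rule: finite_induct)
    case (insert a A)
    have "mset_prod f (replicate_mset k a + M) = f a ^ k * mset_prod f M" for k M
      by (induction k) simp_all
    then show ?case using insert by simp
  qed simp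
  have "(\<Sum>M\<in>bounded_msets A J. mset_prod f M) = (\<Sum>g\<in>A \<rightarrow>\<^sub>E {..J}. mset_prod f (\<Sum>a\<in>A. replicate_mset (g a) a))"
    by (rule sum.reindex_bij_betw[symmetric, OF bij_betw_bounded_msets[OF assms]])
  also have "\<dots> = (\<Prod>a\<in>A. \<Sum>j\<le>J. f a ^ j)"
    unfolding prod_rep using assms by (subst prod_sum_PiE) auto
  finally show ?thesis .
qed

text \<open>The Euler product: multisets over \<open>A\<close> are generated by the product of the
  geometric series \<open>1 / (1 - f a)\<close>. Its exponential form turns products over infinitely
  many trees into sums.\<close>

lemma sum_mset_prod_le:
  assumes "finite A" "finite \<M>" "\<And>M. M \<in> \<M> \<Longrightarrow> set_mset M \<subseteq> A" "\<And>a. 0 \<le> f a" "\<And>a. f a < 1"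
  shows "(\<Sum>M\<in>\<M>. mset_prod f M) \<le> exp (\<Sum>a\<in>A. - ln (1 - f a))"
proof -
  define J where "J = Max (insert 0 (size ` \<M>))"
  have "\<M> \<subseteq> bounded_msets A J"
  proof
    fix M assume M: "M \<in> \<M>"
    have "count M a \<le> size M" for a by (simp add: count_le_size)
    moreover have "size M \<le> J" unfolding J_def using M assms(2) by (intro Max_ge) auto
    ultimately show "M \<in> bounded_msets A J"
      using assms(3)[OF M] by (auto simp: bounded_msets_def intro: order_trans)
  qed
  then have "(\<Sum>M\<in>\<M>. mset_prod f M) \<le> (\<Sum>M\<in>bounded_msets A J. mset_prod f M)"
    using assms(1,4) by (intro sum_mono2 finite_bounded_msets mset_prod_nonneg)
  also have "\<dots> = (\<Prod>a\<in>A. \<Sum>j\<le>J. f a ^ j)" by (rule sum_bounded_msets[OF assms(1)])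
  also have "\<dots> \<le> (\<Prod>a\<in>A. 1 / (1 - f a))"
  proof (intro prod_mono conjI sum_nonneg)
    fix a
    have "(\<Sum>j\<le>J. f a ^ j) \<le> (\<Sum>j. f a ^ j)"
      using assms(4,5)[of a] by (intro sum_le_suminf summable_geometric) auto
    then show "(\<Sum>j\<le>J. f a ^ j) \<le> 1 / (1 - f a)"
      using assms(4,5)[of a] by (simp add: suminf_geometric)
  qed (use assms(4) in auto)
  also have "\<dots> = (\<Prod>a\<in>A. exp (- ln (1 - f a)))"
    using assms(5) by (intro prod.cong refl) (simp add: exp_minus divide_inverse)
  also have "\<dots> = exp (\<Sum>a\<in>A. - ln (1 - f a))" using assms(1) by (simp add: exp_sum)
  finally show ?thesis .
qed

text \<open>Above, every finite sum is at most a finite Euler product. Below, for a finite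
  \<open>A\<close> the products of truncated geometric series are finite sums of
  \<open>mset_prod f\<close> and converge to the full product over \<open>A\<close>; then
  \<open>A\<close> grows.\<close>

lemma has_sum_mset_prod:
  fixes f :: "'a \<Rightarrow> real"
  assumes f: "\<And>a. 0 \<le> f a" "\<And>a. f a < 1" and L: "((\<lambda>a. - ln (1 - f a)) has_sum L) UNIV"
  shows "(mset_prod f has_sum exp L) UNIV"
proof -
  have nn: "0 \<le> - ln (1 - f a)" for a using f[of a] by simp
  have bound: "sum (mset_prod f) \<M> \<le> exp L" if "finite \<M>" for \<M>
  proof -
    have "sum (mset_prod f) \<M> \<le> exp (\<Sum>a\<in>(\<Union>M\<in>\<M>. set_mset M). - ln (1 - f a))"
      using that f by (intro sum_mset_prod_le) auto
    also have "\<dots> \<le> exp L"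
      using finite_sum_le_has_sum[OF L, of "\<Union>M\<in>\<M>. set_mset M"] that nn by simp
    finally show ?thesis .
  qed
  have summ: "mset_prod f summable_on UNIV"
    using bound f by (intro nonneg_bdd_above_summable_on) (auto intro!: mset_prod_nonneg bdd_aboveI[of _ "exp L"])
  have low: "exp (\<Sum>a\<in>A. - ln (1 - f a)) \<le> infsum (mset_prod f) UNIV" if A: "finite A" for A
  proof (rule LIMSEQ_le_const2)
    have "(\<lambda>J. \<Sum>j\<le>J. f a ^ j) \<longlonglongrightarrow> 1 / (1 - f a)" for a
      using geometric_sums[of "f a"] f[of a] by (simp add: sums_def_le)
    then have "(\<lambda>J. \<Prod>a\<in>A. \<Sum>j\<le>J. f a ^ j) \<longlonglongrightarrow> (\<Prod>a\<in>A. 1 / (1 - f a))"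
      by (rule tendsto_prod)
    also have "(\<Prod>a\<in>A. 1 / (1 - f a)) = (\<Prod>a\<in>A. exp (- ln (1 - f a)))"
      using f by (intro prod.cong refl) (simp add: exp_minus divide_inverse)
    also have "\<dots> = exp (\<Sum>a\<in>A. - ln (1 - f a))" using A by (simp add: exp_sum)
    finally show "(\<lambda>J. \<Sum>M\<in>bounded_msets A J. mset_prod f M) \<longlonglongrightarrow> exp (\<Sum>a\<in>A. - ln (1 - f a))"
      unfolding sum_bounded_msets[OF A] .
    show "\<exists>N. \<forall>J\<ge>N. (\<Sum>M\<in>bounded_msets A J. mset_prod f M) \<le> infsum (mset_prod f) UNIV"
      using A f summ by (intro exI allI impI finite_sum_le_infsum finite_bounded_msets mset_prod_nonneg) auto
  qed
  have "((\<lambda>A. exp (\<Sum>a\<in>A. - ln (1 - f a))) \<longlongrightarrow> exp L) (finite_subsets_at_top UNIV)"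
    using L unfolding has_sum_def by (intro tendsto_exp)
  then have "exp L \<le> infsum (mset_prod f) UNIV"
    by (rule tendsto_upperbound) (auto intro!: eventually_finite_subsets_at_top_weakI low)
  moreover have "infsum (mset_prod f) UNIV \<le> exp L"
    using summ bound by (intro infsum_le_finite_sums) auto
  ultimately show ?thesis using has_sum_infsum[OF summ] by simp
qed

section \<open>Rooted trees, truncation by size, and the functional equation\<close>

text \<open>Taking the subtrees as a multiset makes equality of terms the isomorphism of unlabelled
  rooted trees.\<close>

datatype rtree = Node "rtree multiset"

primrec nodes :: "rtree \<Rightarrow> nat" where
  "nodes (Node M) = Suc (sum_mset (image_mset nodes M))"

primrec unaries :: "rtree \<Rightarrow> nat" where
  "unaries (Node M) = (if size M = 1 then 1 else 0) + sum_mset (image_mset unaries M)"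

primrec width :: "rtree \<Rightarrow> nat" where
  "width (Node M) = Max (insert (size M) (set_mset (image_mset width M)))"

lemma nodes_ge_1: "1 \<le> nodes T"
  by (cases T) simp

lemma nodes_le_sum_mset: "T \<in># M \<Longrightarrow> nodes T \<le> sum_mset (image_mset nodes M)"
  by (induction M) auto

lemma size_le_sum_nodes: "size M \<le> sum_mset (image_mset nodes M)"
proof (induction M)
  case (add T M)
  then show ?case using nodes_ge_1[of T] by simp
qed simp

text \<open>Finite truncations: since \<open>small (Suc N)\<close> consists of the trees over
  \<open>small_forests N\<close>, bounds on partial sums of generating functions can be proved by
  induction on \<open>N\<close>, without presupposing convergence.\<close>

definition small :: "nat \<Rightarrow> rtree set" where
  "small N = {T. nodes T \<le> N}"

definition small_forests :: "nat \<Rightarrow> rtree multiset set" where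
  "small_forests N = {M. sum_mset (image_mset nodes M) \<le> N}"

lemma small_0 [simp]: "small 0 = {}"
  using nodes_ge_1 by (auto simp: small_def not_le intro: less_le_trans)

lemma small_Suc: "small (Suc N) = Node ` small_forests N"
proof (intro equalityI subsetI)
  fix T assume "T \<in> small (Suc N)"
  then show "T \<in> Node ` small_forests N" by (cases T) (auto simp: small_def small_forests_def)
qed (auto simp: small_def small_forests_def)

lemma small_forests_subset: "M \<in> small_forests N \<Longrightarrow> set_mset M \<subseteq> small N"
  using nodes_le_sum_mset by (fastforce simp: small_def small_forests_def)

lemma finite_small_forests: "finite (small N) \<Longrightarrow> finite (small_forests N)"
proof -
  assume fin: "finite (small N)"
  have "small_forests N \<subseteq> bounded_msets (small N) N"
  proof
    fix M assume M: "M \<in> small_forests N"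
    have "count M T \<le> N" for T
      using M size_le_sum_nodes[of M] count_le_size[of M T] by (simp add: small_forests_def)
    then show "M \<in> bounded_msets (small N) N"
      using small_forests_subset[OF M] by (simp add: bounded_msets_def)
  qed
  then show ?thesis using finite_bounded_msets[OF fin] finite_subset by blast
qed

lemma finite_small: "finite (small N)"
  by (induction N) (simp_all add: small_Suc finite_small_forests)

lemma finite_subset_small:
  assumes "finite F"
  shows "\<exists>N. F \<subseteq> small N"
proof
  show "F \<subseteq> small (Max (insert 0 (nodes ` F)))"
    using assms by (auto simp: small_def)
qed

definition wt :: "real \<Rightarrow> real \<Rightarrow> rtree \<Rightarrow> real" where
  "wt x u T = x ^ nodes T * u ^ unaries T"

lemma wt_Node: "wt x u (Node M) = x * (if size M = 1 then u else 1) * mset_prod (wt x u) M"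
proof -
  have "x ^ sum_mset (image_mset nodes M) * u ^ sum_mset (image_mset unaries M) = mset_prod (wt x u) M"
    by (induction M) (simp_all add: wt_def power_add mult_ac)
  then show ?thesis by (simp add: wt_def power_add mult_ac)
qed

lemma wt_nonneg: "0 \<le> x \<Longrightarrow> 0 \<le> u \<Longrightarrow> 0 \<le> wt x u T"
  by (simp add: wt_def)

lemma wt_le:
  assumes "0 \<le> x" "x \<le> 1" "0 \<le> u" "u \<le> 1"
  shows "wt x u T \<le> x"
proof -
  have "wt x u T \<le> x ^ nodes T * 1"
    unfolding wt_def using assms by (intro mult_left_mono power_le_one) auto
  also have "\<dots> \<le> x ^ 1 * 1"
    using assms nodes_ge_1[of T] by (intro mult_right_mono power_decreasing) auto
  finally show ?thesis by simp
qed

lemma wt_mono: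
  assumes "0 \<le> x" "x \<le> y" "0 \<le> u" "u \<le> v"
  shows "wt x u T \<le> wt y v T"
  unfolding wt_def using assms by (intro mult_mono power_mono) auto

lemma minus_ln_le:
  assumes "0 \<le> t" "t \<le> x" "x < (1::real)"
  shows "- ln (1 - t) \<le> t / (1 - x)"
proof -
  have "- ln (1 - t) = ln (1 / (1 - t))" using assms by (simp add: ln_div)
  also have "\<dots> \<le> 1 / (1 - t) - 1" using assms by (intro ln_le_minus_one) simp
  also have "\<dots> = t / (1 - t)" using assms by (simp add: field_simps)
  also have "\<dots> \<le> t / (1 - x)" using assms by (intro divide_left_mono) auto
  finally show ?thesis .
qed

lemma summable_wtI:
  assumes "0 \<le> x" "0 \<le> u" "\<And>N. sum (wt x u) (small N) \<le> B"
  shows "wt x u summable_on UNIV" "infsum (wt x u) UNIV \<le> B"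
proof -
  have b: "sum (wt x u) F \<le> B" if "finite F" for F
  proof -
    obtain N where "F \<subseteq> small N" using finite_subset_small[OF \<open>finite F\<close>] by blast
    then have "sum (wt x u) F \<le> sum (wt x u) (small N)"
      using assms by (intro sum_mono2 finite_small wt_nonneg)
    then show ?thesis using assms(3)[of N] by simp
  qed
  show s: "wt x u summable_on UNIV"
    using b assms by (intro nonneg_bdd_above_summable_on) (auto intro!: wt_nonneg bdd_aboveI[of _ B])
  show "infsum (wt x u) UNIV \<le> B"
    using s b by (intro infsum_le_finite_sums) auto
qed

lemma summable_minus_ln:
  assumes "0 < x" "x < 1" "0 \<le> u" "u \<le> 1" "wt x u summable_on UNIV"
  shows "(\<lambda>T. - ln (1 - wt x u T)) summable_on UNIV"
proof (rule summable_on_comparison_test)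
  show "(\<lambda>T. 1 / (1 - x) * wt x u T) summable_on UNIV"
    using assms(5) by (rule summable_on_cmult_right)
  fix T
  have w: "0 \<le> wt x u T" "wt x u T \<le> x" using assms by (auto intro: wt_nonneg wt_le)
  show "- ln (1 - wt x u T) \<le> 1 / (1 - x) * wt x u T"
    using minus_ln_le[OF w] assms by simp
  show "0 \<le> - ln (1 - wt x u T)" using w assms by simp
qed

text \<open>The root contributes \<open>x\<close> and the forest below it the Euler product
  \<open>exp L\<close>. Forests with a single tree, of total weight \<open>y\<close>, make the root
  unary and must carry the factor \<open>u\<close> instead of 1, whence the correction.\<close>

lemma wt_functional_equation:
  assumes "0 < x" "x < 1" "0 \<le> u" "u \<le> 1" and s: "wt x u summable_on UNIV"
  defines "y \<equiv> infsum (wt x u) UNIV" and "L \<equiv> infsum (\<lambda>T. - ln (1 - wt x u T)) UNIV"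
  shows "y = x * (exp L - (1 - u) * y)"
proof -
  have w: "0 \<le> wt x u T" "wt x u T < 1" for T
    using wt_le[of x u T] assms by (auto intro: wt_nonneg)
  have 1: "(mset_prod (wt x u) has_sum exp L) UNIV"
    unfolding L_def using w summable_minus_ln[OF assms(1-5)]
    by (intro has_sum_mset_prod has_sum_infsum) auto
  have y: "(wt x u has_sum y) UNIV" unfolding y_def using s by simp
  have inj: "inj (\<lambda>T::rtree. {#T#})" by (auto intro: injI)
  have "(mset_prod (wt x u) has_sum y) (range (\<lambda>T. {#T#}))"
    unfolding has_sum_reindex[OF inj] using y by (simp add: o_def)
  then have 2: "((\<lambda>M. if size M = 1 then mset_prod (wt x u) M else 0) has_sum y) UNIV"
    by (subst has_sum_cong_neutral[where T = "range (\<lambda>T. {#T#})" and g = "mset_prod (wt x u)"])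
       (auto simp: size_eq_Suc_0)
  have "((\<lambda>M. x * (mset_prod (wt x u) M + - (1 - u) * (if size M = 1 then mset_prod (wt x u) M else 0)))
     has_sum (x * (exp L + - (1 - u) * y))) UNIV"
    by (intro has_sum_cmult_right has_sum_add 1 2)
  also have "(\<lambda>M. x * (mset_prod (wt x u) M + - (1 - u) * (if size M = 1 then mset_prod (wt x u) M else 0)))
    = wt x u \<circ> Node"
    by (auto simp: fun_eq_iff wt_Node algebra_simps)
  finally have "((wt x u \<circ> Node) has_sum (x * (exp L + - (1 - u) * y))) UNIV" .
  moreover have "inj Node" "range Node = UNIV" by (auto intro: injI) (metis rangeI rtree.exhaust)
  ultimately have "(wt x u has_sum (x * (exp L + - (1 - u) * y))) UNIV"
    using has_sum_reindex[of Node UNIV "wt x u"] by simp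
  with y have "y = x * (exp L + - (1 - u) * y)" by (rule has_sum_unique)
  then show ?thesis by (simp only: mult_minus_left add_uminus_conv_diff)
qed

lemma sum_singletons_small_forests:
  "(\<Sum>M\<in>small_forests N. if size M = 1 then mset_prod (wt x u) M else 0) = sum (wt x u) (small N)"
proof -
  have "(\<Sum>M\<in>small_forests N. if size M = 1 then mset_prod (wt x u) M else 0)
      = (\<Sum>M\<in>(\<lambda>T. {#T#}) ` small N. mset_prod (wt x u) M)"
    using finite_small_forests[OF finite_small]
    by (intro sum.mono_neutral_cong_right) (auto simp: small_def small_forests_def size_eq_Suc_0)
  also have "\<dots> = sum (wt x u) (small N)"
    by (subst sum.reindex) (auto intro: inj_onI)
  finally show ?thesis .
qed

text \<open>Truncated form of the functional equation. Only an inequality: a forest with at most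
  \<open>N\<close> nodes has all its trees in \<open>small N\<close>, but a multiset over
  \<open>small N\<close> may have more nodes.\<close>

lemma sum_wt_small_Suc_le:
  assumes "0 \<le> x" "x < 1" "0 \<le> u" "u \<le> 1"
  shows "sum (wt x u) (small (Suc N)) \<le>
    x * (exp (\<Sum>T\<in>small N. - ln (1 - wt x u T)) - (1 - u) * sum (wt x u) (small N))"
proof -
  have w: "0 \<le> wt x u T" "wt x u T < 1" for T
    using wt_le[of x u T] assms by (auto intro: wt_nonneg)
  have "sum (wt x u) (small (Suc N)) = (\<Sum>M\<in>small_forests N. wt x u (Node M))"
    unfolding small_Suc by (subst sum.reindex) (auto intro: inj_onI)
  also have "\<dots> = (\<Sum>M\<in>small_forests N. x * (mset_prod (wt x u) M - (1 - u) * (if size M = 1 then mset_prod (wt x u) M else 0)))"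
    by (intro sum.cong) (auto simp: wt_Node algebra_simps)
  also have "\<dots> = x * ((\<Sum>M\<in>small_forests N. mset_prod (wt x u) M) - (1 - u) * sum (wt x u) (small N))"
    by (simp only: sum_distrib_left[symmetric] sum_subtractf sum_singletons_small_forests)
  also have "\<dots> \<le> x * (exp (\<Sum>T\<in>small N. - ln (1 - wt x u T)) - (1 - u) * sum (wt x u) (small N))"
    using assms(1) w by (intro mult_left_mono diff_right_mono sum_mset_prod_le small_forests_subset
      finite_small finite_small_forests) auto
  finally show ?thesis .
qed


section \<open>The radius of convergence\<close>

text \<open>Stands for the radius of convergence. The bound 1 is where \<open>r * exp (- r)\<close>
  is maximal, so the generating function cannot be continued past this value;
  \<open>not_summable_beyond_rho\<close> makes this precise.\<close>

definition rho :: real where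
  "rho = Sup {x. 0 < x \<and> (\<forall>N. sum (wt x 1) (small N) \<le> 1)}"

lemma sum_wt_mono:
  assumes "0 \<le> x" "x \<le> y" "0 \<le> u" "u \<le> v"
  shows "sum (wt x u) (small N) \<le> sum (wt y v) (small N)"
  using assms by (intro sum_mono wt_mono)

text \<open>The four trees with at most three nodes already contribute
  \<open>x + x ^ 2 + 2 * x ^ 3\<close>, which equals 1 at 1/2.\<close>

lemma sum_wt_small_le_half:
  assumes "0 < x" "\<And>N. sum (wt x 1) (small N) \<le> 1"
  shows "x \<le> 1/2"
proof (rule ccontr)
  assume x: "\<not> x \<le> 1/2"
  define a b c d where "a = Node {#}" and "b = Node {#a#}" and "c = Node {#b#}" and "d = Node {#a, a#}"
  have "(\<Sum>T\<in>{a, b, c, d}. wt x 1 T) \<le> sum (wt x 1) (small 3)"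
    using assms(1) by (intro sum_mono2 finite_small wt_nonneg) (auto simp: small_def a_def b_def c_def d_def)
  also have "\<dots> \<le> 1" by (rule assms(2))
  also have "(\<Sum>T\<in>{a, b, c, d}. wt x 1 T) = x + x ^ 2 + 2 * x ^ 3"
    by (simp add: a_def b_def c_def d_def wt_def eval_nat_numeral)
  finally have "x + x ^ 2 + 2 * x ^ 3 \<le> 1" .
  moreover have "(1/2)^2 < x ^ 2" "(1/2)^3 < x ^ 3"
    using x by (intro power_strict_mono; simp)+
  ultimately show False using x by (simp add: power2_eq_square power3_eq_cube)
qed

text \<open>Shows that \<open>rho\<close> is positive. There is room to spare: the exponent is at
  most 16/15, hence at most 2, and e squared is at most 9.\<close>

lemma sum_wt_small_sixteenth: "sum (wt (1/16) 1) (small N) \<le> 1"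
proof (induction N)
  case (Suc N)
  have w: "0 \<le> wt (1/16) 1 T" "wt (1/16) 1 T \<le> 1/16" for T
    using wt_le[of "1/16" 1 T] by (auto intro: wt_nonneg)
  have "(\<Sum>T\<in>small N. - ln (1 - wt (1/16) 1 T)) \<le> (\<Sum>T\<in>small N. wt (1/16) 1 T / (1 - 1/16))"
    using w by (intro sum_mono minus_ln_le) auto
  also have "\<dots> = sum (wt (1/16) 1) (small N) / (1 - 1/16)" by (simp only: sum_divide_distrib)
  also have "\<dots> \<le> 2" using Suc by simp
  finally have "exp (\<Sum>T\<in>small N. - ln (1 - wt (1/16) 1 T)) \<le> exp 2" by simp
  also have "exp 2 = exp 1 * exp (1::real)" by (simp add: exp_add[symmetric])
  also have "\<dots> \<le> 3 * 3" using exp_le by (intro mult_mono) auto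
  finally have "1/16 * exp (\<Sum>T\<in>small N. - ln (1 - wt (1/16) 1 T)) \<le> 1" by simp
  then show ?case using sum_wt_small_Suc_le[of "1/16" 1 N] by simp
qed simp

lemma rho_pos: "0 < rho" and rho_le: "rho \<le> 1/2"
  and sum_wt_gt_1: "rho < x \<Longrightarrow> \<exists>N. 1 < sum (wt x 1) (small N)"
  and sum_wt_rho_le: "sum (wt rho 1) (small N) \<le> 1"
proof -
  let ?X = "{x. 0 < x \<and> (\<forall>N. sum (wt x 1) (small N) \<le> 1)}"
  have ne: "1/16 \<in> ?X" using sum_wt_small_sixteenth by simp
  have bd: "bdd_above ?X" using sum_wt_small_le_half by (intro bdd_aboveI[of _ "1/2"]) auto
  have "1/16 \<le> rho" unfolding rho_def using ne bd by (intro cSup_upper) auto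
  then show pos: "0 < rho" by simp
  show "rho \<le> 1/2" unfolding rho_def
  proof (rule cSup_least)
    show "?X \<noteq> {}" using ne by blast
  qed (use sum_wt_small_le_half in auto)
  show "\<exists>N. 1 < sum (wt x 1) (small N)" if "rho < x" for x
  proof (rule ccontr)
    assume "\<not> ?thesis"
    then have "x \<in> ?X" using that pos by (auto simp: not_less)
    then have "x \<le> rho" unfolding rho_def using bd by (intro cSup_upper)
    with that show False by simp
  qed
  have below: "sum (wt x 1) (small N) \<le> 1" if x: "0 < x" "x < rho" for x
  proof -
    have "?X \<noteq> {}" using ne by blast
    then obtain y where y: "y \<in> ?X" "x < y"
      using less_cSup_iff[OF _ bd] x unfolding rho_def by blast
    then have "sum (wt x 1) (small N) \<le> sum (wt y 1) (small N)"
      using x by (intro sum_wt_mono) auto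
    also have "\<dots> \<le> 1" using y(1) by blast
    finally show ?thesis .
  qed
  \<comment> \<open>A partial sum is a polynomial in \<open>x\<close>, so the bound valid below the
    supremum passes to \<open>rho\<close> itself.\<close>
  have "((\<lambda>x. sum (wt x 1) (small N)) \<longlongrightarrow> sum (wt rho 1) (small N)) (at_left rho)"
    unfolding wt_def by (intro tendsto_intros)
  moreover have "\<forall>\<^sub>F x in at_left rho. sum (wt x 1) (small N) \<le> 1"
    using eventually_at_left_real[OF pos] by eventually_elim (use below in auto)
  ultimately show "sum (wt rho 1) (small N) \<le> 1"
    by (rule tendsto_upperbound) simp
qed

lemma minus_ln_minus_mono:
  assumes "0 \<le> s" "s \<le> t" "t < (1::real)"
  shows "- ln (1 - s) - s \<le> - ln (1 - t) - t"
proof -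
  have "ln ((1 - t) / (1 - s)) \<le> (1 - t) / (1 - s) - 1" using assms by (intro ln_le_minus_one) simp
  also have "\<dots> = - ((t - s) / (1 - s))" using assms by (simp add: field_simps)
  also have "\<dots> \<le> - ((t - s) / 1)" using assms by (intro le_imp_neg_le divide_left_mono) auto
  finally show ?thesis using assms by (simp add: ln_div)
qed

(* The generating function R satisfies x * exp (C x) = R x * exp (- R x) with C increasing, and
   r * exp (- r) is decreasing for r >= 1, so R cannot take values above 1. *)
lemma not_summable_beyond_rho:
  assumes "rho < x" "x < 1"
  shows "\<not> wt x 1 summable_on UNIV"
proof
  assume s: "wt x 1 summable_on UNIV"
  define z where "z = (rho + x) / 2"
  have z: "rho < z" "z < x" "0 < z" "z < 1" and x0: "0 < x" using assms rho_pos by (auto simp: z_def)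
  have mono: "wt z 1 T \<le> wt x 1 T" for T using z by (intro wt_mono) auto
  have sz: "wt z 1 summable_on UNIV"
    using z by (intro summable_on_comparison_test[OF s] mono wt_nonneg) auto
  define Y y where "Y = infsum (wt x 1) UNIV" and "y = infsum (wt z 1) UNIV"
  define K k where "K = infsum (\<lambda>T. - ln (1 - wt x 1 T)) UNIV" and "k = infsum (\<lambda>T. - ln (1 - wt z 1 T)) UNIV"
  have lx: "(\<lambda>T. - ln (1 - wt x 1 T)) summable_on UNIV" and lz: "(\<lambda>T. - ln (1 - wt z 1 T)) summable_on UNIV"
    using s sz z x0 assms by (auto intro!: summable_minus_ln)
  obtain N where "1 < sum (wt z 1) (small N)" using sum_wt_gt_1[OF z(1)] by blast
  also have "\<dots> \<le> y" unfolding y_def using sz z by (intro finite_sum_le_infsum finite_small wt_nonneg) auto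
  finally have y1: "1 < y" .
  \<comment> \<open>Every tree has a node, so passing from \<open>z\<close> to \<open>x\<close>
    multiplies each weight by at least \<open>x / z\<close>; this makes \<open>y < Y\<close>
    strict.\<close>
  have "x / z * y \<le> Y"
  proof (rule has_sum_mono)
    show "((\<lambda>T. x / z * wt z 1 T) has_sum (x / z * y)) UNIV"
      using sz unfolding y_def by (intro has_sum_cmult_right) simp
    show "(wt x 1 has_sum Y) UNIV" using s by (simp add: Y_def)
    fix T
    obtain m where m: "nodes T = Suc m" using nodes_ge_1[of T] by (cases "nodes T") auto
    have "x / z * wt z 1 T = x * z ^ m" using z by (simp add: wt_def m)
    also have "\<dots> \<le> x * x ^ m" using z by (intro mult_left_mono power_mono) auto
    finally show "x / z * wt z 1 T \<le> wt x 1 T" by (simp add: wt_def m)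
  qed
  moreover have "1 * y < x / z * y" using y1 z by (intro mult_strict_right_mono) auto
  ultimately have yY: "y < Y" by simp
  have "k + - 1 * y \<le> K + - 1 * Y"
  proof (rule has_sum_mono)
    show "((\<lambda>T. - ln (1 - wt z 1 T) + - 1 * wt z 1 T) has_sum (k + - 1 * y)) UNIV"
      using lz sz unfolding k_def y_def by (intro has_sum_add has_sum_cmult_right has_sum_infsum)
    show "((\<lambda>T. - ln (1 - wt x 1 T) + - 1 * wt x 1 T) has_sum (K + - 1 * Y)) UNIV"
      using lx s unfolding K_def Y_def by (intro has_sum_add has_sum_cmult_right has_sum_infsum)
    show "- ln (1 - wt z 1 T) + - 1 * wt z 1 T \<le> - ln (1 - wt x 1 T) + - 1 * wt x 1 T" for T
      using minus_ln_minus_mono[OF wt_nonneg[of z 1 T] mono] wt_le[of x 1 T] z assms x0 by simp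
  qed
  moreover have "Y = x * exp K" unfolding Y_def K_def
    using wt_functional_equation[of x 1] s x0 assms by simp
  moreover have "y = z * exp k" unfolding y_def k_def
    using wt_functional_equation[of z 1] sz z by simp
  moreover have "ln (x * exp K) = ln x + K" "ln (z * exp k) = ln z + k"
    using x0 z by (simp_all add: ln_mult)
  moreover have "ln z < ln x" using z by simp
  \<comment> \<open>In logarithmic form the two equations say that \<open>ln Y - ln y\<close>
    exceeds \<open>K - k\<close>, which is at least \<open>Y - y\<close>; but the slope of the
    logarithm is below 1 beyond 1.\<close>
  ultimately have "Y - y < ln Y - ln y" by simp
  also have "\<dots> = ln (Y / y)" using y1 yY by (simp add: ln_div)
  also have "\<dots> \<le> Y / y - 1" using y1 yY by (intro ln_le_minus_one) simp
  also have "\<dots> = (Y - y) / y" using y1 by (simp add: field_simps)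
  also have "\<dots> \<le> (Y - y) / 1" using y1 yY by (intro divide_left_mono) auto
  finally show False by simp
qed

section \<open>Growth of the number of rooted trees\<close>

definition num_rtrees :: "nat \<Rightarrow> nat" where
  "num_rtrees n = card {T. nodes T = n}"

lemma finite_nodes_eq: "finite {T. nodes T = n}"
  by (rule finite_subset[OF _ finite_small[of n]]) (auto simp: small_def)

lemma num_rtrees_pos: "1 \<le> n \<Longrightarrow> 0 < num_rtrees n"
proof (induction n rule: dec_induct)
  case base
  have "Node {#} \<in> {T. nodes T = 1}" by simp
  then show ?case unfolding num_rtrees_def using finite_nodes_eq card_gt_0_iff by blast
next
  case (step n)
  then obtain T where "nodes T = n"
    unfolding num_rtrees_def card_gt_0_iff by blast
  then have "Node {#T#} \<in> {T. nodes T = Suc n}" by simp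
  then show ?case unfolding num_rtrees_def using finite_nodes_eq card_gt_0_iff by blast
qed

text \<open>Two trees are joined under a new root. Their different sizes tell them apart, so the
  unordered pair of subtrees determines the ordered one.\<close>

lemma num_rtrees_supermult:
  assumes "m < n"
  shows "num_rtrees m * num_rtrees n \<le> num_rtrees (m + n + 1)"
proof -
  let ?A = "{T. nodes T = m} \<times> {T. nodes T = n}"
  have "S = S' \<and> T = T'" if "{#S, T#} = {#S', T'#}" "nodes S = m" "nodes T = n" "nodes S' = m" "nodes T' = n" for S T S' T'
    using that assms by (auto simp: add_eq_conv_ex)
  then have "inj_on (\<lambda>(S, T). Node {#S, T#}) ?A"
    unfolding inj_on_def by simp
  then have "card ?A \<le> card {T. nodes T = m + n + 1}"
    by (intro card_inj_on_le[OF _ _ finite_nodes_eq]) auto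
  then show ?thesis by (simp add: num_rtrees_def card_cartesian_product)
qed

lemma sum_wt_small_num_rtrees:
  "sum (wt x 1) (small N) = (\<Sum>m=1..N. real (num_rtrees m) * x ^ m)"
proof -
  have "sum (wt x 1) (small N) = (\<Sum>m=1..N. \<Sum>T | T \<in> small N \<and> nodes T = m. wt x 1 T)"
    using nodes_ge_1 by (intro sum.group[symmetric] finite_small) (auto simp: small_def)
  also have "\<dots> = (\<Sum>m=1..N. \<Sum>T | nodes T = m. x ^ m)"
    by (intro sum.cong) (auto simp: small_def wt_def)
  finally show ?thesis by (simp add: num_rtrees_def)
qed

text \<open>Divergence between \<open>rho\<close> and \<open>y\<close> yields one \<open>m\<close>
  with \<open>num_rtrees m * y ^ (m + 1)\<close> at least 1. Joining a tree of that size under a new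
  root then carries a lower bound from \<open>n - m - 1\<close> to \<open>n\<close>.\<close>

lemma num_rtrees_growth:
  assumes "rho < y" "y < 1"
  shows "\<exists>c>0. \<exists>m. \<forall>n>m. c \<le> real (num_rtrees n) * y ^ n"
proof -
  have y0: "0 < y" using assms rho_pos by simp
  have "\<exists>m. 1 \<le> real (num_rtrees m) * y ^ (m + 1)"
  proof (rule ccontr)
    assume "\<not> ?thesis"
    then have lt: "real (num_rtrees m) * y ^ (m + 1) < 1" for m by (simp add: not_le)
    define z where "z = (rho + y) / 2"
    have z: "rho < z" "z < y" "0 < z" using assms rho_pos by (auto simp: z_def)
    define q where "q = z / y"
    have q: "0 \<le> q" "q < 1" using z y0 by (auto simp: q_def)
    have "wt z 1 summable_on UNIV"
    proof (rule summable_wtI(1)[of _ _ "1 / y * (1 / (1 - q))"])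
      fix N
      have "sum (wt z 1) (small N) = (\<Sum>m=1..N. real (num_rtrees m) * z ^ m)" by (rule sum_wt_small_num_rtrees)
      also have "\<dots> \<le> (\<Sum>m=1..N. 1 / y * q ^ m)"
      proof (intro sum_mono)
        fix m
        have "real (num_rtrees m) * z ^ m = real (num_rtrees m) * y ^ (m + 1) * (1 / y * q ^ m)"
          using y0 by (simp add: q_def power_divide)
        also have "\<dots> \<le> 1 * (1 / y * q ^ m)"
          using lt[of m] y0 q by (intro mult_right_mono) auto
        finally show "real (num_rtrees m) * z ^ m \<le> 1 / y * q ^ m" by simp
      qed
      also have "\<dots> = 1 / y * (\<Sum>m=1..N. q ^ m)" by (simp add: sum_distrib_left)
      also have "(\<Sum>m=1..N. q ^ m) \<le> (\<Sum>m. q ^ m)"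
        using q by (intro sum_le_suminf summable_geometric) auto
      also have "\<dots> = 1 / (1 - q)" using q by (simp add: suminf_geometric)
      finally show "sum (wt z 1) (small N) \<le> 1 / y * (1 / (1 - q))" using y0 by (simp add: mult_left_mono divide_right_mono)
    qed (use z in auto)
    then show False using not_summable_beyond_rho[of z] z assms by auto
  qed
  then obtain m where m: "1 \<le> real (num_rtrees m) * y ^ (m + 1)" by blast
  \<comment> \<open>A window of \<open>m + 1\<close> consecutive sizes starts the induction with
    step \<open>m + 1\<close>; beyond it, \<open>n - m - 1\<close> still exceeds \<open>m\<close>,
    as \<open>num_rtrees_supermult\<close> requires.\<close>
  define F where "F = (\<lambda>n. real (num_rtrees n) * y ^ n) ` {m+1..2*m+1}"
  have Fpos: "0 < t" if "t \<in> F" for t using that y0 num_rtrees_pos by (auto simp: F_def)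
  have F: "finite F" "F \<noteq> {}" by (auto simp: F_def)
  have "Min F \<le> real (num_rtrees n) * y ^ n" if "n > m" for n
    using that
  proof (induction n rule: less_induct)
    case (less n)
    show ?case
    proof (cases "n \<le> 2 * m + 1")
      case True
      then show ?thesis using F less.prems by (intro Min_le) (auto simp: F_def)
    next
      case False
      define n' where "n' = n - m - 1"
      have n': "n = m + n' + 1" "m < n'" "n' < n" using False by (auto simp: n'_def)
      have "Min F \<le> 1 * (real (num_rtrees n') * y ^ n')" using less.IH n' by simp
      also have "\<dots> \<le> real (num_rtrees m) * y ^ (m + 1) * (real (num_rtrees n') * y ^ n')"
        using m y0 by (intro mult_right_mono) auto
      also have "\<dots> = real (num_rtrees m * num_rtrees n') * y ^ n"
        by (simp add: n'(1) power_add)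
      also have "\<dots> \<le> real (num_rtrees n) * y ^ n"
        using num_rtrees_supermult[OF n'(2)] y0 unfolding n'(1) by (intro mult_right_mono) (simp_all only: of_nat_le_iff zero_le_power less_imp_le)
      finally show ?thesis .
    qed
  qed
  moreover have "0 < Min F" using F Fpos by (simp add: Min_gr_iff)
  ultimately show ?thesis by blast
qed


section \<open>Trees with few unary vertices are rare\<close>

text \<open>The series of t^k / k over k at least 2, that is the part of the Euler exponent due to
  repeated subtrees. Its quadratic size is what keeps it summable beyond \<open>rho\<close>.\<close>

definition excess :: "real \<Rightarrow> real" where
  "excess t = - ln (1 - t) - t"

lemma excess_nonneg: "0 \<le> t \<Longrightarrow> t < 1 \<Longrightarrow> 0 \<le> excess t"
  using minus_ln_minus_mono[of 0 t] by (simp add: excess_def)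

lemma excess_mono: "0 \<le> s \<Longrightarrow> s \<le> t \<Longrightarrow> t < 1 \<Longrightarrow> excess s \<le> excess t"
  using minus_ln_minus_mono[of s t] by (simp add: excess_def)

lemma excess_le:
  assumes "0 \<le> t" "t \<le> x" "x < 1"
  shows "excess t \<le> t ^ 2 / (1 - x)"
proof -
  have "excess t \<le> t / (1 - t) - t"
    using minus_ln_le[of t t] assms by (simp add: excess_def)
  also have "\<dots> = t ^ 2 / (1 - t)" using assms by (simp add: field_simps power2_eq_square)
  also have "\<dots> \<le> t ^ 2 / (1 - x)" using assms by (intro divide_left_mono) auto
  finally show ?thesis .
qed

lemma excess_convex:
  assumes "0 \<le> l" "l \<le> 1" "0 \<le> s" "s < 1" "0 \<le> t" "t < 1"
  shows "excess ((1 - l) * s + l * t) \<le> (1 - l) * excess s + l * excess t"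
proof -
  have "(1 - l) * ln (1 - s) + l * ln (1 - t) \<le> ln ((1 - l) * (1 - s) + l * (1 - t))"
    using concave_onD[OF ln_concave, of l "1 - s" "1 - t"] assms by simp
  also have "(1 - l) * (1 - s) + l * (1 - t) = 1 - ((1 - l) * s + l * t)" by (simp add: algebra_simps)
  finally show ?thesis by (simp add: excess_def algebra_simps)
qed

lemma power_convex_comb:
  assumes "0 \<le> l" "l \<le> 1" "0 \<le> a" "a \<le> (b::real)"
  shows "((1 - l) * a + l * b) ^ m \<le> (1 - l) * a ^ m + l * b ^ m"
proof (induction m)
  case (Suc m)
  have "((1 - l) * a + l * b) ^ Suc m \<le> ((1 - l) * a + l * b) * ((1 - l) * a ^ m + l * b ^ m)"
    using Suc assms by (simp add: mult_left_mono)
  also have "\<dots> = (1 - l) * a ^ Suc m + l * b ^ Suc m - (1 - l) * l * ((b - a) * (b ^ m - a ^ m))"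
    by (simp add: algebra_simps)
  also have "\<dots> \<le> (1 - l) * a ^ Suc m + l * b ^ Suc m"
    using assms by (simp add: power_mono)
  finally show ?case .
qed simp

text \<open>Both the power and \<open>excess\<close> are convex and increasing, so at a point
  between \<open>a\<close> and \<open>b\<close> the excess is at most the convex combination of its
  values at the ends. This gives an explicit bound, uniform in the truncation, in place of
  continuity of an infinite series.\<close>

lemma excess_wt_perturb:
  assumes "0 \<le> l" "l \<le> 1" "0 < a" "a \<le> b" "b < 1" "0 \<le> u" "u \<le> 1"
  shows "excess (wt ((1 - l) * a + l * b) u T) \<le> excess (wt a u T) + l * excess (wt b u T)"
proof -
  let ?x = "(1 - l) * a + l * b"
  have wa: "0 \<le> wt a u T" "wt a u T < 1" and wb: "0 \<le> wt b u T" "wt b u T < 1"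
    using wt_le[of a u T] wt_le[of b u T] assms by (auto intro: wt_nonneg)
  have "wt ?x u T \<le> ((1 - l) * a ^ nodes T + l * b ^ nodes T) * u ^ unaries T"
    unfolding wt_def using assms by (intro mult_right_mono power_convex_comb) auto
  also have "\<dots> = (1 - l) * wt a u T + l * wt b u T" by (simp add: wt_def algebra_simps)
  finally have le: "wt ?x u T \<le> (1 - l) * wt a u T + l * wt b u T" .
  have "(1 - l) * wt a u T + l * wt b u T < 1"
    using convex_bound_lt[of "wt a u T" 1 "wt b u T" "1 - l" l] wa wb assms by simp
  then have "excess (wt ?x u T) \<le> excess ((1 - l) * wt a u T + l * wt b u T)"
    using le assms by (intro excess_mono wt_nonneg) auto
  also have "\<dots> \<le> (1 - l) * excess (wt a u T) + l * excess (wt b u T)"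
    using assms wa wb by (intro excess_convex) auto
  also have "\<dots> \<le> 1 * excess (wt a u T) + l * excess (wt b u T)"
    using assms wa by (intro add_right_mono mult_right_mono excess_nonneg) auto
  finally show ?thesis by simp
qed

lemma sum_minus_ln_wt:
  "(\<Sum>T\<in>A. - ln (1 - wt x u T)) = sum (wt x u) A + (\<Sum>T\<in>A. excess (wt x u T))"
  by (simp add: excess_def sum.distrib[symmetric])

text \<open>The weights with \<open>u = 1\<close> sum to at most 1 at \<open>rho\<close>, and
  \<open>u < 1\<close> strictly lowers the weight of the path with two nodes, by
  \<open>(1 - u) * rho ^ 2\<close>. Truncating at \<open>N + 2\<close> makes sure that this tree is
  counted.\<close>

lemma infsum_wt_rho_less_1:
  assumes "0 \<le> u" "u < 1"
  shows "wt rho u summable_on UNIV" "infsum (wt rho u) UNIV < 1"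
proof -
  define T0 where "T0 = Node {#Node {#}#}"
  have "sum (wt rho u) (small N) \<le> 1 - (1 - u) * rho ^ 2" for N
  proof -
    have "sum (wt rho u) (small N) \<le> sum (wt rho u) (small (N + 2))"
      using rho_pos assms by (intro sum_mono2 finite_small wt_nonneg) (auto simp: small_def)
    also have "\<dots> \<le> (\<Sum>T\<in>small (N + 2). wt rho 1 T - (if T = T0 then (1 - u) * rho ^ 2 else 0))"
    proof (intro sum_mono)
      fix T
      show "wt rho u T \<le> wt rho 1 T - (if T = T0 then (1 - u) * rho ^ 2 else 0)"
        using wt_mono[of rho rho u 1 T] rho_pos assms
        by (auto simp: wt_def T0_def algebra_simps power2_eq_square)
    qed
    also have "\<dots> = sum (wt rho 1) (small (N + 2)) - (1 - u) * rho ^ 2"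
      using finite_small by (simp add: sum_subtractf small_def T0_def)
    also have "\<dots> \<le> 1 - (1 - u) * rho ^ 2" using sum_wt_rho_le by simp
    finally show ?thesis .
  qed
  from summable_wtI[OF _ assms(1) this] rho_pos
  have "wt rho u summable_on UNIV" "infsum (wt rho u) UNIV \<le> 1 - (1 - u) * rho ^ 2" by auto
  moreover have "0 < (1 - u) * rho ^ 2" using rho_pos assms by simp
  ultimately show "wt rho u summable_on UNIV" "infsum (wt rho u) UNIV < 1" by linarith+
qed

(* At rho the map s |-> rho * (exp (s + c) - (1 - u) * s) has the fixed point y < 1, where its slope
   is y - (1 - u) * rho * (1 - y) < 1; so for x slightly beyond rho it still has a point y1 that is
   mapped below itself, and y1 bounds all partial sums. *)
lemma wt_bounded_beyond_rho:
  assumes u: "0 \<le> u" "u < 1"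
  shows "\<exists>x y q. rho < x \<and> x \<le> 3/5 \<and> q < 1 \<and> (\<forall>N. sum (wt x u) (small N) \<le> y) \<and>
    (\<forall>N. x * (exp (\<Sum>T\<in>small N. - ln (1 - wt x u T)) - (1 - u)) \<le> q)"
proof -
  define y where "y = infsum (wt rho u) UNIV"
  define L where "L = infsum (\<lambda>T. - ln (1 - wt rho u T)) UNIV"
  define c where "c = L - y"
  have r: "0 < rho" "rho \<le> 1/2" "rho < 1" using rho_pos rho_le by auto
  have s: "wt rho u summable_on UNIV" and y1: "y < 1"
    using infsum_wt_rho_less_1[OF u] by (auto simp: y_def)
  have y0: "0 \<le> y" unfolding y_def using r u by (intro infsum_nonneg wt_nonneg) auto
  have wr: "0 \<le> wt rho u T" "wt rho u T < 1" for T
    using wt_le[of rho u T] r u by (auto intro: wt_nonneg)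
  have eqn: "y = rho * (exp L - (1 - u) * y)"
    unfolding y_def L_def using wt_functional_equation[of rho u] r u s by simp
  have Ec: "((\<lambda>T. excess (wt rho u T)) has_sum c) UNIV"
  proof -
    have "((\<lambda>T. - ln (1 - wt rho u T) + - 1 * wt rho u T) has_sum (L + - 1 * y)) UNIV"
      unfolding L_def y_def using s summable_minus_ln[of rho u] r u
      by (intro has_sum_add has_sum_cmult_right has_sum_infsum) auto
    then show ?thesis by (simp add: c_def excess_def)
  qed
  have Ec_le: "(\<Sum>T\<in>small N. excess (wt rho u T)) \<le> c" for N
    using finite_sum_le_has_sum[OF Ec finite_small] excess_nonneg[OF wr] by simp
  have c0: "0 \<le> c" using Ec_le[of 0] by simp
  define h where "h s = rho * (exp (s + c) - (1 - u) * s) - s" for s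
  have hy: "h y = 0" using eqn by (simp add: h_def c_def)
  have Lc: "L = y + c" by (simp add: c_def)
  \<comment> \<open>The fixed point equation amounts to
    \<open>rho * exp (y + c) = y + rho * (1 - u) * y\<close>.\<close>
  have slope: "rho * (exp (y + c) - (1 - u)) = y - rho * (1 - u) * (1 - y)"
    using eqn unfolding Lc by (simp add: algebra_simps)
  have pos: "0 < rho * (1 - u) * (1 - y)" using r u y1 by simp
  have "(h has_real_derivative (rho * (exp (y + c) - (1 - u)) - 1)) (at y)"
    unfolding h_def by (auto intro!: derivative_eq_intros)
  then obtain d where d: "d > 0" "\<And>e. 0 < e \<Longrightarrow> e < d \<Longrightarrow> h (y + e) < h y"
    using DERIV_neg_dec_right[of h _ y] slope pos y1 by fastforce
  have "\<forall>\<^sub>F s in at_right y. h s < 0"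
    unfolding eventually_at_right_field
  proof (intro exI[of _ "y + d"] conjI allI impI)
    fix s assume "y < s" "s < y + d"
    then show "h s < 0" using d(2)[of "s - y"] hy by simp
  qed (use d in simp)
  moreover have "\<forall>\<^sub>F s in at_right y. rho * (exp (s + c) - (1 - u)) < 1"
  proof (rule order_tendstoD(2))
    show "((\<lambda>s. rho * (exp (s + c) - (1 - u))) \<longlongrightarrow> rho * (exp (y + c) - (1 - u))) (at_right y)"
      by (intro tendsto_intros)
    show "rho * (exp (y + c) - (1 - u)) < 1" using slope pos y1 by simp
  qed
  moreover have "\<forall>\<^sub>F s in at_right y. y < s" by (simp add: eventually_at_right_less)
  ultimately have "\<forall>\<^sub>F s in at_right y. h s < 0 \<and> rho * (exp (s + c) - (1 - u)) < 1 \<and> y < s"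
    by eventually_elim simp
  then obtain z where z: "h z < 0" "rho * (exp (z + c) - (1 - u)) < 1" "y < z"
    using eventually_happens by force
  \<comment> \<open>Since \<open>rho \<le> 1/2\<close>, the point \<open>b\<close> is at most 3/5
    and \<open>b ^ 2 \<le> rho\<close>, so that the excess at \<open>b\<close>, being quadratic in
    the weight, is controlled by the weights at \<open>rho\<close>. The constant 5/2 below is
    \<open>1 / (1 - 3/5)\<close>.\<close>
  define b where "b = 6/5 * rho"
  define X where "X l = (1 - l) * rho + l * b" for l
  have b: "rho \<le> b" "b \<le> 3/5" "b < 1" using r by (auto simp: b_def)
  \<comment> \<open>At \<open>l = 0\<close> the two expressions are \<open>h z\<close> and the slope
    at \<open>z\<close>, so both strict inequalities persist for small positive \<open>l\<close>.
    The term \<open>5/2 * l\<close> allows for the growth of the excess between \<open>rho\<close>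
    and \<open>X l\<close>.\<close>
  have "((\<lambda>l. X l * (exp (z + (c + 5/2 * l)) - (1 - u) * z) - z) \<longlongrightarrow>
     X 0 * (exp (z + (c + 5/2 * 0)) - (1 - u) * z) - z) (at_right 0)"
    unfolding X_def by (intro tendsto_intros)
  then have "\<forall>\<^sub>F l in at_right 0. X l * (exp (z + (c + 5/2 * l)) - (1 - u) * z) - z < 0"
    using z(1) by (intro order_tendstoD(2)) (auto simp: X_def h_def)
  moreover have "((\<lambda>l. X l * (exp (z + (c + 5/2 * l)) - (1 - u))) \<longlongrightarrow>
     X 0 * (exp (z + (c + 5/2 * 0)) - (1 - u))) (at_right 0)"
    unfolding X_def by (intro tendsto_intros)
  then have "\<forall>\<^sub>F l in at_right 0. X l * (exp (z + (c + 5/2 * l)) - (1 - u)) < 1"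
    using z(2) by (intro order_tendstoD(2)) (auto simp: X_def)
  moreover have "\<forall>\<^sub>F l in at_right (0::real). l \<in> {0<..<1}"
    by (rule eventually_at_right_real) simp
  ultimately have "\<forall>\<^sub>F l in at_right 0. X l * (exp (z + (c + 5/2 * l)) - (1 - u) * z) - z < 0 \<and>
      X l * (exp (z + (c + 5/2 * l)) - (1 - u)) < 1 \<and> l \<in> {0<..<1}"
    by eventually_elim simp
  then obtain l where l: "X l * (exp (z + (c + 5/2 * l)) - (1 - u) * z) < z"
      "X l * (exp (z + (c + 5/2 * l)) - (1 - u)) < 1" "0 < l" "l < 1"
    using eventually_happens by force
  define x where "x = X l"
  have x_eq: "x = rho + l * (b - rho)" by (simp add: x_def X_def algebra_simps)
  have x: "rho < x" "x \<le> b" "0 < x"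
  proof -
    have "0 < l * (b - rho)" using l(3) r by (simp add: b_def)
    then show "rho < x" unfolding x_eq by linarith
    then show "0 < x" using r by linarith
    have "x \<le> rho + 1 * (b - rho)"
      unfolding x_eq using l(4) b by (intro add_left_mono mult_right_mono) auto
    also have "\<dots> = b" by simp
    finally show "x \<le> b" .
  qed
  have wb: "0 \<le> wt b u T" "wt b u T \<le> 3/5" for T
    using wt_le[of b u T] b r u by (auto intro: wt_nonneg)
  have Eb: "(\<Sum>T\<in>small N. excess (wt b u T)) \<le> 5/2" for N
  proof -
    have "excess (wt b u T) \<le> 5/2 * wt rho 1 T" for T
    proof -
      have "excess (wt b u T) \<le> wt b u T ^ 2 / (1 - 3/5)" by (intro excess_le wb) simp
      also have "wt b u T ^ 2 \<le> wt b 1 T ^ 2"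
        using u b r by (intro power_mono wt_mono wb) auto
      also have "wt b 1 T ^ 2 = (b ^ 2) ^ nodes T" by (simp add: wt_def power_mult[symmetric] mult.commute)
      also have "\<dots> \<le> rho ^ nodes T"
      proof (intro power_mono)
        have "b ^ 2 = 36/25 * rho * rho" by (simp add: b_def power2_eq_square)
        also have "\<dots> \<le> 1 * rho" using r by (intro mult_right_mono) auto
        finally show "b ^ 2 \<le> rho" by simp
      qed simp
      finally show ?thesis by (simp add: wt_def divide_right_mono)
    qed
    then have "(\<Sum>T\<in>small N. excess (wt b u T)) \<le> (\<Sum>T\<in>small N. 5/2 * wt rho 1 T)" by (intro sum_mono)
    also have "\<dots> \<le> 5/2 * 1" unfolding sum_distrib_left[symmetric] using sum_wt_rho_le by (intro mult_left_mono) auto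
    finally show ?thesis by simp
  qed
  have Ex: "(\<Sum>T\<in>small N. excess (wt x u T)) \<le> c + 5/2 * l" for N
  proof -
    have "(\<Sum>T\<in>small N. excess (wt x u T)) \<le> (\<Sum>T\<in>small N. excess (wt rho u T) + l * excess (wt b u T))"
      unfolding x_def X_def using l r b u by (intro sum_mono excess_wt_perturb) auto
    also have "\<dots> = (\<Sum>T\<in>small N. excess (wt rho u T)) + l * (\<Sum>T\<in>small N. excess (wt b u T))"
      by (simp add: sum.distrib sum_distrib_left)
    also have "\<dots> \<le> c + l * (5/2)" using l by (intro add_mono Ec_le mult_left_mono Eb) auto
    finally show ?thesis by (simp add: mult.commute)
  qed
  define c' where "c' = c + 5/2 * l"
  have c'0: "0 \<le> c'" using c0 l by (simp add: c'_def)
  have bound: "sum (wt x u) (small N) \<le> z" for N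
  proof (induction N)
    case 0
    then show ?case using y0 z(3) by simp
  next
    case (Suc N)
    let ?s = "sum (wt x u) (small N)"
    have s0: "0 \<le> ?s" using x u by (intro sum_nonneg wt_nonneg) auto
    have "sum (wt x u) (small (Suc N)) \<le> x * (exp (\<Sum>T\<in>small N. - ln (1 - wt x u T)) - (1 - u) * ?s)"
      using x b u by (intro sum_wt_small_Suc_le) auto
    also have "\<dots> \<le> x * (exp (?s + c') - (1 - u) * ?s)"
      using x Ex[of N] unfolding sum_minus_ln_wt c'_def by (intro mult_left_mono) auto
    \<comment> \<open>The map sending \<open>s\<close> to \<open>exp (s + c') - (1 - u) * s\<close>
      increases for nonnegative \<open>s\<close>, its slope being at least \<open>u\<close>; the
      tangent bound for exp stands in for the derivative.\<close>
    also have "\<dots> \<le> x * (exp (z + c') - (1 - u) * z)"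
    proof (intro mult_left_mono)
      have "exp (?s + c') * (1 + (z - ?s)) \<le> exp (?s + c') * exp (z - ?s)"
        by (intro mult_left_mono exp_ge_add_one_self) simp
      also have "\<dots> = exp (z + c')" by (simp add: exp_add[symmetric])
      finally have "exp (?s + c') + exp (?s + c') * (z - ?s) \<le> exp (z + c')" by (simp add: algebra_simps)
      moreover have "(1 - u) * (z - ?s) \<le> exp (?s + c') * (z - ?s)"
      proof (rule mult_right_mono)
        have "1 \<le> exp (?s + c')" using s0 c'0 by simp
        then show "1 - u \<le> exp (?s + c')" using u by linarith
      qed (use Suc in simp)
      ultimately show "exp (?s + c') - (1 - u) * ?s \<le> exp (z + c') - (1 - u) * z"
        by (simp add: algebra_simps)
    qed (use x in simp)
    also have "\<dots> \<le> z" using l(1) unfolding x_def c'_def by simp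
    finally show ?case .
  qed
  \<comment> \<open>The slope of the map at \<open>z\<close>; being below 1, it later makes the
    recursion for the width a contraction.\<close>
  have "x * (exp (\<Sum>T\<in>small N. - ln (1 - wt x u T)) - (1 - u)) \<le> x * (exp (z + c') - (1 - u))" for N
    using bound[of N] Ex[of N] x unfolding sum_minus_ln_wt c'_def by (intro mult_left_mono) auto
  moreover have "x * (exp (z + c') - (1 - u)) < 1" using l(2) unfolding x_def c'_def .
  ultimately show ?thesis using bound x b by (intro exI[of _ x] exI[of _ z] exI[of _ "x * (exp (z + c') - (1 - u))"]) auto
qed


section \<open>Exponential moment of the width\<close>

lemma power_width_le:
  assumes "(1::real) \<le> z"
  shows "z ^ width (Node M) \<le> z ^ size M + (\<Sum>T\<in>set_mset M. z ^ width T)"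
proof -
  have nn: "0 \<le> (\<Sum>T\<in>set_mset M. z ^ width T)" using assms by (intro sum_nonneg) simp
  have "width (Node M) \<in> insert (size M) (width ` set_mset M)"
    unfolding width.simps set_image_mset by (rule Max_in) auto
  then consider "width (Node M) = size M" | T where "T \<in># M" "width (Node M) = width T" by blast
  then show ?thesis
  proof cases
    case 2
    have "z ^ width T \<le> (\<Sum>T\<in>set_mset M. z ^ width T)"
      using 2 assms by (intro member_le_sum) auto
    then show ?thesis using 2 assms by (simp add: add_increasing)
  qed (use nn in simp)
qed

text \<open>Removing one copy of \<open>T\<close> leaves a smaller forest, empty exactly when the
  root had a single child. So the factor \<open>u\<close> falls on the empty forest alone, whose
  weight is 1; this is the term \<open>1 - u\<close>.\<close>

lemma sum_forests_containing_le:
  assumes x: "0 \<le> x" "x < 1" and u: "0 \<le> u" "u \<le> 1"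
  shows "(\<Sum>M | M \<in> small_forests N \<and> T \<in># M. (if size M = 1 then u else 1) * mset_prod (wt x u) M)
    \<le> wt x u T * (exp (\<Sum>T\<in>small N. - ln (1 - wt x u T)) - (1 - u))"
proof -
  let ?f = "wt x u"
  have w: "0 \<le> ?f T" "?f T < 1" for T
    using wt_le[of x u T] x u by (auto intro: wt_nonneg)
  have fin: "finite (small_forests N)" by (rule finite_small_forests[OF finite_small])
  have p0: "0 \<le> mset_prod ?f M" for M using w by (intro mset_prod_nonneg)
  define \<M> where "\<M> = (\<lambda>M. M - {#T#}) ` {M \<in> small_forests N. T \<in># M}"
  have sub: "\<M> \<subseteq> small_forests N"
  proof
    fix M' assume "M' \<in> \<M>"
    then obtain M where M: "M \<in> small_forests N" "T \<in># M" "M' = M - {#T#}" by (auto simp: \<M>_def)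
    then have "M = add_mset T M'" by simp
    with M(1) show "M' \<in> small_forests N" by (simp add: small_forests_def)
  qed
  have img: "{M. M \<in> small_forests N \<and> T \<in># M} = add_mset T ` \<M>"
    by (force simp: \<M>_def image_image)
  have "(\<Sum>M | M \<in> small_forests N \<and> T \<in># M. (if size M = 1 then u else 1) * mset_prod ?f M)
      = (\<Sum>M\<in>\<M>. (if size (add_mset T M) = 1 then u else 1) * mset_prod ?f (add_mset T M))"
    unfolding img by (subst sum.reindex) (auto intro: inj_onI)
  also have "\<dots> = ?f T * (\<Sum>M\<in>\<M>. (if M = {#} then u else 1) * mset_prod ?f M)"
    unfolding sum_distrib_left by (intro sum.cong) auto
  also have "\<dots> \<le> ?f T * (\<Sum>M\<in>small_forests N. (if M = {#} then u else 1) * mset_prod ?f M)"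
    using sub u p0 w by (intro mult_left_mono sum_mono2 fin) auto
  also have "(\<Sum>M\<in>small_forests N. (if M = {#} then u else 1) * mset_prod ?f M)
      = (\<Sum>M\<in>small_forests N. mset_prod ?f M - (if M = {#} then 1 - u else 0))"
    by (intro sum.cong) auto
  also have "\<dots> = (\<Sum>M\<in>small_forests N. mset_prod ?f M) - (1 - u)"
    using fin by (simp add: sum_subtractf small_forests_def)
  also have "\<dots> \<le> exp (\<Sum>T\<in>small N. - ln (1 - ?f T)) - (1 - u)"
    using w by (intro diff_right_mono sum_mset_prod_le finite_small fin small_forests_subset) auto
  finally show ?thesis using w by (simp add: mult_left_mono)
qed

text \<open>The width is either the number of children of the root or inherited from a subtree. The
  first case contributes at most the constant \<open>G\<close>, from an Euler product with weights
  \<open>z * wt x u T\<close>; the second reproduces the sum itself with a factor at most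
  \<open>q < 1\<close>. Hence the bound \<open>G / (1 - q)\<close>.\<close>

lemma sum_wt_width_bounded:
  assumes x: "0 < x" "x \<le> 3/5" and u: "0 \<le> u" "u \<le> 1" and z: "1 \<le> z" "z \<le> 4/3"
    and q: "q < 1" "\<And>N. x * (exp (\<Sum>T\<in>small N. - ln (1 - wt x u T)) - (1 - u)) \<le> q"
    and y: "\<And>N. sum (wt x u) (small N) \<le> y"
  shows "\<exists>B. \<forall>N. (\<Sum>T\<in>small N. wt x u T * z ^ width T) \<le> B"
proof -
  let ?f = "wt x u" and ?Z = "\<lambda>T. z ^ width T" and ?u = "\<lambda>M. if size M = 1 then u else 1"
  define V where "V N = (\<Sum>T\<in>small N. ?f T * ?Z T)" for N
  \<comment> \<open>The 5 is \<open>1 / (1 - 4/5)\<close>, where 4/5 = 4/3 * 3/5 bounds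
    \<open>z * wt x u T\<close>.\<close>
  define G where "G = x * exp (5 * z * y)"
  have w: "0 \<le> ?f T" "?f T \<le> 3/5" for T
    using wt_le[of x u T] x u by (auto intro: wt_nonneg)
  have zw: "0 \<le> z * ?f T" "z * ?f T \<le> 4/5" for T
  proof -
    show "0 \<le> z * ?f T" using w z by simp
    have "z * ?f T \<le> 4/3 * (3/5)" using w z by (intro mult_mono) auto
    then show "z * ?f T \<le> 4/5" by simp
  qed
  have zw1: "z * ?f T < 1" for T using zw(2)[of T] by linarith
  have fin: "finite (small_forests N)" for N by (rule finite_small_forests[OF finite_small])
  have p0: "0 \<le> mset_prod ?f M" for M using w by (intro mset_prod_nonneg)
  have first: "(\<Sum>M\<in>small_forests N. ?u M * mset_prod ?f M * z ^ size M) \<le> exp (5 * z * y)" for N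
  proof -
    have "(\<Sum>M\<in>small_forests N. ?u M * mset_prod ?f M * z ^ size M) \<le> (\<Sum>M\<in>small_forests N. mset_prod (\<lambda>T. z * ?f T) M)"
    proof (intro sum_mono)
      fix M
      have "?u M * mset_prod ?f M * z ^ size M \<le> 1 * mset_prod ?f M * z ^ size M"
        using u p0 z by (intro mult_right_mono) auto
      then show "?u M * mset_prod ?f M * z ^ size M \<le> mset_prod (\<lambda>T. z * ?f T) M"
        by (simp add: mset_prod_scale mult.commute)
    qed
    also have "\<dots> \<le> exp (\<Sum>T\<in>small N. - ln (1 - z * ?f T))"
      using zw(1) zw1 by (intro sum_mset_prod_le finite_small fin small_forests_subset) auto
    also have "(\<Sum>T\<in>small N. - ln (1 - z * ?f T)) \<le> (\<Sum>T\<in>small N. z * ?f T / (1 - 4/5))"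
      using zw by (intro sum_mono minus_ln_le) auto
    also have "\<dots> = 5 * z * sum ?f (small N)"
      unfolding sum_distrib_left by (intro sum.cong) auto
    also have "\<dots> \<le> 5 * z * y" using z y by (intro mult_left_mono) auto
    finally show ?thesis by simp
  qed
  have second: "(\<Sum>M\<in>small_forests N. ?u M * mset_prod ?f M * (\<Sum>T\<in>set_mset M. ?Z T))
      \<le> V N * (exp (\<Sum>T\<in>small N. - ln (1 - ?f T)) - (1 - u))" for N
  proof -
    have "(\<Sum>M\<in>small_forests N. ?u M * mset_prod ?f M * (\<Sum>T\<in>set_mset M. ?Z T))
        = (\<Sum>M\<in>small_forests N. \<Sum>T | T \<in> small N \<and> T \<in># M. ?u M * mset_prod ?f M * ?Z T)"
      unfolding sum_distrib_left using small_forests_subset by (intro sum.cong) auto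
    also have "\<dots> = (\<Sum>T\<in>small N. \<Sum>M | M \<in> small_forests N \<and> T \<in># M. ?u M * mset_prod ?f M * ?Z T)"
      by (rule sum.swap_restrict[OF fin finite_small])
    also have "\<dots> = (\<Sum>T\<in>small N. ?Z T * (\<Sum>M | M \<in> small_forests N \<and> T \<in># M. ?u M * mset_prod ?f M))"
      unfolding sum_distrib_left by (intro sum.cong refl mult.commute)
    also have "\<dots> \<le> (\<Sum>T\<in>small N. ?Z T * (?f T * (exp (\<Sum>T\<in>small N. - ln (1 - ?f T)) - (1 - u))))"
      using x u z by (intro sum_mono mult_left_mono sum_forests_containing_le) auto
    also have "\<dots> = V N * (exp (\<Sum>T\<in>small N. - ln (1 - ?f T)) - (1 - u))"
      unfolding V_def sum_distrib_right by (intro sum.cong) auto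
    finally show ?thesis .
  qed
  have V0: "0 \<le> V N" for N unfolding V_def using w z by (intro sum_nonneg mult_nonneg_nonneg) auto
  have rec: "V (Suc N) \<le> G + q * V N" for N
  proof -
    have "V (Suc N) = (\<Sum>M\<in>small_forests N. ?f (Node M) * ?Z (Node M))"
      unfolding V_def small_Suc by (subst sum.reindex) (auto intro: inj_onI)
    also have "\<dots> \<le> (\<Sum>M\<in>small_forests N. x * (?u M * mset_prod ?f M * z ^ size M) +
        x * (?u M * mset_prod ?f M * (\<Sum>T\<in>set_mset M. ?Z T)))"
    proof (intro sum_mono)
      fix M
      have "?f (Node M) * ?Z (Node M) \<le> ?f (Node M) * (z ^ size M + (\<Sum>T\<in>set_mset M. ?Z T))"
        using z w by (intro mult_left_mono power_width_le) auto
      also have "\<dots> = x * (?u M * mset_prod ?f M * z ^ size M) + x * (?u M * mset_prod ?f M * (\<Sum>T\<in>set_mset M. ?Z T))"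
        unfolding wt_Node by (simp only: distrib_left mult.assoc)
      finally show "?f (Node M) * ?Z (Node M) \<le> x * (?u M * mset_prod ?f M * z ^ size M) + x * (?u M * mset_prod ?f M * (\<Sum>T\<in>set_mset M. ?Z T))" .
    qed
    also have "\<dots> = x * (\<Sum>M\<in>small_forests N. ?u M * mset_prod ?f M * z ^ size M) +
        x * (\<Sum>M\<in>small_forests N. ?u M * mset_prod ?f M * (\<Sum>T\<in>set_mset M. ?Z T))"
      by (simp only: sum.distrib sum_distrib_left)
    also have "\<dots> \<le> x * exp (5 * z * y) + x * (V N * (exp (\<Sum>T\<in>small N. - ln (1 - ?f T)) - (1 - u)))"
      using x by (intro add_mono mult_left_mono first second) auto
    also have "\<dots> = G + x * (exp (\<Sum>T\<in>small N. - ln (1 - ?f T)) - (1 - u)) * V N"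
      by (simp add: G_def)
    also have "\<dots> \<le> G + q * V N" using V0 q(2) by (intro add_left_mono mult_right_mono)
    finally show ?thesis .
  qed
  have "0 \<le> x * (exp (\<Sum>T\<in>small 0. - ln (1 - ?f T)) - (1 - u))" using x u by simp
  then have q0: "0 \<le> q" using q(2)[of 0] by linarith
  have "V N \<le> G / (1 - q)" for N
  proof (induction N)
    case 0
    then show ?case using q(1) x by (simp add: V_def G_def)
  next
    case (Suc N)
    have "V (Suc N) \<le> G + q * (G / (1 - q))"
      using rec[of N] mult_left_mono[OF Suc q0] by linarith
    also have "\<dots> = G / (1 - q)" using q(1) by (simp add: field_simps)
    finally show ?case .
  qed
  then show ?thesis unfolding V_def by blast
qed

definition narrowly_unary :: "nat \<Rightarrow> rtree set" where
  "narrowly_unary n = {T. nodes T = n \<and> unaries T < width T}"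

lemma card_narrowly_unary_bound:
  "\<exists>x B. rho < x \<and> x \<le> 3/5 \<and> (\<forall>n. real (card (narrowly_unary n)) * x ^ n \<le> B)"
proof -
  \<comment> \<open>The parameters 3/4 and 4/3 are reciprocal, so every tree with fewer unary nodes
    than its width has weight at least \<open>x ^ n\<close>; and 4/3 is small enough that 4/3 * 3/5
    < 1.\<close>
  obtain x y q where x: "rho < x" "x \<le> 3/5" "q < 1" "\<And>N. sum (wt x (3/4)) (small N) \<le> y"
    "\<And>N. x * (exp (\<Sum>T\<in>small N. - ln (1 - wt x (3/4) T)) - (1 - 3/4)) \<le> q"
    using wt_bounded_beyond_rho[of "3/4"] by auto
  have x0: "0 < x" using x(1) rho_pos by simp
  obtain B where B: "\<And>N. (\<Sum>T\<in>small N. wt x (3/4) T * (4/3) ^ width T) \<le> B"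
    using sum_wt_width_bounded[of x "3/4" "4/3" q y] x x0 by auto
  have "real (card (narrowly_unary n)) * x ^ n \<le> B" for n
  proof -
    have "real (card (narrowly_unary n)) * x ^ n = (\<Sum>T\<in>narrowly_unary n. x ^ n)" by simp
    also have "\<dots> \<le> (\<Sum>T\<in>narrowly_unary n. wt x (3/4) T * (4/3) ^ width T)"
    proof (intro sum_mono)
      fix T assume T: "T \<in> narrowly_unary n"
      have "x ^ n = x ^ n * ((3/4) ^ unaries T * (4/3) ^ unaries T)"
        by (simp add: power_mult_distrib[symmetric])
      also have "\<dots> \<le> x ^ n * ((3/4) ^ unaries T * (4/3) ^ width T)"
        using T x0 by (intro mult_left_mono power_increasing) (auto simp: narrowly_unary_def)
      finally show "x ^ n \<le> wt x (3/4) T * (4/3) ^ width T"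
        using T by (simp add: wt_def narrowly_unary_def)
    qed
    also have "\<dots> \<le> (\<Sum>T\<in>small n. wt x (3/4) T * (4/3) ^ width T)"
      using x0 by (intro sum_mono2 finite_small mult_nonneg_nonneg wt_nonneg) (auto simp: narrowly_unary_def small_def)
    finally show ?thesis using B[of n] by linarith
  qed
  then show ?thesis using x by blast
qed

lemma narrowly_unary_rare:
  "(\<lambda>n. real n * real (card (narrowly_unary n)) / real (num_rtrees n)) \<longlonglongrightarrow> 0"
proof -
  obtain x B where x: "rho < x" "x \<le> 3/5" "\<And>n. real (card (narrowly_unary n)) * x ^ n \<le> B"
    using card_narrowly_unary_bound by blast
  \<comment> \<open>Strictly between \<open>rho\<close> and \<open>x\<close>: the number of all
    rooted trees is at least of order \<open>y ^ (- n)\<close>, that of the narrow ones at most of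
    order \<open>x ^ (- n)\<close>.\<close>
  define y where "y = (rho + x) / 2"
  have y: "rho < y" "y < x" "y < 1" "0 < y" "0 < x" using x rho_pos by (auto simp: y_def)
  obtain c m where c: "0 < c" "\<And>n. n > m \<Longrightarrow> c \<le> real (num_rtrees n) * y ^ n"
    using num_rtrees_growth[OF y(1,3)] by blast
  have bound: "real n * real (card (narrowly_unary n)) / real (num_rtrees n) \<le> B / c * (real n * (y / x) ^ n)"
    if n: "n > m" for n
  proof -
    have r: "0 < real (num_rtrees n)"
      using c(1) c(2)[OF n] y by (metis less_le_trans zero_less_mult_pos2 zero_less_power)
    define Q where "Q = (y / x) ^ n"
    have "real (card (narrowly_unary n)) * c \<le> real (card (narrowly_unary n)) * (real (num_rtrees n) * y ^ n)"
      by (intro mult_left_mono c(2) n) simp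
    also have "\<dots> = real (card (narrowly_unary n)) * x ^ n * (real (num_rtrees n) * (y / x) ^ n)"
      using y by (simp add: power_divide)
    also have "\<dots> \<le> B * (real (num_rtrees n) * (y / x) ^ n)"
      using y by (intro mult_right_mono x(3)) auto
    finally have "real (card (narrowly_unary n)) * c \<le> B * (real (num_rtrees n) * Q)"
      by (simp only: Q_def)
    then have "real (card (narrowly_unary n)) / real (num_rtrees n) \<le> B / c * Q"
      using r c(1) by (simp add: field_simps)
    then have "real n * (real (card (narrowly_unary n)) / real (num_rtrees n)) \<le> real n * (B / c * Q)"
      by (rule mult_left_mono) simp
    then show ?thesis by (simp only: Q_def times_divide_eq_right mult.left_commute)
  qed
  have "(\<lambda>n. real n * (y / x) ^ n) \<longlonglongrightarrow> 0"
    using y by (intro powser_times_n_limit_0) simp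
  then have lim: "(\<lambda>n. B / c * (real n * (y / x) ^ n)) \<longlonglongrightarrow> 0"
    by (rule tendsto_mult_right_zero)
  show ?thesis
    by (rule tendsto_sandwich[OF _ _ tendsto_const lim])
       (use bound in \<open>auto intro!: eventually_sequentiallyI[of "Suc m"]\<close>)
qed


section \<open>Shapes of labelled trees\<close>

definition shape_fun :: "'a set \<Rightarrow> 'a \<Rightarrow> ('a \<Rightarrow> 'a) \<Rightarrow> ('a \<Rightarrow> rtree) \<Rightarrow> bool" where
  "shape_fun V r p sh \<longleftrightarrow> (\<forall>v\<in>V. sh v = Node (image_mset sh (mset_set (children V r p v))))"

lemma shape_funD:
  "shape_fun V r p sh \<Longrightarrow> v \<in> V \<Longrightarrow> sh v = Node (image_mset sh (mset_set (children V r p v)))"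
  by (simp add: shape_fun_def)

lemma finite_children: "rooted V r p \<Longrightarrow> finite (children V r p v)"
  by (simp add: rooted_def children_def)

lemma children_subset: "children V r p v \<subseteq> V - {r}"
  by (auto simp: children_def)

lemma rooted_induct_down [consumes 2, case_names step]:
  assumes R: "rooted V r p" and v: "v \<in> V"
    and step: "\<And>v. v \<in> V \<Longrightarrow> (\<And>w. w \<in> children V r p v \<Longrightarrow> P w) \<Longrightarrow> P v"
  shows "P v"
proof -
  obtain h :: "'a \<Rightarrow> nat" where h: "\<And>v. v \<in> V-{r} \<Longrightarrow> h (p v) < h v"
    using R by (auto simp: rooted_def)
  define K where "K = Max (h ` V)"
  have K: "h v \<le> K" if "v \<in> V" for v
    unfolding K_def using R that by (intro Max_ge) (auto simp: rooted_def)
  show ?thesis using v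
  proof (induction v rule: measure_induct_rule[of "\<lambda>v. K - h v"])
    case (less v)
    show ?case
    proof (rule step[OF less.prems])
      fix w assume "w \<in> children V r p v"
      then have "w \<in> V - {r}" "p w = v" by (auto simp: children_def)
      with h[of w] K[of w] have "K - h w < K - h v" by auto
      then show "P w" using less.IH \<open>w \<in> V - {r}\<close> by simp
    qed
  qed
qed

text \<open>Recursion along an arbitrary \<open>C\<close> need not terminate, so the shape is first
  a relation; in a rooted tree its existence follows by induction from the leaves.\<close>

inductive shape :: "('a \<Rightarrow> 'a set) \<Rightarrow> 'a \<Rightarrow> rtree \<Rightarrow> bool" for C where
  "finite (C v) \<Longrightarrow> (\<And>w. w \<in> C v \<Longrightarrow> shape C w (s w)) \<Longrightarrow> shape C v (Node (image_mset s (mset_set (C v))))"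

lemma shape_unique: "shape C v t \<Longrightarrow> shape C v t' \<Longrightarrow> t = t'"
proof (induction arbitrary: t' rule: shape.induct)
  case (1 v s)
  from 1(4) obtain s' where s': "t' = Node (image_mset s' (mset_set (C v)))" "\<And>w. w \<in> C v \<Longrightarrow> shape C w (s' w)"
    by (cases rule: shape.cases) auto
  have "image_mset s (mset_set (C v)) = image_mset s' (mset_set (C v))"
    using 1(1) 1(3) s'(2) by (intro image_mset_cong) auto
  then show ?case using s'(1) by simp
qed

lemma shape_fun_exists:
  assumes R: "rooted V r p"
  shows "\<exists>sh. shape_fun V r p sh"
proof -
  let ?C = "children V r p"
  have ex: "\<exists>t. shape ?C v t" if "v \<in> V" for v
    using R that
  proof (induction rule: rooted_induct_down)
    case (step v)
    then obtain s where "\<And>w. w \<in> ?C v \<Longrightarrow> shape ?C w (s w)" by metis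
    from shape.intros[where C = ?C, OF finite_children[OF R] this] show ?case by blast
  qed
  define sh where "sh v = (THE t. shape ?C v t)" for v
  have sh: "shape ?C v (sh v)" if "v \<in> V" for v
    unfolding sh_def using ex[OF that] shape_unique by (metis theI)
  have "sh v = Node (image_mset sh (mset_set (?C v)))" if v: "v \<in> V" for v
  proof (rule shape_unique[OF sh[OF v]])
    show "shape ?C v (Node (image_mset sh (mset_set (?C v))))"
      using children_subset[of V r p v] by (intro shape.intros finite_children[OF R] sh) auto
  qed
  then show ?thesis by (auto simp: shape_fun_def)
qed

lemma shape_fun_unique:
  assumes R: "rooted V r p" and "shape_fun V r p sh" "shape_fun V r p sh'" "v \<in> V"
  shows "sh v = sh' v"
  using R assms(4)
proof (induction rule: rooted_induct_down)
  case (step v)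
  have "image_mset sh (mset_set (children V r p v)) = image_mset sh' (mset_set (children V r p v))"
    using step finite_children[OF R] by (intro image_mset_cong) auto
  then show ?case using step(1) assms(2,3) by (simp add: shape_fun_def)
qed

text \<open>Sum the recursion for \<open>st\<close> over all vertices. Every non-root vertex is the
  child of exactly one vertex, so all terms except that of the root cancel.\<close>

lemma shape_fun_sum:
  fixes st :: "rtree \<Rightarrow> nat"
  assumes R: "rooted V r p" and sh: "shape_fun V r p sh"
    and st: "\<And>M. st (Node M) = g (size M) + sum_mset (image_mset st M)"
  shows "st (sh r) = (\<Sum>v\<in>V. g (card (children V r p v)))"
proof -
  let ?C = "children V r p"
  have fin: "finite V" and r: "r \<in> V" and pV: "p ` (V - {r}) \<subseteq> V" using R by (auto simp: rooted_def)
  have "(\<Sum>v\<in>V. st (sh v)) = (\<Sum>v\<in>V. g (card (?C v)) + (\<Sum>w\<in>?C v. st (sh w)))"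
  proof (intro sum.cong refl)
    fix v assume "v \<in> V"
    then have "st (sh v) = st (Node (image_mset sh (mset_set (?C v))))" using shape_funD[OF sh] by metis
    then show "st (sh v) = g (card (?C v)) + (\<Sum>w\<in>?C v. st (sh w))"
      unfolding st by (simp add: sum_unfold_sum_mset image_mset.compositionality o_def)
  qed
  also have "\<dots> = (\<Sum>v\<in>V. g (card (?C v))) + (\<Sum>v\<in>V. \<Sum>w\<in>?C v. st (sh w))" by (simp add: sum.distrib)
  also have "(\<Sum>v\<in>V. \<Sum>w\<in>?C v. st (sh w)) = (\<Sum>w\<in>V - {r}. st (sh w))"
    unfolding children_def using fin pV by (intro sum.group) auto
  also have "(\<Sum>v\<in>V. st (sh v)) = st (sh r) + (\<Sum>w\<in>V - {r}. st (sh w))"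
    using fin r by (rule sum.remove)
  finally show ?thesis by simp
qed

lemma card_children_le_width:
  assumes R: "rooted V r p" and sh: "shape_fun V r p sh" and v: "v \<in> V"
  shows "card (children V r p v) \<le> width (sh r)"
proof -
  have "width (Node M) \<ge> size M" for M by simp
  then have "card (children V r p v) \<le> width (sh v)"
    using shape_funD[OF sh v] by (metis size_image_mset size_mset_set)
  also have "width (sh v) \<le> width (sh r)"
    using R v
  proof (induction rule: rooted_induct)
    case (step v)
    have pv: "p v \<in> V" and vC: "v \<in> children V r p (p v)" using R step by (auto simp: rooted_def children_def)
    have "width T \<le> width (Node M)" if "T \<in># M" for T M
      using that by (auto intro!: Max_ge)
    moreover have "sh v \<in># image_mset sh (mset_set (children V r p (p v)))"
      using vC finite_children[OF R] by simp
    ultimately have "width (sh v) \<le> width (sh (p v))" using shape_funD[OF sh pv] by metis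
    then show ?case using step by simp
  qed simp
  finally show ?thesis .
qed

lemma image_mset_eq_imp_bij:
  assumes "finite A" "finite B" "image_mset f (mset_set A) = image_mset g (mset_set B)"
  shows "\<exists>b. bij_betw b A B \<and> (\<forall>a\<in>A. g (b a) = f a)"
  using assms
proof (induction A arbitrary: B rule: finite_induct)
  case empty
  then have "B = {}" by (auto simp: mset_set_empty_iff)
  then show ?case by (auto simp: bij_betw_def)
next
  case (insert a A)
  have "f a \<in># image_mset g (mset_set B)"
    unfolding insert.prems(2)[symmetric] using insert.hyps by simp
  then obtain b where b: "b \<in> B" "g b = f a" using insert.prems(1) by auto
  define B' where "B' = B - {b}"
  have B: "B = insert b B'" "b \<notin> B'" "finite B'" using b insert.prems(1) by (auto simp: B'_def)
  have "image_mset f (mset_set A) = image_mset g (mset_set B')"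
    using insert.prems(2) insert.hyps b B by simp
  then obtain c where c: "bij_betw c A B'" "\<forall>x\<in>A. g (c x) = f x" using insert.IH B by blast
  have "bij_betw (c(a := b)) (insert a A) (insert b B')"
  proof -
    have "bij_betw (c(a := b)) A B'" using c(1) insert.hyps by (subst bij_betw_cong[of A _ c]) auto
    then show ?thesis using insert.hyps(2) B(2) notIn_Un_bij_betw[of a A "c(a := b)" B'] by simp
  qed
  then have "bij_betw (c(a := b)) (insert a A) B" using B(1) by simp
  moreover have "\<forall>x\<in>insert a A. g ((c(a := b)) x) = f x" using c(2) b insert.hyps by auto
  ultimately show ?case by blast
qed

(* The isomorphism is built downwards from the root: the children of u are matched with those of the
   image of u by a shape-preserving bijection. *)
lemma same_shape_embedding:
  assumes R: "rooted V r p" and sh: "shape_fun V r p sh"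
    and R': "rooted V' r' p'" and sh': "shape_fun V' r' p' sh'" and eq: "sh r = sh' r'"
  shows "\<exists>f. inj_on f V \<and> f ` V \<subseteq> V' \<and> f r = r' \<and> f ` (V - {r}) \<subseteq> V' - {r'} \<and> (\<forall>v\<in>V-{r}. p' (f v) = f (p v))"
proof -
  let ?C = "children V r p" and ?C' = "children V' r' p'"
  have "\<exists>b. bij_betw b (?C u) (?C' u') \<and> (\<forall>w\<in>?C u. sh' (b w) = sh w)"
    if "u \<in> V" "u' \<in> V'" "sh u = sh' u'" for u u'
    using that shape_funD[OF sh that(1)] shape_funD[OF sh' that(2)] finite_children[OF R] finite_children[OF R']
    by (intro image_mset_eq_imp_bij) auto
  then obtain \<beta> where \<beta>: "\<And>u u'. u \<in> V \<Longrightarrow> u' \<in> V' \<Longrightarrow> sh u = sh' u' \<Longrightarrow>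
      bij_betw (\<beta> u u') (?C u) (?C' u') \<and> (\<forall>w\<in>?C u. sh' (\<beta> u u' w) = sh w)"
    by metis
  obtain h :: "'a \<Rightarrow> nat" where h: "\<And>v. v \<in> V-{r} \<Longrightarrow> h (p v) < h v"
    using R by (auto simp: rooted_def)
  define f where "f = wfrec (measure h) (\<lambda>f v. if v = r then r' else \<beta> (p v) (f (p v)) v)"
  have fr: "f r = r'" unfolding f_def by (subst wfrec[OF wf_measure]) simp
  have fv: "f v = \<beta> (p v) (f (p v)) v" if "v \<in> V - {r}" for v
  proof -
    have "(p v, v) \<in> measure h" using h[OF that] by simp
    then show ?thesis unfolding f_def
      by (subst wfrec[OF wf_measure]) (use that in \<open>simp add: cut_apply\<close>)
  qed
  have pV: "p v \<in> V" "v \<in> ?C (p v)" if "v \<in> V - {r}" for v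
    using that R by (auto simp: rooted_def children_def)
  have f: "f v \<in> V' \<and> sh' (f v) = sh v" if "v \<in> V" for v
    using R that
  proof (induction rule: rooted_induct)
    case root
    then show ?case using fr eq R' by (simp add: rooted_def)
  next
    case (step v)
    then have b: "bij_betw (\<beta> (p v) (f (p v))) (?C (p v)) (?C' (f (p v)))"
        "\<forall>w\<in>?C (p v). sh' (\<beta> (p v) (f (p v)) w) = sh w"
      using \<beta>[of "p v" "f (p v)"] pV[OF step(1)] by auto
    have "\<beta> (p v) (f (p v)) v \<in> ?C' (f (p v))"
      using b(1) pV(2)[OF step(1)] by (rule bij_betwE[rule_format])
    then show ?case using b(2) pV(2)[OF step(1)] fv[OF step(1)] children_subset by fastforce
  qed
  have bij: "bij_betw (\<beta> u (f u)) (?C u) (?C' (f u))" if "u \<in> V" for u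
    using \<beta>[of u "f u"] f[OF that] that by simp
  have fC: "f v \<in> ?C' (f (p v))" if "v \<in> V - {r}" for v
    unfolding fv[OF that] using bij[OF pV(1)[OF that]] pV(2)[OF that] by (rule bij_betwE[rule_format])
  then have f': "f v \<in> V' - {r'}" "p' (f v) = f (p v)" if "v \<in> V - {r}" for v
    using that by (auto simp: children_def)
  \<comment> \<open>Injectivity by induction from the root: equal images have parents with equal
    images, hence equal parents, and siblings are separated by the injective
    \<open>\<beta>\<close>.\<close>
  have "\<forall>w\<in>V. f v = f w \<longrightarrow> v = w" if "v \<in> V" for v
    using R that
  proof (induction rule: rooted_induct)
    case root
    then show ?case using f'(1) fr by force
  next
    case (step v)
    show ?case
    proof (intro ballI impI)
      fix w assume w: "w \<in> V" "f v = f w"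
      then have wr: "w \<in> V - {r}" using f'(1)[OF step(1)] fr by auto
      have "f (p v) = f (p w)" using f'(2)[OF step(1)] f'(2)[OF wr] w(2) by simp
      then have pp: "p v = p w" using step(2) pV(1)[OF wr] by blast
      have "inj_on (\<beta> (p v) (f (p v))) (?C (p v))" using bij[OF pV(1)[OF step(1)]] by (rule bij_betw_imp_inj_on)
      moreover have "\<beta> (p v) (f (p v)) v = \<beta> (p v) (f (p v)) w"
        using fv[OF step(1)] fv[OF wr] w(2) pp by simp
      ultimately show "v = w" using pV(2)[OF step(1)] pV(2)[OF wr] pp by (auto dest: inj_onD)
    qed
  qed
  then have "inj_on f V" by (auto intro: inj_onI)
  then show ?thesis using f f' fr by (intro exI[of _ f]) auto
qed

definition has_shape :: "'a pair_pre_digraph \<Rightarrow> 'a \<Rightarrow> rtree \<Rightarrow> bool" where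
  "has_shape G v t \<longleftrightarrow> (\<exists>p sh. rooted (pverts G) v p \<and> G = tree_of (pverts G) v p \<and>
     shape_fun (pverts G) v p sh \<and> sh v = t)"

lemma has_shape_exists:
  assumes "simple_tree G" "v \<in> pverts G"
  shows "\<exists>t. has_shape G v t"
  using simple_tree_ex_parent[OF assms] shape_fun_exists unfolding has_shape_def by metis

lemma has_shape_unique:
  assumes "has_shape G v t" "has_shape G v t'"
  shows "t = t'"
proof -
  let ?V = "pverts G"
  obtain p sh where 1: "rooted ?V v p" "G = tree_of ?V v p" "shape_fun ?V v p sh" "sh v = t"
    using assms(1) by (auto simp: has_shape_def)
  obtain p' sh' where 2: "rooted ?V v p'" "G = tree_of ?V v p'" "shape_fun ?V v p' sh'" "sh' v = t'"
    using assms(2) by (auto simp: has_shape_def)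
  have "tree_of ?V v p = tree_of ?V v p'" using 1(2) 2(2) by simp
  then have "p w = p' w" if "w \<in> ?V - {v}" for w
    using tree_of_parent_unique[OF 1(1) 2(1)] that by blast
  then have "children ?V v p = children ?V v p'" by (auto simp: children_def fun_eq_iff)
  then have "shape_fun ?V v p sh'" using 2(3) by (simp add: shape_fun_def)
  from shape_fun_unique[OF 1(1,3) this, of v] show ?thesis
    using 1(1,4) 2(4) by (simp add: rooted_def)
qed

lemma has_shape_nodes:
  assumes "has_shape G v t"
  shows "nodes t = card (pverts G)"
proof -
  obtain p sh where 1: "rooted (pverts G) v p" "shape_fun (pverts G) v p sh" "sh v = t"
    using assms by (auto simp: has_shape_def)
  have "nodes (sh v) = (\<Sum>u\<in>pverts G. 1)"
    by (rule shape_fun_sum[OF 1(1,2)]) simp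
  then show ?thesis using 1(3) by simp
qed

lemma has_shape_unbalanced:
  assumes "has_shape G v t" "\<not> balanced G"
  shows "unaries t < width t"
proof -
  let ?V = "pverts G"
  obtain p sh where 1: "rooted ?V v p" "G = tree_of ?V v p" "shape_fun ?V v p sh" "sh v = t"
    using assms(1) by (auto simp: has_shape_def)
  obtain w where w: "w \<in> ?V" "card (unary ?V v p) < card (children ?V v p w)"
    using not_balanced_few_unary[OF 1(1)] 1(2) assms(2) by auto
  have "unaries (sh v) = (\<Sum>u\<in>?V. if card (children ?V v p u) = 1 then 1 else 0)"
    by (rule shape_fun_sum[OF 1(1,3)]) simp
  also have "\<dots> = card (unary ?V v p)"
    using 1(1) by (simp add: unary_def rooted_def sum.If_cases Int_def)
  finally show ?thesis
    using w(2) card_children_le_width[OF 1(1,3) w(1)] 1(4) by simp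
qed

lemma tree_of_image:
  assumes "\<And>v. v \<in> V - {r} \<Longrightarrow> p' (f v) = f (p v)" "inj_on f V" "r \<in> V"
  shows "parcs (tree_of (f ` V) (f r) p') = map_prod f f ` parcs (tree_of V r p)"
proof -
  have "f ` V - {f r} = f ` (V - {r})" using assms(2,3) by (auto dest: inj_onD)
  then show ?thesis using assms(1) by (simp add: image_UN)
qed

text \<open>The embedding given by equal shapes is onto, since both trees have
  \<open>nodes t\<close> vertices.\<close>

lemma has_shape_iso:
  assumes "has_shape G v t" "has_shape H w t"
  shows "digraph_iso (with_proj G) (with_proj H)"
proof -
  obtain p sh where 1: "rooted (pverts G) v p" "G = tree_of (pverts G) v p" "shape_fun (pverts G) v p sh" "sh v = t"
    using assms(1) by (auto simp: has_shape_def)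
  obtain p' sh' where 2: "rooted (pverts H) w p'" "H = tree_of (pverts H) w p'" "shape_fun (pverts H) w p' sh'" "sh' w = t"
    using assms(2) by (auto simp: has_shape_def)
  obtain f where f: "inj_on f (pverts G)" "f ` pverts G \<subseteq> pverts H" "f v = w"
      "\<And>u. u \<in> pverts G - {v} \<Longrightarrow> p' (f u) = f (p u)"
    using same_shape_embedding[OF 1(1,3) 2(1,3)] 1(4) 2(4) by auto
  have "card (f ` pverts G) = card (pverts H)"
    using has_shape_nodes[OF assms(1)] has_shape_nodes[OF assms(2)] f(1) by (simp add: card_image)
  then have im: "pverts H = f ` pverts G"
    using f(2) 2(1) by (intro card_subset_eq[symmetric]) (auto simp: rooted_def)
  have v: "v \<in> pverts G" using 1(1) by (simp add: rooted_def)
  have "parcs H = parcs (tree_of (f ` pverts G) (f v) p')" using 2(2) im f(3) by metis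
  also have "\<dots> = map_prod f f ` parcs (tree_of (pverts G) v p)"
    by (rule tree_of_image[of "pverts G" v p' f p, OF f(4,1) v])
  finally have "parcs H = map_prod f f ` parcs G" using 1(2) by metis
  moreover have "pair_graph G" using pair_graph_tree_of[OF 1(1)] 1(2) by metis
  ultimately show ?thesis using f(1) im by (auto simp: pair_graph_digraph_iso_iff)
qed

lemma has_shape_image:
  assumes "has_shape G v t" "inj_on f (pverts G)" "pverts H = f ` pverts G" "parcs H = map_prod f f ` parcs G"
  shows "has_shape H (f v) t"
proof -
  let ?V = "pverts G"
  obtain p sh where 1: "rooted ?V v p" "G = tree_of ?V v p" "shape_fun ?V v p sh" "sh v = t"
    using assms(1) by (auto simp: has_shape_def)
  have v: "v \<in> ?V" and pV: "\<And>u. u \<in> ?V - {v} \<Longrightarrow> p u \<in> ?V" and fin: "finite ?V" using 1(1) by (auto simp: rooted_def)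
  define g where "g = the_inv_into ?V f"
  have g: "g (f u) = u" if "u \<in> ?V" for u using that assms(2) by (simp add: g_def the_inv_into_f_f)
  define p' where "p' = f \<circ> p \<circ> g"
  have V': "f ` ?V - {f v} = f ` (?V - {v})" using assms(2) v by (auto dest: inj_onD)
  have p': "p' (f u) = f (p u)" if "u \<in> ?V - {v}" for u using that by (simp add: p'_def g)
  have R': "rooted (f ` ?V) (f v) p'"
  proof -
    obtain h :: "'a \<Rightarrow> nat" where h: "\<And>u. u \<in> ?V-{v} \<Longrightarrow> h (p u) < h u"
      using 1(1) by (auto simp: rooted_def)
    have "\<forall>x\<in>f ` ?V - {f v}. p' x \<in> f ` ?V" unfolding V' using p' pV by auto
    moreover have "\<forall>x\<in>f ` ?V - {f v}. (h \<circ> g) (p' x) < (h \<circ> g) x"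
      unfolding V' using p' pV g h by auto
    ultimately show ?thesis using fin v unfolding rooted_def by blast
  qed
  have ch: "children (f ` ?V) (f v) p' (f u) = f ` children ?V v p u" if u: "u \<in> ?V" for u
  proof -
    have "f (p w) = f u \<longleftrightarrow> p w = u" if "w \<in> ?V - {v}" for w
      using inj_on_eq_iff[OF assms(2) pV[OF that] u] .
    then show ?thesis unfolding children_def V' using p' by auto
  qed
  have "shape_fun (f ` ?V) (f v) p' (sh \<circ> g)"
    unfolding shape_fun_def
  proof (intro ballI)
    fix x assume "x \<in> f ` ?V"
    then obtain u where u: "u \<in> ?V" "x = f u" by auto
    let ?C = "children ?V v p u"
    have C: "?C \<subseteq> ?V" "finite ?C" using children_subset[of ?V v p u] finite_children[OF 1(1)] by auto
    have "image_mset (sh \<circ> g) (mset_set (f ` ?C)) = image_mset (sh \<circ> g) (image_mset f (mset_set ?C))"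
      using assms(2) C by (subst image_mset_mset_set) (auto intro: inj_on_subset)
    also have "\<dots> = image_mset sh (mset_set ?C)"
      unfolding image_mset.compositionality using C g by (intro image_mset_cong) auto
    finally show "(sh \<circ> g) x = Node (image_mset (sh \<circ> g) (mset_set (children (f ` ?V) (f v) p' x)))"
      using shape_funD[OF 1(3) u(1)] ch[OF u(1)] by (simp add: u(2) g[OF u(1)])
  qed
  moreover have "H = tree_of (f ` ?V) (f v) p'"
  proof -
    have "parcs H = parcs (tree_of (f ` ?V) (f v) p')"
      using assms(4) 1(2) tree_of_image[of ?V v p' f p, OF p' assms(2) v] by metis
    then show ?thesis using assms(3) by (cases H) (simp add: tree_of_def)
  qed
  ultimately show ?thesis
    unfolding has_shape_def assms(3) using R' 1(4) g[OF v] by (intro exI[of _ p'] exI[of _ "sh \<circ> g"]) auto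
qed

text \<open>Vertices are addresses: the list of child positions on the way from the root, so that
  the parent is \<open>butlast\<close> for every tree at once. A node prefixes the addresses of its
  \<open>i\<close>-th subtree with \<open>i\<close>.\<close>

lemma shape_realization:
  "\<exists>V sh. rooted V [] butlast \<and> shape_fun V [] butlast sh \<and> sh ([] :: nat list) = t"
proof (induction t)
  case (Node M)
  obtain ts where ts: "mset ts = M" using ex_mset by blast
  define k where "k = length ts"
  have "\<forall>i\<in>{..<k}. \<exists>V sh. rooted V [] butlast \<and> shape_fun V [] butlast sh \<and> sh ([] :: nat list) = ts ! i"
    using Node ts by (auto simp: k_def)
  then obtain W s where W: "\<And>i. i < k \<Longrightarrow> rooted (W i) [] butlast"
    and s: "\<And>i. i < k \<Longrightarrow> shape_fun (W i) [] butlast (s i)" "\<And>i. i < k \<Longrightarrow> s i ([] :: nat list) = ts ! i"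
    by (metis lessThan_iff)
  define V where "V = insert [] (\<Union>i<k. (#) i ` W i)"
  define sh where "sh v = (case v of [] \<Rightarrow> Node M | i # w \<Rightarrow> s i w)" for v
  have nil: "[] \<in> W i" "finite (W i)" if "i < k" for i using W[OF that] by (auto simp: rooted_def)
  have "\<forall>v\<in>V - {[]}. length (butlast v) < length v" by auto
  moreover have "butlast v \<in> V" if vV: "v \<in> V - {[]}" for v
  proof -
    obtain i w where v: "v = i # w" "i < k" "w \<in> W i" using vV unfolding V_def by blast
    show ?thesis
    proof (cases "w = []")
      case False
      then have "butlast w \<in> W i" using W[OF v(2)] v(3) by (auto simp: rooted_def)
      then show ?thesis using v False by (auto simp: V_def)
    qed (simp add: v V_def)
  qed
  moreover have "finite V" "[] \<in> V" using nil by (simp_all add: V_def)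
  ultimately have R: "rooted V [] butlast"
    unfolding rooted_def by blast
  have root: "children V [] butlast [] = (\<lambda>i. [i]) ` {..<k}"
    using nil by (auto simp: children_def V_def butlast_conv_take take_eq_Nil)
  have child: "children V [] butlast (i # w) = (#) i ` children (W i) [] butlast w" if "i < k" for i w
    using that by (auto simp: children_def V_def split: if_splits)
  have "shape_fun V [] butlast sh"
    unfolding shape_fun_def
  proof (intro ballI)
    fix v assume v: "v \<in> V"
    show "sh v = Node (image_mset sh (mset_set (children V [] butlast v)))"
    proof (cases v)
      case Nil
      have "image_mset sh (mset_set ((\<lambda>i. [i]) ` {..<k})) = image_mset sh (image_mset (\<lambda>i. [i]) (mset_set {..<k}))"
        by (subst image_mset_mset_set) (auto intro: inj_onI)
      also have "\<dots> = image_mset ((!) ts) (mset_set {..<k})"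
        unfolding image_mset.compositionality using s(2) by (intro image_mset_cong) (auto simp: sh_def)
      also have "\<dots> = mset (map ((!) ts) [0..<k])" by (simp add: lessThan_atLeast0)
      also have "\<dots> = M" using ts by (simp add: k_def map_nth)
      finally show ?thesis using Nil by (simp add: root sh_def)
    next
      case (Cons i w)
      then have i: "i < k" "w \<in> W i" using v by (auto simp: V_def)
      let ?C = "children (W i) [] butlast w"
      have "image_mset sh (mset_set ((#) i ` ?C)) = image_mset sh (image_mset ((#) i) (mset_set ?C))"
        by (subst image_mset_mset_set) (auto intro: inj_onI)
      also have "\<dots> = image_mset (s i) (mset_set ?C)"
        unfolding image_mset.compositionality by (intro image_mset_cong) (auto simp: sh_def)
      finally show ?thesis
        using shape_funD[OF s(1)[OF i(1)] i(2)] by (simp add: Cons child[OF i(1)] sh_def)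
    qed
  qed
  moreover have "sh [] = Node M" by (simp add: sh_def)
  ultimately show ?case using R by blast
qed

lemma labeled_tree_with_shape:
  assumes "nodes t = n"
  shows "\<exists>G\<in>labeled_trees n. \<exists>v\<in>{1..n}. has_shape G v t"
proof -
  obtain V sh where V: "rooted V [] butlast" "shape_fun V [] butlast sh" "sh ([] :: nat list) = t"
    using shape_realization by blast
  let ?G = "tree_of V [] butlast"
  have G: "has_shape ?G [] t" unfolding has_shape_def using V by auto
  have "card V = n" using has_shape_nodes[OF G] assms by simp
  moreover have fin: "finite V" using V(1) by (simp add: rooted_def)
  ultimately obtain f where f: "bij_betw f V {1..n}"
    using finite_same_card_bij[of V "{1..n}"] by auto
  define H where "H = \<lparr>pverts = {1..n}, parcs = map_prod f f ` parcs ?G\<rparr>"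
  have H: "has_shape H (f []) t"
    using f by (intro has_shape_image[OF G]) (auto simp: H_def bij_betw_def)
  then obtain p where p: "rooted (pverts H) (f []) p" "H = tree_of (pverts H) (f []) p"
    by (auto simp: has_shape_def)
  from simple_tree_tree_of[OF p(1)] have "simple_tree H" using p(2) by simp
  moreover have "pverts H = {1..n}" by (simp add: H_def)
  ultimately have "H \<in> labeled_trees n" "f [] \<in> {1..n}"
    using p(1) by (simp_all add: labeled_trees_def rooted_def)
  then show ?thesis using H by blast
qed


section \<open>Comparing isomorphism classes with rooted trees\<close>

lemma finite_unlabeled_trees: "finite (unlabeled_trees n)"
  unfolding unlabeled_trees_def quotient_def using finite_labeled_trees by simp

definition representative :: "nat pair_pre_digraph set \<Rightarrow> nat pair_pre_digraph" where
  "representative C = (SOME G. G \<in> C)"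

lemma representative:
  assumes "C \<in> unlabeled_trees n"
  shows "representative C \<in> C" "representative C \<in> labeled_trees n"
proof -
  have "C \<noteq> {}"
    using assms equiv_tree_iso in_quotient_imp_non_empty unfolding unlabeled_trees_def by blast
  then show "representative C \<in> C" unfolding representative_def by (simp add: some_in_eq)
  moreover have "C \<subseteq> labeled_trees n"
    using assms equiv_tree_iso in_quotient_imp_subset unfolding unlabeled_trees_def by blast
  ultimately show "representative C \<in> labeled_trees n" by blast
qed

text \<open>Every rooted tree arises from an isomorphism class by choosing a root in its
  representative, which leaves \<open>n\<close> choices.\<close>

lemma num_rtrees_le: "num_rtrees n \<le> n * card (unlabeled_trees n)"
proof -
  let ?t = "\<lambda>(C, v). THE t. has_shape (representative C) v t"
  have "{T. nodes T = n} \<subseteq> ?t ` (unlabeled_trees n \<times> {1..n})"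
  proof
    fix T assume "T \<in> {T. nodes T = n}"
    then obtain G v where G: "G \<in> labeled_trees n" "has_shape G v T"
      using labeled_tree_with_shape by blast
    define C where "C = tree_iso n `` {G}"
    have C: "C \<in> unlabeled_trees n" "G \<in> C"
      unfolding C_def unlabeled_trees_def using G(1) equiv_class_self[OF equiv_tree_iso] by (auto intro: quotientI)
    let ?H = "representative C"
    have H: "?H \<in> C" "?H \<in> labeled_trees n" by (rule representative[OF C(1)])+
    have "digraph_iso (with_proj G) (with_proj ?H)"
      using H(1) by (auto simp: C_def tree_iso_def)
    moreover have pg: "pair_graph G" using G(1) by (simp add: labeled_trees_def simple_tree_def)
    ultimately obtain f where f: "inj_on f (pverts G)" "pverts ?H = f ` pverts G" "parcs ?H = map_prod f f ` parcs G"
      by (auto simp: pair_graph_digraph_iso_iff)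
    have S: "has_shape ?H (f v) T" by (rule has_shape_image[OF G(2) f])
    then have "T = ?t (C, f v)" using has_shape_unique by (auto intro!: the_equality[symmetric])
    moreover have "f v \<in> {1..n}"
      using S H(2) by (auto simp: has_shape_def rooted_def labeled_trees_def)
    ultimately show "T \<in> ?t ` (unlabeled_trees n \<times> {1..n})" using C(1) by blast
  qed
  then have "num_rtrees n \<le> card (unlabeled_trees n \<times> {1..n})"
    unfolding num_rtrees_def using finite_unlabeled_trees
    by (intro surj_card_le) auto
  then show ?thesis by (simp add: card_cartesian_product mult.commute)
qed

text \<open>Each class is sent to the shape of its representative rooted at 1. Equal shapes force
  isomorphic representatives, so this is injective, and an unbalanced tree has a narrow shape from
  any root.\<close>

lemma card_unbalanced_unlabeled_trees_le:
  assumes n: "n \<ge> 1"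
  shows "card (unlabeled_trees n - balanced_unlabeled_trees n) \<le> card (narrowly_unary n)"
proof -
  let ?U = "unlabeled_trees n - balanced_unlabeled_trees n"
  have "\<exists>t. has_shape (representative C) 1 t" if "C \<in> unlabeled_trees n" for C
    using representative(2)[OF that] n by (intro has_shape_exists) (auto simp: labeled_trees_def)
  then obtain t where t: "\<And>C. C \<in> unlabeled_trees n \<Longrightarrow> has_shape (representative C) 1 (t C)"
    by metis
  have "inj_on t ?U"
  proof (rule inj_onI)
    fix C D assume CD: "C \<in> ?U" "D \<in> ?U" "t C = t D"
    then have "digraph_iso (with_proj (representative C)) (with_proj (representative D))"
      using t[of C] t[of D] by (auto intro: has_shape_iso)
    then have "(representative C, representative D) \<in> tree_iso n"
      using representative(2) CD by (simp add: tree_iso_def)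
    then show "C = D"
      using quotient_eq_iff[OF equiv_tree_iso] representative(1) CD unfolding unlabeled_trees_def by blast
  qed
  moreover have "t ` ?U \<subseteq> narrowly_unary n"
  proof
    fix T assume "T \<in> t ` ?U"
    then obtain C where C: "C \<in> ?U" "T = t C" by auto
    have S: "has_shape (representative C) 1 T" using t C by auto
    have "representative C \<in> C" "representative C \<in> labeled_trees n" using representative C(1) by auto
    then have "\<not> balanced (representative C)" "pverts (representative C) = {1..n}"
      using C(1) by (auto simp: balanced_unlabeled_trees_def labeled_trees_def)
    then show "T \<in> narrowly_unary n"
      using has_shape_unbalanced[OF S] has_shape_nodes[OF S] by (simp add: narrowly_unary_def)
  qed
  moreover have "finite (narrowly_unary n)"
    by (rule finite_subset[OF _ finite_nodes_eq[of n]]) (auto simp: narrowly_unary_def)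
  ultimately show ?thesis by (rule card_inj_on_le)
qed

lemma unlabeled_trees_limit:
  "(\<lambda>n. real (card (balanced_unlabeled_trees n)) / real (card (unlabeled_trees n))) \<longlonglongrightarrow> 1"
proof -
  define u where "u n = real (card (unlabeled_trees n - balanced_unlabeled_trees n)) / real (card (unlabeled_trees n))" for n
  have pos: "0 < card (unlabeled_trees n)" if "n \<ge> 1" for n
    using num_rtrees_le[of n] num_rtrees_pos[OF that] by (cases "card (unlabeled_trees n)") auto
  have bound: "u n \<le> real n * real (card (narrowly_unary n)) / real (num_rtrees n)" if n: "n \<ge> 1" for n
  proof -
    have r: "0 < real (num_rtrees n)" using num_rtrees_pos[OF n] by simp
    have "u n \<le> real (card (narrowly_unary n)) / real (card (unlabeled_trees n))"
      unfolding u_def using card_unbalanced_unlabeled_trees_le[OF n] by (intro divide_right_mono) auto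
    also have "\<dots> = real n * real (card (narrowly_unary n)) / (real n * real (card (unlabeled_trees n)))"
      using n by simp
    also have "\<dots> \<le> real n * real (card (narrowly_unary n)) / real (num_rtrees n)"
    proof (rule divide_left_mono)
      show "real (num_rtrees n) \<le> real n * real (card (unlabeled_trees n))"
        using num_rtrees_le[of n] by (metis of_nat_le_iff of_nat_mult)
    qed (use r pos[OF n] n in auto)
    finally show ?thesis .
  qed
  have "u \<longlonglongrightarrow> 0"
    by (rule tendsto_sandwich[OF _ _ tendsto_const narrowly_unary_rare])
       (use bound in \<open>auto simp: u_def intro!: eventually_sequentiallyI[of 1]\<close>)
  then have "(\<lambda>n. 1 - u n) \<longlonglongrightarrow> 1 - 0" by (intro tendsto_intros)
  moreover have "\<forall>\<^sub>F n in sequentially. 1 - u n = real (card (balanced_unlabeled_trees n)) / real (card (unlabeled_trees n))"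
  proof (rule eventually_sequentiallyI[of 1])
    fix n :: nat assume n: "1 \<le> n"
    have sub: "balanced_unlabeled_trees n \<subseteq> unlabeled_trees n" by (auto simp: balanced_unlabeled_trees_def)
    then have "card (unlabeled_trees n - balanced_unlabeled_trees n) = card (unlabeled_trees n) - card (balanced_unlabeled_trees n)"
      "card (balanced_unlabeled_trees n) \<le> card (unlabeled_trees n)"
      using finite_unlabeled_trees[of n] by (simp_all add: card_Diff_subset finite_subset card_mono)
    then show "1 - u n = real (card (balanced_unlabeled_trees n)) / real (card (unlabeled_trees n))"
      using pos[OF n] by (simp add: u_def field_simps)
  qed
  ultimately show ?thesis using tendsto_cong by force
qed

theorem theoremA:
  shows "(\<lambda>n. real (card (balanced_labeled_trees n)) / real (card (labeled_trees n)))
           \<longlonglongrightarrow> 1 \<and>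
         (\<lambda>n. real (card (balanced_unlabeled_trees n)) / real (card (unlabeled_trees n)))
           \<longlonglongrightarrow> 1"
  using labeled_trees_limit unlabeled_trees_limit ..

end
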